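(* For any $y\ge1$ and any $t>0$ let $L_{y,t}\subset\mathbb R^3$ be the body-centred-orthorhombic lattice defined in the context, i.e. the anisotropic dilation of the BCC lattice (based on the unit cube) along the coordinate axes by $\sqrt y$, $1/\sqrt y$ and $t$. Then: 1. For any $t>0$ and any $\alpha>0$, a minimizer of $y\mapsto\theta_{L_{y,t}}(\alpha)$ belongs to $[1,\sqrt3]$. 2. For any $\alpha>0$, there exists $t_0(\alpha)>0$ such that for any $t<t_0(\alpha)$, $y=1$ is not a minimizer of $y\mapsto\theta_{L_{y,t}}(\alpha)$. 3. For any $t<\sqrt2$, there exists $\alpha_t$ such that for any $\alpha>\alpha_t$, $y=1$ is not a minimizer of $y\mapsto\theta_{L_{y,t}}(\alpha)$. In particular, for $t=1$, there exists $\alpha_1$ such that (a) for $\alpha>\alpha_1$, the BCC lattice is not a local minimizer of $\Lambda\mapsto\theta_\Lambda(\alpha)$ among Bravais lattices of unit density, (b) for $\alpha<1/\alpha_1$, the FCC lattice is not a local minimizer of $\Lambda\mapsto\theta_\Lambda(\alpha)$ among Bravais lattices of unit density. Numerically, one computes $\alpha_1\approx2.38$, and $\alpha_1^{-1}\approx0.42$. 4. For $\alpha=1$ and any $t\ge0.9$, $y=1$ is the only minimizer of $y\mapsto\theta_{L_{y,t}}(\alpha)$. In particular, for $t=1$, the BCC lattice is the only minimizer of $\Lambda\mapsto\theta_\Lambda(1)$ among the Bravais lattices $(L_{y,1})_{y\ge1}$.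
   Context: A Bravais lattice in $\mathbb R^3$ is the $\mathbb Z$-span of a basis of $\mathbb R^3$; $\theta_\Lambda(\alpha)=\sum_{p\in\Lambda}e^{-\pi\alpha|p|^2}$ for $\alpha>0$. Throughout, $t>0$, $\alpha>0$, and the variable $y$ ranges over $[1,+\infty)$. The lattice $L_{y,t}$ is $$L_{y,t}=\bigcup_{k\in\mathbb Z}\Big(\mathbb Z(\sqrt y,0,0)+\mathbb Z\big(0,\tfrac1{\sqrt y},0\big)+\mathbf s(k)+k\,(0,0,t/2)\Big),$$ where $\mathbf s(k)=\big(\tfrac{\sqrt y}2,\tfrac1{2\sqrt y},0\big)$ if $k$ is odd and $\mathbf s(k)=0$ if $k$ is even. BCC based on the unit cube is $\mathbb Z^3\cup(\mathbb Z^3+(1/2,1/2,1/2))=L_{1,1}$; FCC based on the unit cube is $\bigcup\{\mathbb Z^3+\tau:\tau\in\{(0,0,0),(1/2,1/2,0),(1/2,0,1/2),(0,1/2,1/2)\}\}$. In item 3(a),(b), BCC and FCC denote the rescalings of these lattices having density one. *)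

theory Defs
  imports "HOL-Analysis.Analysis"
begin

section \<open>Bravais lattices and the lattice theta function\<close>

text \<open>The columns of \<open>B\<close> are the generating vectors.\<close>

definition lattice_of :: "real^3^3 \<Rightarrow> (real^3) set" where
  "lattice_of B = range (\<lambda>n :: int^3. B *v (\<chi> i. of_int (n $ i)))"

definition bravais_lattice :: "(real^3) set \<Rightarrow> bool" where
  "bravais_lattice \<Lambda> \<longleftrightarrow> (\<exists>B. invertible B \<and> \<Lambda> = lattice_of B)"

text \<open>The density of a lattice is the reciprocal of the volume of a fundamental cell, and that
  volume is the same for all bases of the lattice.\<close>

definition unit_density :: "(real^3) set \<Rightarrow> bool" where
  "unit_density \<Lambda> \<longleftrightarrow> (\<exists>B. \<bar>det B\<bar> = 1 \<and> \<Lambda> = lattice_of B)"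

definition lattice_theta :: "(real^3) set \<Rightarrow> real \<Rightarrow> real" where
  "lattice_theta \<Lambda> \<alpha> = (\<Sum>\<^sub>\<infinity>p\<in>\<Lambda>. exp (- pi * \<alpha> * (norm p)\<^sup>2))"

section \<open>Local minimality in the space of lattices\<close>

text \<open>The space of Bravais lattices carries the quotient topology of the space of bases:
  a set of lattices is open iff the set of all bases of its members is open.\<close>

definition lattice_topology :: "(real^3) set topology" where
  "lattice_topology =
     topology (\<lambda>U. U \<subseteq> Collect bravais_lattice \<and> open {B. invertible B \<and> lattice_of B \<in> U})"

definition local_minimizer :: "'a topology \<Rightarrow> ('a \<Rightarrow> real) \<Rightarrow> 'a \<Rightarrow> bool" where
  "local_minimizer T F x \<longleftrightarrow>
     x \<in> topspace T \<and> (\<exists>U. openin T U \<and> x \<in> U \<and> (\<forall>y\<in>U. F x \<le> F y))"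

abbreviation unit_density_lattices :: "(real^3) set topology" where
  "unit_density_lattices \<equiv> subtopology lattice_topology (Collect unit_density)"

section \<open>The lattices BCC, FCC and \<open>L\<^sub>y\<^sub>,\<^sub>t\<close>\<close>

definition cubic_lattice :: "(real^3) set" where
  "cubic_lattice = {p. \<forall>i. p $ i \<in> \<int>}"

definition bcc :: "(real^3) set" where
  "bcc = cubic_lattice \<union> (+) (vector [1/2, 1/2, 1/2]) ` cubic_lattice"

definition fcc :: "(real^3) set" where
  "fcc = (\<Union>\<tau> \<in> {vector [0, 0, 0], vector [1/2, 1/2, 0], vector [1/2, 0, 1/2], vector [0, 1/2, 1/2]}.
            (+) \<tau> ` cubic_lattice)"

text \<open>The lattices \<open>bcc\<close> and \<open>fcc\<close> have \<open>2\<close> and \<open>4\<close> points per unit cube; see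
  \<open>unit_density_bcc_unit\<close> and \<open>unit_density_fcc_unit\<close> below.\<close>

definition bcc_unit :: "(real^3) set" where
  "bcc_unit = (*\<^sub>R) (root 3 2) ` bcc"

definition fcc_unit :: "(real^3) set" where
  "fcc_unit = (*\<^sub>R) (root 3 4) ` fcc"

definition bco_shift :: "real \<Rightarrow> int \<Rightarrow> real^3" where
  "bco_shift y k = (if odd k then vector [sqrt y / 2, 1 / (2 * sqrt y), 0] else 0)"

definition bco :: "real \<Rightarrow> real \<Rightarrow> (real^3) set" where
  "bco y t = (\<Union>k::int.
     {of_int m *\<^sub>R vector [sqrt y, 0, 0] + of_int n *\<^sub>R vector [0, 1 / sqrt y, 0]
        + bco_shift y k + of_int k *\<^sub>R vector [0, 0, t / 2] | m n :: int. True})"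

section \<open>Consistency of the definitions\<close>

lemma istopology_lattice:
  "istopology (\<lambda>U. U \<subseteq> Collect bravais_lattice \<and> open {B. invertible B \<and> lattice_of B \<in> U})"
proof -
  have *: "{B. invertible B \<and> lattice_of B \<in> S \<inter> T} =
      {B. invertible B \<and> lattice_of B \<in> S} \<inter> {B. invertible B \<and> lattice_of B \<in> T}" for S T
    by auto
  have **: "{B. invertible B \<and> lattice_of B \<in> \<Union>K} =
      (\<Union>U\<in>K. {B. invertible B \<and> lattice_of B \<in> U})" for K
    by auto
  show ?thesis
    unfolding istopology_def * ** by blast
qed

lemma openin_lattice_topology:
  "openin lattice_topology U \<longleftrightarrow>
     U \<subseteq> Collect bravais_lattice \<and> open {B. invertible B \<and> lattice_of B \<in> U}"
  unfolding lattice_topology_def by (simp add: topology_inverse'[OF istopology_lattice])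

lemma open_invertible: "open {B :: real^3^3. invertible B}"
proof -
  have "continuous_on UNIV (det :: real^3^3 \<Rightarrow> real)"
    unfolding det_3 by (intro continuous_intros)
  then have "open ((det :: real^3^3 \<Rightarrow> real) -` (- {0}))"
    by (intro open_vimage) auto
  then show ?thesis
    by (simp add: invertible_det_nz vimage_def)
qed

lemma topspace_lattice_topology: "topspace lattice_topology = Collect bravais_lattice"
proof -
  have "{B. invertible B \<and> lattice_of B \<in> Collect bravais_lattice} = {B. invertible B}"
    by (auto simp: bravais_lattice_def)
  then have "openin lattice_topology (Collect bravais_lattice)"
    by (simp add: openin_lattice_topology open_invertible)
  then show ?thesis
    by (metis openin_lattice_topology openin_subset openin_topspace subset_antisym)
qed

lemma unit_density_imp_bravais: "unit_density \<Lambda> \<Longrightarrow> bravais_lattice \<Lambda>"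
  unfolding unit_density_def bravais_lattice_def invertible_det_nz by force

lemma topspace_unit_density_lattices:
  "topspace unit_density_lattices = Collect unit_density"
  using unit_density_imp_bravais by (auto simp: topspace_subtopology topspace_lattice_topology)

lemma mem_lattice_of_iff:
  "p \<in> lattice_of B \<longleftrightarrow>
    (\<exists>a b c :: int. \<forall>i. p $ i = B $ i $ 1 * of_int a + B $ i $ 2 * of_int b + B $ i $ 3 * of_int c)"
proof
  assume "p \<in> lattice_of B"
  then obtain n :: "int^3" where "p = B *v (\<chi> i. of_int (n $ i))"
    unfolding lattice_of_def by blast
  then show "\<exists>a b c :: int. \<forall>i. p $ i = B $ i $ 1 * of_int a + B $ i $ 2 * of_int b + B $ i $ 3 * of_int c"
    by (intro exI[of _ "n $ 1"] exI[of _ "n $ 2"] exI[of _ "n $ 3"])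
       (simp add: matrix_vector_mult_def sum_3)
next
  assume "\<exists>a b c :: int. \<forall>i. p $ i = B $ i $ 1 * of_int a + B $ i $ 2 * of_int b + B $ i $ 3 * of_int c"
  then obtain a b c :: int where
    "\<forall>i. p $ i = B $ i $ 1 * of_int a + B $ i $ 2 * of_int b + B $ i $ 3 * of_int c"
    by blast
  then have "p = B *v (\<chi> i. of_int ((vector [a, b, c] :: int^3) $ i))"
    by (simp add: vec_eq_iff matrix_vector_mult_def sum_3)
  then show "p \<in> lattice_of B"
    unfolding lattice_of_def by blast
qed

lemma scaleR_lattice_of: "(*\<^sub>R) c ` lattice_of B = lattice_of (c *\<^sub>R B)"
  unfolding lattice_of_def image_image by (simp add: scaleR_matrix_vector_assoc)

lemma mem_cubic_translate_iff:
  "p \<in> (+) (vector [a, b, c]) ` cubic_lattice \<longleftrightarrow>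
     (\<exists>l m n :: int. p $ 1 = a + of_int l \<and> p $ 2 = b + of_int m \<and> p $ 3 = c + of_int n)"
proof -
  have "p \<in> (+) (vector [a, b, c]) ` cubic_lattice \<longleftrightarrow> p - vector [a, b, c] \<in> cubic_lattice"
    by (auto simp: image_iff algebra_simps intro!: bexI[of _ "p - vector [a, b, c]"])
  also have "\<dots> \<longleftrightarrow> p $ 1 - a \<in> \<int> \<and> p $ 2 - b \<in> \<int> \<and> p $ 3 - c \<in> \<int>"
    by (simp add: cubic_lattice_def forall_3)
  also have "\<dots> \<longleftrightarrow> (\<exists>l m n :: int. p $ 1 = a + of_int l \<and> p $ 2 = b + of_int m \<and> p $ 3 = c + of_int n)"
    by (auto simp: Ints_def algebra_simps)
  finally show ?thesis .
qed

lemma cubic_lattice_eq: "cubic_lattice = (+) (vector [0, 0, 0]) ` cubic_lattice"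
proof -
  have "(vector [0, 0, 0] :: real^3) = 0" by (simp add: vec_eq_iff forall_3)
  then show ?thesis by simp
qed

lemma bcc_eq_lattice_of:
  "bcc = lattice_of (vector [vector [1, 0, 1/2], vector [0, 1, 1/2], vector [0, 0, 1/2]])"
    (is "_ = lattice_of ?B")
proof (intro set_eqI iffI)
  fix p assume "p \<in> bcc"
  then consider l m n :: int where "p $ 1 = l" "p $ 2 = m" "p $ 3 = n"
    | l m n :: int where "p $ 1 = 1/2 + l" "p $ 2 = 1/2 + m" "p $ 3 = 1/2 + n"
    unfolding bcc_def by (subst (asm) cubic_lattice_eq) (auto simp: mem_cubic_translate_iff)
  then show "p \<in> lattice_of ?B"
  proof cases
    case 1
    then show ?thesis
      unfolding mem_lattice_of_iff forall_3
      by (intro exI[of _ "l - n"] exI[of _ "m - n"] exI[of _ "2 * n"]) simp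
  next
    case 2
    then show ?thesis
      unfolding mem_lattice_of_iff forall_3
      by (intro exI[of _ "l - n"] exI[of _ "m - n"] exI[of _ "2 * n + 1"]) (simp add: field_simps)
  qed
next
  fix p assume "p \<in> lattice_of ?B"
  then obtain a b c :: int where p: "p $ 1 = a + c / 2" "p $ 2 = b + c / 2" "p $ 3 = c / 2"
    unfolding mem_lattice_of_iff forall_3 by auto
  show "p \<in> bcc"
  proof (cases "even c")
    case True
    then obtain d where "c = 2 * d" by blast
    then have "p \<in> cubic_lattice"
      using p by (subst cubic_lattice_eq, unfold mem_cubic_translate_iff)
        (intro exI[of _ "a + d"] exI[of _ "b + d"] exI[of _ d], simp)
    then show ?thesis by (simp add: bcc_def)
  next
    case False
    then obtain d where "c = 2 * d + 1" by (metis oddE)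
    then have "p \<in> (+) (vector [1/2, 1/2, 1/2]) ` cubic_lattice"
      using p unfolding mem_cubic_translate_iff
      by (intro exI[of _ "a + d"] exI[of _ "b + d"] exI[of _ d]) (simp add: field_simps)
    then show ?thesis by (simp add: bcc_def)
  qed
qed

lemma fcc_eq_lattice_of:
  "fcc = lattice_of (vector [vector [1/2, 1/2, 0], vector [1/2, 0, 1/2], vector [0, 1/2, 1/2]])"
    (is "_ = lattice_of ?B")
proof (intro set_eqI iffI)
  fix p assume "p \<in> fcc"
  then consider l m n :: int where "p $ 1 = l" "p $ 2 = m" "p $ 3 = n"
    | l m n :: int where "p $ 1 = 1/2 + l" "p $ 2 = 1/2 + m" "p $ 3 = n"
    | l m n :: int where "p $ 1 = 1/2 + l" "p $ 2 = m" "p $ 3 = 1/2 + n"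
    | l m n :: int where "p $ 1 = l" "p $ 2 = 1/2 + m" "p $ 3 = 1/2 + n"
    unfolding fcc_def by (auto simp: mem_cubic_translate_iff)
  then show "p \<in> lattice_of ?B"
  proof cases
    case 1
    then show ?thesis
      unfolding mem_lattice_of_iff forall_3
      by (intro exI[of _ "l + m - n"] exI[of _ "l - m + n"] exI[of _ "m + n - l"]) (simp add: field_simps)
  next
    case 2
    then show ?thesis
      unfolding mem_lattice_of_iff forall_3
      by (intro exI[of _ "l + m - n + 1"] exI[of _ "l - m + n"] exI[of _ "m + n - l"]) (simp add: field_simps)
  next
    case 3
    then show ?thesis
      unfolding mem_lattice_of_iff forall_3
      by (intro exI[of _ "l + m - n"] exI[of _ "l - m + n + 1"] exI[of _ "m + n - l"]) (simp add: field_simps)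
  next
    case 4
    then show ?thesis
      unfolding mem_lattice_of_iff forall_3
      by (intro exI[of _ "l + m - n"] exI[of _ "l - m + n"] exI[of _ "m + n - l + 1"]) (simp add: field_simps)
  qed
next
  fix p assume "p \<in> lattice_of ?B"
  then obtain a b c :: int where p: "p $ 1 = (a + b) / 2" "p $ 2 = (a + c) / 2" "p $ 3 = (b + c) / 2"
    unfolding mem_lattice_of_iff forall_3 by (auto simp: field_simps)
  consider "even (a + b)" "even (a + c)" "even (b + c)"
    | "odd (a + b)" "odd (a + c)" "even (b + c)"
    | "odd (a + b)" "even (a + c)" "odd (b + c)"
    | "even (a + b)" "odd (a + c)" "odd (b + c)"
    by (cases "even a"; cases "even b"; cases "even c") simp_all
  then have "\<exists>l m n :: int. (a + b = 2 * l \<and> a + c = 2 * m \<and> b + c = 2 * n)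
      \<or> (a + b = 2 * l + 1 \<and> a + c = 2 * m + 1 \<and> b + c = 2 * n)
      \<or> (a + b = 2 * l + 1 \<and> a + c = 2 * m \<and> b + c = 2 * n + 1)
      \<or> (a + b = 2 * l \<and> a + c = 2 * m + 1 \<and> b + c = 2 * n + 1)"
    by cases (metis evenE oddE)+
  then obtain l m n :: int where
    "(a + b = 2 * l \<and> a + c = 2 * m \<and> b + c = 2 * n)
      \<or> (a + b = 2 * l + 1 \<and> a + c = 2 * m + 1 \<and> b + c = 2 * n)
      \<or> (a + b = 2 * l + 1 \<and> a + c = 2 * m \<and> b + c = 2 * n + 1)
      \<or> (a + b = 2 * l \<and> a + c = 2 * m + 1 \<and> b + c = 2 * n + 1)"
    by blast
  then have "(p $ 1 = l \<and> p $ 2 = m \<and> p $ 3 = n)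
      \<or> (p $ 1 = 1/2 + l \<and> p $ 2 = 1/2 + m \<and> p $ 3 = n)
      \<or> (p $ 1 = 1/2 + l \<and> p $ 2 = m \<and> p $ 3 = 1/2 + n)
      \<or> (p $ 1 = l \<and> p $ 2 = 1/2 + m \<and> p $ 3 = 1/2 + n)"
    unfolding p by (elim disjE conjE) (simp_all add: add_divide_distrib)
  then show "p \<in> fcc"
    unfolding fcc_def by (auto simp: mem_cubic_translate_iff)
qed

lemma unit_density_bcc_unit: "unit_density bcc_unit"
proof -
  have *: "root 3 2 * (root 3 2 * root 3 2) = (2 :: real)"
    using real_root_pow_pos2[of 3 2] by (simp add: power3_eq_cube mult.assoc)
  show ?thesis
    unfolding unit_density_def bcc_unit_def bcc_eq_lattice_of scaleR_lattice_of
    by (intro exI conjI[rotated], rule refl) (simp add: det_3 * mult.assoc)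
qed

lemma unit_density_fcc_unit: "unit_density fcc_unit"
proof -
  have *: "root 3 4 * (root 3 4 * root 3 4) = (4 :: real)"
    using real_root_pow_pos2[of 3 4] by (simp add: power3_eq_cube mult.assoc)
  show ?thesis
    unfolding unit_density_def fcc_unit_def fcc_eq_lattice_of scaleR_lattice_of
    by (intro exI conjI[rotated], rule refl) (simp add: det_3 *)
qed

text \<open>\<open>L\<^sub>y\<^sub>,\<^sub>t\<close> is the dilation of BCC along the coordinate axes by
  \<open>\<surd>y\<close>, \<open>1/\<surd>y\<close> and \<open>t\<close>.\<close>

lemma mem_bco_iff:
  "p \<in> bco y t \<longleftrightarrow> (\<exists>k m n :: int.
     p $ 1 = sqrt y * (of_int m + (if odd k then 1/2 else 0)) \<and>
     p $ 2 = (of_int n + (if odd k then 1/2 else 0)) / sqrt y \<and> p $ 3 = t * of_int k / 2)"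
  by (auto simp: bco_def bco_shift_def vec_eq_iff forall_3 algebra_simps add_divide_distrib)

lemma bco_eq_lattice_of:
  "bco y t = lattice_of (vector [vector [sqrt y, 0, sqrt y / 2],
     vector [0, 1 / sqrt y, 1 / (2 * sqrt y)], vector [0, 0, t / 2]])" (is "_ = lattice_of ?B")
proof (intro set_eqI iffI)
  fix p assume "p \<in> bco y t"
  then obtain k m n :: int where p: "p $ 1 = sqrt y * (of_int m + (if odd k then 1/2 else 0))"
     "p $ 2 = (of_int n + (if odd k then 1/2 else 0)) / sqrt y" "p $ 3 = t * k / 2"
    unfolding mem_bco_iff by blast
  obtain d where d: "k = 2 * d + (if odd k then 1 else 0)"
    by (cases "even k") (auto elim: evenE oddE)
  have k: "of_int k / 2 = of_int d + (if odd k then 1/2 else 0 :: real)"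
    by (subst d) auto
  have "p $ 1 = sqrt y * (of_int (m - d) + of_int k / 2)" "p $ 2 = (of_int (n - d) + of_int k / 2) / sqrt y"
    unfolding p k by auto
  then show "p \<in> lattice_of ?B"
    unfolding mem_lattice_of_iff forall_3 using p(3)
    by (intro exI[of _ "m - d"] exI[of _ "n - d"] exI[of _ k])
       (simp add: algebra_simps add_divide_distrib diff_divide_distrib)
next
  fix p assume "p \<in> lattice_of ?B"
  then obtain a b k :: int where p: "p $ 1 = sqrt y * (a + k / 2)" "p $ 2 = (b + k / 2) / sqrt y"
      "p $ 3 = t * k / 2"
    unfolding mem_lattice_of_iff forall_3 by (auto simp: algebra_simps add_divide_distrib)
  obtain d where d: "k = 2 * d + (if odd k then 1 else 0)"
    by (cases "even k") (auto elim: evenE oddE)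
  have k: "of_int k / 2 = of_int d + (if odd k then 1/2 else 0 :: real)"
    by (subst d) auto
  show "p \<in> bco y t"
    unfolding mem_bco_iff using p(3)
    by (intro exI[of _ k] exI[of _ "a + d"] exI[of _ "b + d"]) (simp add: p(1,2) k add.assoc)
qed

lemma bco_eq_dilation_bcc:
  "bco y t = (\<lambda>p :: real^3. vector [sqrt y * p $ 1, p $ 2 / sqrt y, t * p $ 3]) ` bcc"
proof (intro set_eqI iffI)
  fix p assume "p \<in> bco y t"
  then obtain a b c :: int where p: "p $ 1 = sqrt y * (a + c / 2)" "p $ 2 = (b + c / 2) / sqrt y"
      "p $ 3 = t * (c / 2)"
    unfolding bco_eq_lattice_of mem_lattice_of_iff forall_3
    by (auto simp: algebra_simps add_divide_distrib)
  define q :: "real^3" where "q = vector [a + c / 2, b + c / 2, c / 2]"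
  have "q \<in> bcc"
    unfolding bcc_eq_lattice_of mem_lattice_of_iff forall_3
    by (intro exI[of _ a] exI[of _ b] exI[of _ c]) (simp add: q_def)
  moreover have "p = vector [sqrt y * q $ 1, q $ 2 / sqrt y, t * q $ 3]"
    using p by (simp add: q_def vec_eq_iff forall_3)
  ultimately show "p \<in> (\<lambda>p. vector [sqrt y * p $ 1, p $ 2 / sqrt y, t * p $ 3]) ` bcc"
    by blast
next
  fix p :: "real^3" assume "p \<in> (\<lambda>p. vector [sqrt y * p $ 1, p $ 2 / sqrt y, t * p $ 3]) ` bcc"
  then obtain q where q: "q \<in> bcc" "p = vector [sqrt y * q $ 1, q $ 2 / sqrt y, t * q $ 3]"
    by blast
  from q(1) obtain a b c :: int where "q $ 1 = of_int a + of_int c / 2"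
     "q $ 2 = of_int b + of_int c / 2" "q $ 3 = of_int c / 2"
    unfolding bcc_eq_lattice_of mem_lattice_of_iff forall_3 by auto
  with q(2) show "p \<in> bco y t"
    unfolding bco_eq_lattice_of mem_lattice_of_iff forall_3
    by (intro exI[of _ a] exI[of _ b] exI[of _ c]) (simp add: algebra_simps add_divide_distrib)
qed

lemma bco_1_1: "bco 1 1 = bcc"
  unfolding bco_eq_lattice_of bcc_eq_lattice_of by simp

lemma bravais_lattice_bco:
  assumes "y \<ge> 1" "t > 0"
  shows "bravais_lattice (bco y t)"
  unfolding bravais_lattice_def bco_eq_lattice_of
  by (intro exI conjI[rotated], rule refl) (use assms in \<open>simp add: invertible_det_nz det_3\<close>)

end

theory Submission imports Defs begin

text \<open>
  With \<open>f y = theta3 (\<alpha> * y) * theta3 (\<alpha> / y)\<close> and \<open>g y = theta2 (\<alpha> * y) * theta2 (\<alpha> / y)\<close>, the theta function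
  of \<open>bco y t\<close> is \<open>theta3 (\<alpha> * t\<^sup>2) * f y + theta2 (\<alpha> * t\<^sup>2) * g y\<close>.  The function \<open>f\<close> increases on
  \<open>y \<ge> 1\<close>, while \<open>f + g\<close>, a planar theta function that is that of the triangular lattice at
  \<open>y = sqrt 3\<close>, is minimal there; since \<open>theta2 < theta3\<close>, minimizers lie in \<open>[1, sqrt 3]\<close>.  For small
  \<open>t\<close> the two weights become equal and the triangular lattice wins over the square one, and for large
  \<open>\<alpha>\<close> the shortest vectors decide.  Along \<open>y = exp x\<close> the sum is even in \<open>x\<close>; for \<open>t = 1\<close> its
  second derivative at \<open>0\<close> is negative as soon as \<open>exp (\<pi> * \<alpha> / 4)\<close> exceeds \<open>\<pi> * \<alpha> - 1\<close> by a small
  margin, which yields the threshold \<open>2.385\<close>, and Poisson summation transfers this to FCC.  For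
  \<open>\<alpha> = 1\<close> and \<open>t \<ge> 0.9\<close> the weights satisfy \<open>theta2 \<le> 0.921 * theta3\<close>, which leaves an explicit
  estimate of \<open>f + 0.921 * g\<close> on \<open>[1, sqrt 3]\<close>.
\<close>

section \<open>Theta constants\<close>

text \<open>The inversion formula for \<open>theta3\<close> carries most of the weight: it gives the
  positivity of \<open>theta3 - theta2\<close>, it exchanges BCC with FCC, and it moves parameters
  into a range where the series converge fast. The remaining obstacle is cancellation, since theta
  functions are compared where their leading terms almost agree. Both planar comparisons meet it in
  the same way: average the terms over a symmetry of the undeformed lattice (a rotation of order
  three at \<open>sqrt 3\<close>, the swap of coordinates at 1), so that the terms odd in the
  deformation cancel, keep the shortest vectors exactly, and bound all others by convexity of
  \<open>exp\<close>. The margins are narrow: for \<alpha> = 1 and the weight 0.921 the decisive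
  linear coefficient is below 1/1000, hence the rational bounds with six digits. The value 2.385
  refers to \<open>bco y 1\<close>, built on the unit cube. Passing to density one multiplies
  \<alpha> by a factor above 1 for BCC and gives a dual parameter above 1/\<alpha> for FCC, so one
  constant serves all claims for t = 1.\<close>

lemma has_sum_diff:
  fixes f g :: "'a \<Rightarrow> real"
  assumes "(f has_sum a) A" "(g has_sum b) A"
  shows "((\<lambda>x. f x - g x) has_sum (a - b)) A"
  using has_sum_add[OF assms(1), of "\<lambda>x. - g x" "- b"] assms(2) by (simp add: has_sum_uminus)

lemma has_sum_mult_Times:
  fixes f :: "'a \<Rightarrow> real" and g :: "'b \<Rightarrow> real"
  assumes f: "(f has_sum a) A" and g: "(g has_sum b) B"
    and nn: "\<And>x. x \<in> A \<Longrightarrow> 0 \<le> f x" "\<And>y. y \<in> B \<Longrightarrow> 0 \<le> g y"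
  shows "((\<lambda>(x, y). f x * g y) has_sum (a * b)) (A \<times> B)"
proof (rule has_sum_SigmaI)
  show "((\<lambda>y. case (x, y) of (x, y) \<Rightarrow> f x * g y) has_sum f x * b) B" for x
    using has_sum_cmult_right[OF g] by simp
  show "((\<lambda>x. f x * b) has_sum a * b) A"
    by (rule has_sum_cmult_left[OF f])
  show "(\<lambda>(x, y). f x * g y) summable_on A \<times> B"
    by (rule summable_on_SigmaI[where g = "\<lambda>x. f x * b"])
      (use f in \<open>auto intro!: has_sum_cmult_right g summable_on_cmult_left mult_nonneg_nonneg nn dest: has_sum_imp_summable\<close>)
qed

text \<open>The negative integers are enumerated as \<open>- 1 - int n\<close>, without overlap at
  0; this reflection also fixes (k + 1/2)^2, which makes the two halves of \<open>theta2\<close>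
  equal.\<close>

lemma has_sum_int_split:
  fixes f :: "int \<Rightarrow> real"
  assumes "((\<lambda>n. f (int n)) has_sum a) UNIV" "((\<lambda>n. f (- 1 - int n)) has_sum b) UNIV"
  shows "(f has_sum (a + b)) UNIV"
proof -
  have "(f has_sum a) (range int)"
    using assms(1) by (subst has_sum_reindex) (auto simp: o_def)
  moreover have "(f has_sum b) (range (\<lambda>n. - 1 - int n))"
    using assms(2) by (subst has_sum_reindex) (auto simp: o_def inj_on_def)
  moreover have "range int \<inter> range (\<lambda>n. - 1 - int n) = {}" by auto
  ultimately have "(f has_sum (a + b)) (range int \<union> range (\<lambda>n. - 1 - int n))"
    by (intro has_sum_Un_disjoint)
  moreover have "k \<in> range int \<union> range (\<lambda>n. - 1 - int n)" for k
    by (cases "k \<ge> 0") (auto simp: image_iff intro: exI[of _ "nat k"] exI[of _ "nat (- 1 - k)"])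
  then have "range int \<union> range (\<lambda>n. - 1 - int n) = UNIV"
    by blast
  ultimately show ?thesis by simp
qed

abbreviation (input) gauss_term :: "nat \<Rightarrow> real \<Rightarrow> real \<Rightarrow> nat \<Rightarrow> real" where
  "gauss_term j a s n \<equiv> (pi * (real n + a)\<^sup>2) ^ j * exp (- (pi * (real n + a)\<^sup>2 * s))"

text \<open>Up to the sign \<open>(- 1) ^ j\<close> these are the derivatives in \<open>s\<close> of
  the case \<open>j = 0\<close>. The offsets 1 and 1/2 give the positive halves of the two theta
  constants, and passing from \<open>a\<close> to \<open>a + 1\<close> removes the first
  term.\<close>

definition gauss_sum :: "nat \<Rightarrow> real \<Rightarrow> real \<Rightarrow> real" where
  "gauss_sum j a s = (\<Sum>n. gauss_term j a s n)"

lemma power_exp_le: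
  fixes x :: real assumes "x \<ge> 0" shows "x ^ j \<le> fact j * exp x"
proof -
  have "(\<Sum>n\<in>{j}. x ^ n /\<^sub>R fact n) \<le> (\<Sum>n. x ^ n /\<^sub>R fact n)"
    using assms by (intro sum_le_suminf summable_exp_generic) auto
  then have "x ^ j / fact j \<le> exp x"
    by (simp add: exp_def divide_inverse mult.commute)
  then show ?thesis by (simp add: field_simps)
qed

text \<open>Half of the exponent absorbs the polynomial factor through \<open>power_exp_le\<close>;
  the other half is bounded by a geometric series because pi (n + a)^2 \<ge> n.\<close>

lemma summable_gauss_sum:
  assumes "s > 0" "a \<ge> 0"
  shows "summable (\<lambda>n. gauss_term j a s n)"
proof (rule summable_comparison_test_ev)
  define C where "C = fact j * (2 / s) ^ j"
  have "norm (gauss_term j a s n) \<le> C * exp (- s / 2) ^ n" for n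
  proof -
    define x where "x = pi * (real n + a)\<^sup>2"
    have "real n \<le> (real n)\<^sup>2" by (cases n) (auto simp: power2_eq_square)
    also have "\<dots> \<le> (real n + a)\<^sup>2" using assms by (intro power_mono) auto
    also have "\<dots> \<le> x" unfolding x_def using pi_ge_two by (simp add: mult_le_cancel_right1)
    finally have n: "real n \<le> x" .
    then have x: "x \<ge> 0" by linarith
    have "x ^ j = (s * x / 2) ^ j * (2 / s) ^ j"
      using assms by (simp add: power_mult_distrib[symmetric])
    also have "\<dots> \<le> (fact j * exp (s * x / 2)) * (2 / s) ^ j"
      using assms x by (intro mult_right_mono power_exp_le) auto
    finally have "x ^ j * exp (- (x * s)) \<le> (fact j * exp (s * x / 2)) * (2 / s) ^ j * exp (- (x * s))"
      by (intro mult_right_mono) auto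
    also have "\<dots> = C * exp (- s * x / 2)"
      unfolding C_def by (simp add: exp_minus exp_diff[symmetric] mult_exp_exp field_simps exp_add[symmetric])
    also have "\<dots> \<le> C * exp (- s * n / 2)"
      using assms n by (intro mult_left_mono) (auto simp: C_def)
    also have "exp (- s * n / 2) = exp (- s / 2) ^ n"
      by (simp add: exp_of_nat_mult[symmetric] algebra_simps)
    finally show ?thesis using x by (simp add: x_def)
  qed
  then show "\<forall>\<^sub>F n in sequentially. norm (gauss_term j a s n) \<le> C * exp (- s / 2) ^ n"
    by simp
  show "summable (\<lambda>n. C * exp (- s / 2) ^ n)"
    using assms by (intro summable_mult summable_geometric) auto
qed

lemma gauss_sum_sums:
  assumes "s > 0" "a \<ge> 0"
  shows "(\<lambda>n. gauss_term j a s n) sums gauss_sum j a s"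
  unfolding gauss_sum_def using summable_gauss_sum[OF assms] by (rule summable_sums)

lemma has_sum_gauss_sum:
  assumes "s > 0" "a \<ge> 0"
  shows "((\<lambda>n. gauss_term j a s n) has_sum gauss_sum j a s) UNIV"
  by (rule sums_nonneg_imp_has_sum[OF gauss_sum_sums[OF assms]]) auto

lemma gauss_sum_pos:
  assumes "s > 0" "a > 0"
  shows "gauss_sum j a s > 0"
  unfolding gauss_sum_def using assms
  by (intro suminf_pos summable_gauss_sum) (auto intro!: mult_pos_pos zero_less_power add_nonneg_pos)

lemma DERIV_gauss_sum:
  assumes "s > 0" "a \<ge> 0"
  shows "(gauss_sum j a has_real_derivative - gauss_sum (Suc j) a s) (at s)"
proof -
  define f where "f n s = gauss_term j a s n" for n s
  define f' where "f' n s = - (gauss_term (Suc j) a s n)" for n s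
  have "((\<lambda>s. \<Sum>n. f n s) has_field_derivative (\<Sum>n. f' n s)) (at s)"
  proof (rule has_field_derivative_series'(2))
    show "convex {s/2..}" by simp
    show "(f n has_field_derivative f' n x) (at x within {s/2..})" for n x
      unfolding f_def f'_def by (auto intro!: derivative_eq_intros)
    \<comment> \<open>The terms of the derivative decrease in absolute value as the argument grows,
      so the left end point of \<open>{s/2..}\<close> supplies the majorant.\<close>
    show "uniformly_convergent_on {s/2..} (\<lambda>n x. \<Sum>i<n. f' i x)"
    proof (rule Weierstrass_m_test')
      show "norm (f' n x) \<le> gauss_term (Suc j) a (s/2) n"
        if "x \<in> {s/2..}" for n x
      proof -
        have "norm (f' n x) = gauss_term (Suc j) a x n"
          unfolding f'_def by (simp add: abs_mult)
        also have "\<dots> \<le> gauss_term (Suc j) a (s/2) n"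
          using that by (intro mult_left_mono) (auto intro!: mult_left_mono)
        finally show ?thesis .
      qed
      show "summable (\<lambda>n. gauss_term (Suc j) a (s/2) n)"
        using assms by (intro summable_gauss_sum) auto
    qed
    show "s \<in> {s/2..}" "s \<in> interior {s/2..}" using assms by (auto simp: interior_real_atLeast)
    show "summable (\<lambda>n. f n s)" unfolding f_def using assms by (intro summable_gauss_sum)
  qed
  moreover have "(\<Sum>n. f' n s) = - gauss_sum (Suc j) a s"
    unfolding f'_def gauss_sum_def using assms by (intro suminf_minus summable_gauss_sum)
  ultimately show ?thesis
    unfolding f_def gauss_sum_def[abs_def] by simp
qed

lemmas DERIV_gauss_sum_chain [derivative_intros] = DERIV_chain2[OF DERIV_gauss_sum]

text \<open>Jacobi's theta constants at the nome \<open>exp (- pi * s)\<close>: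
  \<open>theta3\<close> is the Gaussian sum over Z, \<open>theta2\<close> the one over Z +
  1/2.\<close>

definition theta3 :: "real \<Rightarrow> real" where
  "theta3 s = 1 + 2 * gauss_sum 0 1 s"

definition theta2 :: "real \<Rightarrow> real" where
  "theta2 s = 2 * gauss_sum 0 (1/2) s"

lemma theta3_gt_1: "s > 0 \<Longrightarrow> theta3 s > 1"
  unfolding theta3_def using gauss_sum_pos[of s 1 0] by simp

lemma theta2_pos: "s > 0 \<Longrightarrow> theta2 s > 0"
  unfolding theta2_def using gauss_sum_pos[of s "1/2" 0] by simp

lemma has_sum_theta2:
  assumes "s > 0"
  shows "((\<lambda>n::int. exp (- (pi * s * (of_int n + 1/2)\<^sup>2))) has_sum theta2 s) UNIV"
proof -
  have "((\<lambda>n::int. exp (- (pi * s * (of_int n + 1/2)\<^sup>2))) has_sum (gauss_sum 0 (1/2) s + gauss_sum 0 (1/2) s)) UNIV"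
  proof (rule has_sum_int_split)
    show "((\<lambda>n. exp (- (pi * s * (real_of_int (int n) + 1 / 2)\<^sup>2))) has_sum gauss_sum 0 (1 / 2) s) UNIV"
      using has_sum_gauss_sum[OF assms, of "1/2" 0] by (simp add: mult_ac)
    have "(real_of_int (- 1 - int n) + 1 / 2)\<^sup>2 = (real n + 1/2)\<^sup>2" for n
      by (simp add: power2_eq_square algebra_simps)
    then show "((\<lambda>n. exp (- (pi * s * (real_of_int (- 1 - int n) + 1 / 2)\<^sup>2))) has_sum gauss_sum 0 (1 / 2) s) UNIV"
      using has_sum_gauss_sum[OF assms, of "1/2" 0] by (simp add: mult_ac)
  qed
  then show ?thesis by (simp add: theta2_def)
qed

lemma has_sum_theta3:
  assumes "s > 0"
  shows "((\<lambda>n::int. exp (- (pi * s * (of_int n)\<^sup>2))) has_sum theta3 s) UNIV"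
proof -
  have "((\<lambda>n::int. exp (- (pi * s * (of_int n)\<^sup>2))) has_sum ((1 + gauss_sum 0 1 s) + gauss_sum 0 1 s)) UNIV"
  proof (rule has_sum_int_split)
    have "(\<lambda>n. exp (- (pi * s * (real n)\<^sup>2))) sums (1 + gauss_sum 0 1 s)"
      using sums_Suc[of "\<lambda>n. exp (- (pi * s * (real n)\<^sup>2))" "gauss_sum 0 1 s"] gauss_sum_sums[OF assms, of 1 0]
      by (simp add: mult_ac add_ac)
    then show "((\<lambda>n. exp (- (pi * s * (real_of_int (int n))\<^sup>2))) has_sum (1 + gauss_sum 0 1 s)) UNIV"
      by (simp add: sums_nonneg_imp_has_sum)
    have "(real_of_int (- 1 - int n))\<^sup>2 = (real n + 1)\<^sup>2" for n
      by (simp add: power2_eq_square algebra_simps)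
    then show "((\<lambda>n. exp (- (pi * s * (real_of_int (- 1 - int n))\<^sup>2))) has_sum gauss_sum 0 1 s) UNIV"
      using has_sum_gauss_sum[OF assms, of 1 0] by (simp add: mult_ac)
  qed
  then show ?thesis by (simp add: theta3_def add_ac)
qed

text \<open>Z/2 is the disjoint union of Z and Z + 1/2, and halving the lattice amounts to dividing
  \<open>s\<close> by 4.\<close>

lemma theta3_quarter:
  assumes "s > 0"
  shows "theta3 (s / 4) = theta3 s + theta2 s"
proof -
  define f where "f n = exp (- (pi * (s / 4) * (real_of_int n)\<^sup>2))" for n
  have e: "(f has_sum theta3 s) (range (\<lambda>n. 2 * n))"
    using has_sum_theta3[OF assms]
    by (subst has_sum_reindex) (auto simp: o_def inj_on_def f_def power2_eq_square mult_ac)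
  have *: "pi * s * (2 * real_of_int n + 1)\<^sup>2 / 4 = pi * s * (real_of_int n + 1/2)\<^sup>2" for n
    by (simp add: power2_eq_square field_simps)
  have o: "(f has_sum theta2 s) (range (\<lambda>n. 2 * n + 1))"
    using has_sum_theta2[OF assms]
    by (subst has_sum_reindex) (auto simp: o_def inj_on_def f_def *)
  have "(f has_sum (theta3 s + theta2 s)) (range (\<lambda>n. 2 * n) \<union> range (\<lambda>n. 2 * n + 1))"
    by (rule has_sum_Un_disjoint[OF e o]) (auto, presburger)
  moreover have "range (\<lambda>n::int. 2 * n) \<union> range (\<lambda>n. 2 * n + 1) = UNIV"
    by (auto elim!: oddE) (metis evenE oddE rangeI)
  ultimately have "(f has_sum (theta3 s + theta2 s)) UNIV" by simp
  moreover have "(f has_sum theta3 (s / 4)) UNIV"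
    unfolding f_def using assms by (intro has_sum_theta3) auto
  ultimately show ?thesis using has_sum_unique by blast
qed

section \<open>The inversion formula\<close>

text \<open>Quotients of neighbouring binomial coefficients telescope. For \<open>r > m\<close> the
  factor with \<open>i = m\<close> vanishes, and so does the left side.\<close>

lemma binomial_central_shift:
  "real (2 * m choose (m + r)) = real (2 * m choose m) * (\<Prod>i<r. (real m - real i) / (real m + real i + 1))"
proof (induction r)
  case (Suc r)
  have "Suc (m + r) * (2 * m choose Suc (m + r)) = (2 * m - (m + r)) * (2 * m choose (m + r))"
    by (metis binomial_absorb_comp binomial_absorption)
  then have "real (Suc (m + r)) * real (2 * m choose Suc (m + r)) = real (2 * m - (m + r)) * real (2 * m choose (m + r))"
    by (metis of_nat_mult)
  also have "\<dots> = (real m - real r) * real (2 * m choose (m + r))"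
    by (cases "r \<le> m") (auto simp: of_nat_diff binomial_eq_0)
  finally have "real (2 * m choose (m + Suc r)) = real (2 * m choose (m + r)) * ((real m - real r) / (real m + real r + 1))"
    by (simp add: field_simps)
  then show ?case using Suc by simp
qed simp

lemma sum_odd_real: "(\<Sum>i<r. 2 * real i + 1) = (real r)\<^sup>2"
  by (induction r) (auto simp: power2_eq_square algebra_simps)

text \<open>Each factor is 1 - (2i+1)/(m+i+1), hence at most exp(-(2i+1)/(m+R)), and the odd numbers
  add up to r^2. The parameter \<open>R\<close> serves two purposes: \<open>R = r\<close> gives the
  sharp limit, \<open>R = m\<close> a majorant uniform in \<open>r\<close>.\<close>

lemma binomial_central_upper:
  assumes "r \<le> R"
  shows "real (2 * m choose (m + r)) \<le> real (2 * m choose m) * exp (- ((real r)\<^sup>2 / (real m + real R)))"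
proof (cases "r \<le> m")
  case True
  have "(\<Prod>i<r. (real m - real i) / (real m + real i + 1)) \<le> (\<Prod>i<r. exp (- ((2 * real i + 1) / (real m + real R))))"
  proof (rule prod_mono, safe)
    fix i assume i: "i < r"
    have "(real m - real i) / (real m + real i + 1) = 1 - (2 * real i + 1) / (real m + real i + 1)"
      by (simp add: field_simps)
    also have "\<dots> \<le> 1 - (2 * real i + 1) / (real m + real R)"
      using i assms by (intro diff_left_mono divide_left_mono) auto
    also have "\<dots> \<le> exp (- ((2 * real i + 1) / (real m + real R)))"
      using exp_ge_add_one_self[of "- ((2 * real i + 1) / (real m + real R))"] by simp
    finally show "(real m - real i) / (real m + real i + 1) \<le> exp (- ((2 * real i + 1) / (real m + real R)))" .
    show "0 \<le> (real m - real i) / (real m + real i + 1)" using i True by auto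
  qed
  also have "\<dots> = exp (- ((\<Sum>i<r. 2 * real i + 1) / (real m + real R)))"
    by (simp only: exp_sum[symmetric, OF finite_lessThan] sum_negf sum_divide_distrib)
  finally show ?thesis
    unfolding binomial_central_shift[of m r] sum_odd_real by (rule mult_left_mono) simp
qed (simp add: binomial_eq_0)

text \<open>The factors are 1/(1+y) \<ge> exp(-y), and the smallest denominator m - r is used for
  all of them. Upper and lower exponent agree in the limit when m grows like r^2.\<close>

lemma binomial_central_lower:
  assumes "r < m"
  shows "real (2 * m choose (m + r)) \<ge> real (2 * m choose m) * exp (- ((real r)\<^sup>2 / (real m - real r)))"
proof -
  have "(\<Prod>i<r. (real m - real i) / (real m + real i + 1)) \<ge> (\<Prod>i<r. exp (- ((2 * real i + 1) / (real m - real r))))"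
  proof (rule prod_mono, safe)
    fix i assume i: "i < r"
    define y where "y = (2 * real i + 1) / (real m - real i)"
    have "y \<ge> 0" using i assms by (auto simp: y_def)
    have "exp (- ((2 * real i + 1) / (real m - real r))) \<le> exp (- y)"
      unfolding y_def using i assms by (simp, intro divide_left_mono) auto
    also have "\<dots> \<le> 1 / (1 + y)"
      using exp_ge_add_one_self[of y] \<open>y \<ge> 0\<close> by (simp add: exp_minus divide_inverse le_imp_inverse_le)
    also have "\<dots> = (real m - real i) / (real m + real i + 1)"
      using i assms by (simp add: y_def field_simps)
    finally show "exp (- ((2 * real i + 1) / (real m - real r))) \<le> (real m - real i) / (real m + real i + 1)" .
  qed simp
  also have "(\<Prod>i<r. exp (- ((2 * real i + 1) / (real m - real r)))) = exp (- ((\<Sum>i<r. 2 * real i + 1) / (real m - real r)))"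
    by (simp only: exp_sum[symmetric, OF finite_lessThan] sum_negf sum_divide_distrib)
  finally show ?thesis
    unfolding binomial_central_shift[of m r] sum_odd_real by (intro mult_left_mono) auto
qed

lemma two_cos_power_even:
  "(2 * cos u) ^ (2 * m) = (\<Sum>i\<le>2*m. real (2 * m choose i) * cos (2 * (real i - real m) * u))"
proof -
  have *: "complex_of_real (2 * cos u) = cis u + cis (- u)"
    by (simp add: complex_eq_iff)
  have "complex_of_real ((2 * cos u) ^ (2 * m)) = (cis u + cis (- u)) ^ (2 * m)"
    by (simp only: *[symmetric] of_real_power)
  also have "\<dots> = (\<Sum>i\<le>2*m. of_nat (2 * m choose i) * cis (2 * (real i - real m) * u))"
    unfolding binomial_ring
  proof (intro sum.cong refl)
    fix i assume "i \<in> {..2 * m}"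
    then have "real i * u + real (2 * m - i) * (- u) = 2 * (real i - real m) * u"
      by (simp add: of_nat_diff algebra_simps)
    then show "of_nat (2 * m choose i) * cis u ^ i * cis (- u) ^ (2 * m - i) =
        of_nat (2 * m choose i) * cis (2 * (real i - real m) * u)"
      by (simp only: Complex.DeMoivre cis_mult mult.assoc[of "of_nat (2 * m choose i)"])
  qed
  finally have "Re (complex_of_real ((2 * cos u) ^ (2 * m))) = Re \<dots>" by simp
  then show ?thesis by simp
qed

lemma sin_half_mult_sum_cos:
  "sin (x / 2) * (1 + 2 * (\<Sum>k<n. cos (real (Suc k) * x))) = sin ((real n + 1/2) * x)"
proof (induction n)
  case (Suc n)
  have "sin (x / 2) * (2 * cos (real (Suc n) * x)) = sin (real (Suc n) * x + x / 2) - sin (real (Suc n) * x - x / 2)"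
    by (simp add: sin_add sin_diff)
  then show ?case using Suc by (simp add: algebra_simps add_divide_distrib)
qed simp

text \<open>Orthogonality of the roots of unity of order 2n+1, with conjugates paired into cosines;
  the odd order leaves only the root 1 unpaired. Off the multiples the Dirichlet kernel of
  \<open>sin_half_mult_sum_cos\<close> vanishes, because (n + 1/2) x is an integer multiple of
  pi.\<close>

lemma sum_cos_roots_of_unity:
  fixes q :: int
  shows "1 + 2 * (\<Sum>k<n. cos (real (Suc k) * (2 * pi * of_int q / real (2 * n + 1)))) =
    (if int (2 * n + 1) dvd q then real (2 * n + 1) else 0)"
proof (cases "int (2 * n + 1) dvd q")
  case True
  then obtain p where p: "q = int (2 * n + 1) * p" by blast
  have "2 * pi * of_int q / real (2 * n + 1) = 2 * pi * of_int p"
    unfolding p by (simp add: field_simps)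
  moreover have "cos (real (Suc k) * (2 * pi * of_int p)) = 1" for k
    using cos_int_2pin[of "int (Suc k) * p"] by (simp add: mult_ac)
  ultimately show ?thesis using True by (simp del: of_nat_Suc)
next
  case False
  define x where "x = 2 * pi * of_int q / real (2 * n + 1)"
  have "sin (x / 2) \<noteq> 0"
  proof
    assume "sin (x / 2) = 0"
    then obtain i :: int where "x / 2 = of_int i * pi" by (auto simp: sin_zero_iff_int2)
    then have "pi * of_int q = pi * real_of_int (i * int (2 * n + 1))" by (simp add: x_def field_simps)
    then have "of_int q = real_of_int (i * int (2 * n + 1))" by (simp only: mult_cancel_left) simp
    then have "q = i * int (2 * n + 1)" by (simp only: of_int_eq_iff)
    then show False using False by simp
  qed
  moreover have "(real n + 1/2) * x = of_int q * pi" by (simp add: x_def field_simps)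
  then have "sin ((real n + 1/2) * x) = 0" by (auto simp: sin_zero_iff_int2)
  ultimately show ?thesis
    using sin_half_mult_sum_cos[of x n] False unfolding x_def[symmetric] by simp
qed

lemma sum_symmetric_binomial:
  assumes "l > 0"
  shows "(\<Sum>i\<le>2*m. if int l dvd int i - int m then real (2 * m choose i) else 0) =
    real (2 * m choose m) + 2 * (\<Sum>j<m. real (2 * m choose (m + Suc j * l)))"
proof -
  define g where "g i = (if int l dvd int i - int m then real (2 * m choose i) else 0)" for i
  have "(\<Sum>i\<le>2*m. g i) = (\<Sum>i\<in>{..<m} \<union> {m} \<union> {m<..2*m}. g i)"
    by (rule sum.cong) auto
  also have "\<dots> = (\<Sum>i<m. g i) + g m + (\<Sum>i\<in>{m<..2*m}. g i)"
    by (subst sum.union_disjoint; (subst sum.union_disjoint)?) auto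
  also have "(\<Sum>i<m. g i) = (\<Sum>i\<in>{m<..2*m}. g i)"
  proof (rule sum.reindex_bij_witness[of _ "\<lambda>i. 2 * m - i" "\<lambda>i. 2 * m - i"])
    fix i assume i: "i \<in> {..<m}"
    have "int (2 * m - i) - int m = - (int i - int m)" using i by (simp add: of_nat_diff)
    moreover have "2 * m choose (2 * m - i) = 2 * m choose i" using i by (intro binomial_symmetric[symmetric]) auto
    ultimately show "g (2 * m - i) = g i" unfolding g_def by (simp only: dvd_minus_iff)
  qed auto
  also have "(\<Sum>i\<in>{m<..2*m}. g i) = (\<Sum>i\<in>{i\<in>{m<..2*m}. int l dvd int i - int m}. real (2 * m choose i))"
    by (simp add: g_def sum.inter_filter[symmetric])
  \<comment> \<open>The progression is continued up to \<open>j < m\<close> whatever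
    \<open>l\<close> is; the entries beyond 2m are zero binomial coefficients.\<close>
  also have "\<dots> = (\<Sum>i\<in>(\<lambda>j. m + Suc j * l) ` {..<m}. real (2 * m choose i))"
  proof (rule sum.mono_neutral_left)
    show "{i \<in> {m<..2 * m}. int l dvd int i - int m} \<subseteq> (\<lambda>j. m + Suc j * l) ` {..<m}"
    proof safe
      fix i assume i: "i \<in> {m<..2 * m}" "int l dvd int i - int m"
      then have "l dvd i - m" by (metis greaterThanAtMost_iff int_dvd_int_iff less_imp_le of_nat_diff)
      then obtain c where c: "i - m = l * c" by blast
      with i have "c \<noteq> 0" by (intro notI) auto
      then obtain j where j: "c = Suc j" by (cases c) auto
      have "c \<le> l * c" using assms by simp
      then have "j < m" using c i j by auto
      moreover have "i = m + Suc j * l" using c i j by (auto simp: mult.commute)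
      ultimately show "i \<in> (\<lambda>j. m + Suc j * l) ` {..<m}" by blast
    qed
    show "\<forall>i\<in>(\<lambda>j. m + Suc j * l) ` {..<m} - {i \<in> {m<..2 * m}. int l dvd int i - int m}. real (2 * m choose i) = 0"
      using assms by (auto intro!: binomial_eq_0)
  qed auto
  also have "\<dots> = (\<Sum>j<m. real (2 * m choose (m + Suc j * l)))"
    using assms by (subst sum.reindex) (auto simp: inj_on_def)
  finally show ?thesis by (simp add: g_def)
qed

text \<open>Both sides are the sum of (2 cos u)^(2m) over u = pi k / l with k modulo l. Only even
  frequencies occur, so these angles sample exp(2iu) over all roots of unity of order l, and the
  filter keeps the binomial coefficients whose distance from the centre is a multiple of l.\<close>

lemma polya_identity:
  defines "l \<equiv> \<lambda>n. 2 * n + 1"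
  shows "real (l n) * (real (2 * m choose m) + 2 * (\<Sum>j<m. real (2 * m choose (m + Suc j * l n)))) =
    4 ^ m * (1 + 2 * (\<Sum>k<n. cos (pi * real (Suc k) / real (l n)) ^ (2 * m)))"
proof -
  have *: "(2 * cos (pi * real (Suc k) / real (l n))) ^ (2 * m) =
    (\<Sum>i\<le>2*m. real (2 * m choose i) * cos (real (Suc k) * (2 * pi * of_int (int i - int m) / real (l n))))" for k
  proof -
    have "2 * (real i - real m) * (pi * real (Suc k) / real (l n)) =
        real (Suc k) * (2 * pi * of_int (int i - int m) / real (l n))" for i
      by simp
    then show ?thesis unfolding two_cos_power_even by (simp only:)
  qed
  have four: "(4::real) ^ m = 2 ^ (2 * m)" by (simp add: power_mult)
  have "4 ^ m * (1 + 2 * (\<Sum>k<n. cos (pi * real (Suc k) / real (l n)) ^ (2 * m))) =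
     2 ^ (2 * m) + 2 * (\<Sum>k<n. (2 * cos (pi * real (Suc k) / real (l n))) ^ (2 * m))"
    unfolding four by (simp add: power_mult_distrib sum_distrib_left algebra_simps)
  also have "(2::real) ^ (2 * m) = (\<Sum>i\<le>2*m. real (2 * m choose i))"
    using two_cos_power_even[of 0 m] by simp
  also have "(\<Sum>k<n. (2 * cos (pi * real (Suc k) / real (l n))) ^ (2 * m)) =
     (\<Sum>i\<le>2*m. real (2 * m choose i) * (\<Sum>k<n. cos (real (Suc k) * (2 * pi * of_int (int i - int m) / real (l n)))))"
    unfolding * by (subst sum.swap) (simp only: sum_distrib_left)
  also have "(\<Sum>i\<le>2*m. real (2 * m choose i)) + 2 * \<dots> =
    (\<Sum>i\<le>2*m. real (2 * m choose i) * (1 + 2 * (\<Sum>k<n. cos (real (Suc k) * (2 * pi * of_int (int i - int m) / real (l n))))))"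
    by (simp only: sum_distrib_left distrib_left sum.distrib mult.right_neutral) (simp only: mult_ac)
  also have "\<dots> = (\<Sum>i\<le>2*m. real (l n) * (if int (l n) dvd int i - int m then real (2 * m choose i) else 0))"
    unfolding l_def sum_cos_roots_of_unity by (intro sum.cong refl) auto
  also have "\<dots> = real (l n) * (real (2 * m choose m) + 2 * (\<Sum>j<m. real (2 * m choose (m + Suc j * l n))))"
    by (subst sum_symmetric_binomial[symmetric]) (auto simp: l_def sum_distrib_left)
  finally show ?thesis by simp
qed

lemma tannery_sequentially:
  fixes a :: "nat \<Rightarrow> nat \<Rightarrow> real"
  assumes "\<And>k. (\<lambda>n. a k n) \<longlonglongrightarrow> b k" "\<forall>\<^sub>F n in sequentially. \<forall>k. \<bar>a k n\<bar> \<le> M k" "summable M"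
  shows "(\<lambda>n. \<Sum>k. a k n) \<longlonglongrightarrow> suminf b"
proof -
  have "\<forall>\<^sub>F (k, n) in at_top \<times>\<^sub>F sequentially. norm (a k n) \<le> M k"
    unfolding eventually_prod_filter using assms(2)
    by (intro exI[of _ "\<lambda>_. True"] exI[of _ "\<lambda>n. \<forall>k. \<bar>a k n\<bar> \<le> M k"]) auto
  from tannerys_theorem[OF assms(1) this assms(3)] show ?thesis by simp
qed

text \<open>The partial products of Wallis have this closed form by induction. The limit supplies
  the factor \<open>1 / sqrt s\<close> of the inversion formula.\<close>

lemma wallis_central_binomial:
  "(\<lambda>n. (4 ^ n / real (2 * n choose n))\<^sup>2 / (2 * real n + 1)) \<longlonglongrightarrow> pi / 2"
proof -
  have "(\<Prod>k=1..n. (4*real k^2) / (4*real k^2 - 1)) = (4 ^ n / real (2 * n choose n))\<^sup>2 / (2 * real n + 1)" for n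
  proof (induction n)
    case (Suc n)
    have "Suc n * (2 * Suc n choose Suc n) = 2 * Suc n * (2 * n + 1 choose n)"
      using binomial_absorption[of n "2 * Suc n"] by (simp only: mult_Suc_right) (simp only: add_2_eq_Suc diff_Suc_1 add_Suc_right mult_2 add_Suc add_0 plus_1_eq_Suc mult_Suc_right flip: Suc_eq_plus1)
    then have "Suc n * (2 * Suc n choose Suc n) = Suc n * (2 * (2 * n + 1 choose n))"
      by (simp only: mult_ac)
    then have *: "(2 * Suc n choose Suc n) = 2 * (2 * n + 1 choose n)"
      by (simp only: mult_cancel1 nat.simps) (simp only: simp_thms)
    have "(2 * n + 1 - n) * (2 * n + 1 choose n) = (2 * n + 1) * ((2 * n + 1 - 1) choose n)"
      by (rule binomial_absorb_comp)
    moreover have "2 * n + 1 - n = Suc n" "2 * n + 1 - 1 = 2 * n" by simp_all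
    ultimately have **: "Suc n * (2 * n + 1 choose n) = (2 * n + 1) * (2 * n choose n)" by metis
    have "Suc n * (2 * Suc n choose Suc n) = 2 * (Suc n * (2 * n + 1 choose n))"
      using * by (simp only: mult_ac)
    then have "Suc n * (2 * Suc n choose Suc n) = 2 * (2 * n + 1) * (2 * n choose n)"
      unfolding ** by (simp only: mult_ac)
    then have "real (Suc n) * real (2 * Suc n choose Suc n) = 2 * (2 * real n + 1) * real (2 * n choose n)"
      by (metis (mono_tags) of_nat_mult of_nat_add of_nat_numeral of_nat_1)
    then have *: "real (2 * Suc n choose Suc n) = 2 * (2 * real n + 1) * real (2 * n choose n) / (real n + 1)"
      by (simp add: field_simps)
    have "real (2 * n choose n) > 0" by simp
    have **: "4 * (real (Suc n))\<^sup>2 - 1 = (2 * real n + 1) * (2 * real n + 3)"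
      by (simp add: power2_eq_square algebra_simps)
    define c where "c = real (2 * n choose n)"
    have c: "c > 0" by (simp add: c_def)
    have "(\<Prod>k=1..Suc n. (4*real k^2) / (4*real k^2 - 1)) =
        (4 ^ n / c)\<^sup>2 / (2 * real n + 1) * (4 * (real n + 1)\<^sup>2 / ((2 * real n + 1) * (2 * real n + 3)))"
      using Suc ** by (simp add: c_def add.commute)
    also have "\<dots> = (4 ^ Suc n / (2 * (2 * real n + 1) * c / (real n + 1)))\<^sup>2 / (2 * real (Suc n) + 1)"
      using c by (simp add: divide_simps) (simp add: power2_eq_square algebra_simps)
    finally show ?case unfolding * c_def .
  qed simp
  then show ?thesis using wallis by simp
qed

text \<open>A weak form of Jordan's inequality, from sin u = 2 sin v cos v \<ge> 2 v cos^2 v with v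
  = u/2 and cos^2 v \<ge> 1/2. It provides the majorant for the powers of cosines in
  \<open>theta3_inverse\<close>.\<close>

lemma sin_ge_half:
  fixes u :: real
  assumes "0 \<le> u" "u \<le> pi / 2"
  shows "sin u \<ge> u / 2"
proof -
  define v where "v = u / 2"
  have v: "0 \<le> v" "v \<le> pi / 4" using assms by (auto simp: v_def)
  then have v': "v < pi / 2" "- (pi / 2) < v" using pi_gt_zero by linarith+
  have c: "cos v > 0" using v' by (intro cos_gt_zero_pi) auto
  have "cos v \<ge> cos (pi / 4)" using v by (intro cos_monotone_0_pi_le) auto
  then have "(cos v)\<^sup>2 \<ge> (cos (pi / 4))\<^sup>2" by (intro power_mono) (auto simp: cos_45)
  then have c2: "(cos v)\<^sup>2 \<ge> 1/2" by (simp add: cos_45 power2_eq_square)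
  have "arctan (tan v) \<le> tan v"
    using v v' by (intro arctan_le_self) (auto intro!: tan_pos_pi2_le)
  then have "v * cos v \<le> sin v"
    using arctan_tan[OF v'(2,1)] c by (simp add: tan_def pos_le_divide_eq)
  then have "2 * (v * cos v) * cos v \<le> 2 * sin v * cos v"
    using c by (intro mult_right_mono) auto
  then have "2 * v * (cos v)\<^sup>2 \<le> sin u"
    using sin_double[of v] by (simp add: v_def power2_eq_square mult_ac)
  moreover have "2 * v * (cos v)\<^sup>2 \<ge> 2 * v * (1/2)"
    using v c2 by (intro mult_left_mono) auto
  ultimately show ?thesis by (simp add: v_def)
qed

lemma tendsto_mult_sin_inverse:
  fixes f :: "_ \<Rightarrow> real"
  assumes f: "filterlim f at_top F"
  shows "((\<lambda>n. f n * sin (c / f n)) \<longlongrightarrow> c) F"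
proof (cases "c = 0")
  case False
  have "((\<lambda>x::real. sin x / x) \<longlongrightarrow> 1) (at 0)"
    using DERIV_sin[of 0] by (simp add: has_field_derivative_iff)
  moreover have *: "\<forall>\<^sub>F n in F. f n > 0"
    using f by (simp add: filterlim_at_top_dense)
  then have *: "\<forall>\<^sub>F n in F. c / f n \<noteq> 0"
    by eventually_elim (use False in auto)
  have "filterlim (\<lambda>n. c / f n) (at 0) F"
    unfolding filterlim_at
    using f False * tendsto_divide_0[OF tendsto_const f[THEN filterlim_at_top_imp_at_infinity]]
    by auto
  ultimately have "((\<lambda>n. c * (sin (c / f n) / (c / f n))) \<longlongrightarrow> c * 1) F"
    by (intro tendsto_intros) (rule filterlim_compose)
  moreover have "\<forall>\<^sub>F n in F. f n > 0"
    using f by (simp add: filterlim_at_top_dense)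
  then have "\<forall>\<^sub>F n in F. c * (sin (c / f n) / (c / f n)) = f n * sin (c / f n)"
    by eventually_elim (use False in \<open>simp add: field_simps\<close>)
  ultimately show ?thesis
    by (simp add: tendsto_cong)
qed simp

text \<open>Polya's proof: divide \<open>polya_identity\<close> by the central binomial coefficient, let
  \<open>m \<sim> l\<^sup>2/(\<pi>s)\<close>, and pass to the limit termwise on both sides.\<close>

theorem theta3_inverse:
  assumes s: "s > 0"
  shows "theta3 s = theta3 (1 / s) / sqrt s"
proof -
  define l where "l n = real (2 * n + 1)" for n
  define m where "m n = nat \<lfloor>(l n)\<^sup>2 / (pi * s)\<rfloor>" for n
  have l_pos: "l n > 0" for n by (simp add: l_def)
  have l_top: "filterlim l at_top sequentially"
    unfolding l_def
    by (rule filterlim_compose[OF filterlim_real_sequentially], rule filterlim_subseq) (simp add: strict_mono_def)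
  have m_le: "real (m n) \<le> (l n)\<^sup>2 / (pi * s)" for n
    unfolding m_def using s by (simp add: of_nat_floor)
  have m_ge: "real (m n) \<ge> (l n)\<^sup>2 / (pi * s) - 1" for n
    unfolding m_def using s by linarith
  have inv_l: "(\<lambda>n. c / l n) \<longlonglongrightarrow> 0" for c
    by (rule tendsto_divide_0[OF tendsto_const filterlim_at_top_imp_at_infinity[OF l_top]])
  have m_lim: "(\<lambda>n. real (m n) / (l n)\<^sup>2) \<longlonglongrightarrow> 1 / (pi * s)"
  proof (rule tendsto_sandwich)
    show "(\<lambda>n. 1 / (pi * s) - (1 / l n)\<^sup>2) \<longlonglongrightarrow> 1 / (pi * s)"
      by (rule tendsto_eq_intros inv_l refl)+ simp
    show "\<forall>\<^sub>F n in sequentially. 1 / (pi * s) - (1 / l n)\<^sup>2 \<le> real (m n) / (l n)\<^sup>2"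
    proof (rule always_eventually, rule allI)
      fix n
      have "((l n)\<^sup>2 / (pi * s) - 1) / (l n)\<^sup>2 \<le> real (m n) / (l n)\<^sup>2"
        using m_ge by (intro divide_right_mono) auto
      moreover have "((l n)\<^sup>2 / (pi * s) - 1) / (l n)\<^sup>2 = 1 / (pi * s) - (1 / l n)\<^sup>2"
        using l_pos[of n] s by (simp add: diff_divide_distrib power_divide)
      ultimately show "1 / (pi * s) - (1 / l n)\<^sup>2 \<le> real (m n) / (l n)\<^sup>2" by simp
    qed
    show "\<forall>\<^sub>F n in sequentially. real (m n) / (l n)\<^sup>2 \<le> 1 / (pi * s)"
    proof (rule always_eventually, rule allI)
      fix n
      have "real (m n) / (l n)\<^sup>2 \<le> ((l n)\<^sup>2 / (pi * s)) / (l n)\<^sup>2"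
        using m_le by (intro divide_right_mono) auto
      then show "real (m n) / (l n)\<^sup>2 \<le> 1 / (pi * s)" using l_pos[of n] by simp
    qed
  qed simp
  have "filterlim (\<lambda>n. real (m n)) at_top sequentially"
  proof (rule filterlim_at_top_mono)
    show "filterlim (\<lambda>n. - 1 + 1 / (pi * s) * (l n * l n)) at_top sequentially"
      using s by (intro filterlim_tendsto_add_at_top[OF tendsto_const] filterlim_tendsto_pos_mult_at_top[OF tendsto_const]
          filterlim_at_top_mult_at_top l_top) auto
    show "\<forall>\<^sub>F n in sequentially. - 1 + 1 / (pi * s) * (l n * l n) \<le> real (m n)"
      using m_ge by (intro always_eventually allI) (simp add: power2_eq_square)
  qed
  then have m_top: "filterlim m at_top sequentially"
    unfolding filterlim_at_top by (auto simp: of_nat_le_iff[where 'a=real, symmetric] simp del: of_nat_le_iff)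

  define C where "C n = real (2 * m n choose m n)" for n
  define a where "a j n = real (2 * m n choose (m n + Suc j * (2 * n + 1))) / C n" for j n
  define b where "b k n = (if k < n then cos (pi * real (Suc k) / l n) ^ (2 * m n) else 0)" for k n
  have C_pos: "C n > 0" for n by (simp add: C_def)

  have "(\<lambda>n. \<Sum>j. a j n) \<longlonglongrightarrow> (\<Sum>j. gauss_term 0 1 s j)"
  proof (rule tannery_sequentially)
    fix j
    define r where "r n = Suc j * (2 * n + 1)" for n
    have r: "real (r n) = (real j + 1) * l n" for n by (simp add: r_def l_def algebra_simps)
    have a_r: "a j n = real (2 * m n choose (m n + r n)) / C n" for n by (simp only: a_def r_def)
    \<comment> \<open>The value \<open>e = 1\<close> is the exponent of the upper binomial bound and
      \<open>e = - 1\<close> that of the lower one; their limits agree because r/l^2 tends to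
      0.\<close>
    have eq: "(real (r n))\<^sup>2 / (real (m n) + e * real (r n)) =
        (real j + 1)\<^sup>2 / (real (m n) / (l n)\<^sup>2 + e * (real j + 1) / l n)" for e n
      unfolding r using l_pos[of n] by (simp add: field_simps power2_eq_square)
    have lim: "(\<lambda>n. exp (- ((real (r n))\<^sup>2 / (real (m n) + e * real (r n))))) \<longlonglongrightarrow>
        gauss_term 0 1 s j" for e
      unfolding eq
      by (rule tendsto_eq_intros m_lim inv_l refl)+ (use s in \<open>auto simp: mult_ac\<close>)
    have "\<forall>\<^sub>F n in sequentially. real (m n) / (l n)\<^sup>2 - (real j + 1) / l n > 0"
    proof -
      have "(\<lambda>n. real (m n) / (l n)\<^sup>2 - (real j + 1) / l n) \<longlonglongrightarrow> 1 / (pi * s) - 0"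
        by (intro tendsto_intros m_lim inv_l)
      from order_tendstoD(1)[OF this, of 0] s show ?thesis by simp
    qed
    then have rm: "\<forall>\<^sub>F n in sequentially. r n < m n"
    proof eventually_elim
      case (elim n)
      then have "0 < (real (m n) / (l n)\<^sup>2 - (real j + 1) / l n) * (l n)\<^sup>2"
        using l_pos[of n] by (intro mult_pos_pos) auto
      also have "\<dots> = real (m n) - real (r n)"
        unfolding r using l_pos[of n] by (simp add: field_simps power2_eq_square)
      finally show ?case by simp
    qed
    show "(\<lambda>n. a j n) \<longlonglongrightarrow> gauss_term 0 1 s j"
    proof (rule tendsto_sandwich[OF _ _ lim[of "-1"] lim[of 1]])
      show "\<forall>\<^sub>F n in sequentially. exp (- ((real (r n))\<^sup>2 / (real (m n) + - 1 * real (r n)))) \<le> a j n"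
        using rm
      proof eventually_elim
        case (elim n)
        show ?case using binomial_central_lower[OF elim] C_pos[of n]
          by (simp add: a_r C_def field_simps)
      qed
      show "\<forall>\<^sub>F n in sequentially. a j n \<le> exp (- ((real (r n))\<^sup>2 / (real (m n) + 1 * real (r n))))"
        using binomial_central_upper[OF order_refl] C_pos
        by (intro always_eventually allI) (simp add: a_r C_def field_simps)
    qed
  next
    show "\<forall>\<^sub>F n in sequentially. \<forall>j. \<bar>a j n\<bar> \<le> gauss_term 0 1 (s / 2) j"
    proof (rule always_eventually, intro allI)
      fix n j
      define r where "r = Suc j * (2 * n + 1)"
      have r: "real r = (real j + 1) * l n" by (simp add: r_def l_def algebra_simps)
      have a_r: "a j n = real (2 * m n choose (m n + r)) / C n" by (simp only: a_def r_def)
      show "\<bar>a j n\<bar> \<le> gauss_term 0 1 (s / 2) j"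
      proof (cases "r \<le> m n")
        case True
        have "r > 0" by (simp add: r_def)
        then have m: "real (m n) > 0" using True by simp
        \<comment> \<open>Taking \<open>R = m n\<close> instead of \<open>r\<close> costs a factor
          two in the exponent, but the bound holds for all \<open>n\<close> at once, as dominated
          convergence demands.\<close>
        have "a j n \<le> exp (- ((real r)\<^sup>2 / (real (m n) + real (m n))))"
          using binomial_central_upper[OF True, of "m n"] C_pos[of n]
          by (simp add: a_r C_def pos_divide_le_eq mult.commute)
        also have "\<dots> \<le> exp (- (pi * (real j + 1)\<^sup>2 * (s / 2)))"
        proof -
          have "pi * s * real (m n) \<le> (l n)\<^sup>2" using m_le[of n] s by (simp add: field_simps)
          then have "(real j + 1)\<^sup>2 * (pi * s * real (m n)) \<le> (real j + 1)\<^sup>2 * (l n)\<^sup>2"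
            by (intro mult_left_mono) auto
          then have "(pi * (real j + 1)\<^sup>2 * (s / 2)) * (real (m n) + real (m n)) \<le> (real r)\<^sup>2"
            unfolding r power_mult_distrib by (simp add: mult_ac)
          then show ?thesis using m by (simp add: pos_le_divide_eq)
        qed
        finally show ?thesis using C_pos[of n] by (simp add: a_def)
      qed (simp add: a_r binomial_eq_0)
    qed
    show "summable (\<lambda>j. gauss_term 0 1 (s / 2) j)"
      using s by (intro summable_gauss_sum) auto
  qed
  then have A: "(\<lambda>n. 1 + 2 * (\<Sum>j. a j n)) \<longlonglongrightarrow> theta3 s"
    unfolding theta3_def gauss_sum_def by (intro tendsto_intros)

  have "(\<lambda>n. \<Sum>k. b k n) \<longlonglongrightarrow> (\<Sum>k. gauss_term 0 1 (1 / s) k)"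
  proof (rule tannery_sequentially)
    fix k
    define u where "u n = pi * real (Suc k) / l n" for n
    have u: "u n \<ge> 0" for n using l_pos[of n] by (simp add: u_def)
    have "u \<longlonglongrightarrow> 0" unfolding u_def by (rule inv_l)
    have sin_lim: "(\<lambda>n. l n * sin (u n)) \<longlonglongrightarrow> pi * real (Suc k)"
      unfolding u_def by (rule tendsto_mult_sin_inverse[OF l_top])
    have cos_lim: "(\<lambda>n. cos (u n)) \<longlonglongrightarrow> 1"
      using tendsto_cos[OF \<open>u \<longlonglongrightarrow> 0\<close>] by simp
    have kn: "\<forall>\<^sub>F n in sequentially. k < n" by (rule eventually_gt_at_top)
    have u_less: "u n < pi / 2" if "k < n" for n
    proof -
      have "pi * (2 * real (Suc k)) < pi * l n" using that by (intro mult_strict_left_mono) (auto simp: l_def)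
      then show ?thesis using l_pos[of n] by (simp add: u_def field_simps)
    qed
    have *: "pi * real (Suc k) * (pi * real (Suc k)) / (pi * s) = pi * (real k + 1)\<^sup>2 * (1 / s)"
      using s by (simp add: power2_eq_square field_simps)
    \<comment> \<open>The sandwich is exp(-tan^2 u) \<le> cos^2 u \<le> exp(-sin^2 u), raised to the
      power \<open>m n\<close>.\<close>
    show "(\<lambda>n. b k n) \<longlonglongrightarrow> gauss_term 0 1 (1 / s) k"
    proof (rule tendsto_sandwich)
      show "(\<lambda>n. exp (- (real (m n) / (l n)\<^sup>2 * (l n * sin (u n) / cos (u n))\<^sup>2))) \<longlonglongrightarrow>
          gauss_term 0 1 (1 / s) k"
        by (rule tendsto_eq_intros m_lim sin_lim cos_lim refl)+ (use * in \<open>auto simp: power2_eq_square\<close>)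
      show "(\<lambda>n. exp (- (real (m n) / (l n)\<^sup>2 * (l n * sin (u n))\<^sup>2))) \<longlonglongrightarrow>
          gauss_term 0 1 (1 / s) k"
        by (rule tendsto_eq_intros m_lim sin_lim refl)+ (use * in \<open>auto simp: power2_eq_square\<close>)
      show "\<forall>\<^sub>F n in sequentially. exp (- (real (m n) / (l n)\<^sup>2 * (l n * sin (u n) / cos (u n))\<^sup>2)) \<le> b k n"
        using kn
      proof eventually_elim
        case (elim n)
        have c: "cos (u n) > 0" using u[of n] u_less[OF elim] by (intro cos_gt_zero_pi) auto
        have "exp (- ((sin (u n) / cos (u n))\<^sup>2)) \<le> 1 / (1 + (sin (u n) / cos (u n))\<^sup>2)"
          using exp_ge_add_one_self[of "(sin (u n) / cos (u n))\<^sup>2"]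
          by (simp add: exp_minus divide_inverse le_imp_inverse_le add_pos_nonneg)
        also have "1 / (1 + (sin (u n) / cos (u n))\<^sup>2) = (cos (u n))\<^sup>2"
          using c sin_cos_squared_add[of "u n"] by (simp add: field_simps)
        finally have "exp (- ((sin (u n) / cos (u n))\<^sup>2)) ^ m n \<le> ((cos (u n))\<^sup>2) ^ m n"
          by (intro power_mono) auto
        also have "exp (- ((sin (u n) / cos (u n))\<^sup>2)) ^ m n = exp (- (real (m n) / (l n)\<^sup>2 * (l n * sin (u n) / cos (u n))\<^sup>2))"
          using l_pos[of n] by (simp add: exp_of_nat_mult[symmetric] power_divide power_mult_distrib)
        finally show ?case using elim by (simp add: b_def u_def power_mult)
      qed
      show "\<forall>\<^sub>F n in sequentially. b k n \<le> exp (- (real (m n) / (l n)\<^sup>2 * (l n * sin (u n))\<^sup>2))"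
        using kn
      proof eventually_elim
        case (elim n)
        have "((cos (u n))\<^sup>2) ^ m n \<le> exp (- ((sin (u n))\<^sup>2)) ^ m n"
          using exp_ge_add_one_self[of "- ((sin (u n))\<^sup>2)"] by (intro power_mono[OF _ zero_le_power2]) (simp add: cos_squared_eq)
        also have "\<dots> = exp (- (real (m n) / (l n)\<^sup>2 * (l n * sin (u n))\<^sup>2))"
          using l_pos[of n] by (simp add: exp_of_nat_mult[symmetric] power_mult_distrib)
        finally show ?case using elim by (simp add: b_def u_def power_mult)
      qed
    qed
  next
    \<comment> \<open>Half of the limit of m/l^2. Together with the loss of 4 from sin u \<ge> u/2
      this explains the factor 8 in the majorant.\<close>
    have "\<forall>\<^sub>F n in sequentially. real (m n) / (l n)\<^sup>2 > 1 / (2 * pi * s)"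
      using s by (intro order_tendstoD(1)[OF m_lim]) (simp add: field_simps)
    then show "\<forall>\<^sub>F n in sequentially. \<forall>k. \<bar>b k n\<bar> \<le> gauss_term 0 1 (1 / (8 * s)) k"
    proof eventually_elim
      case (elim n)
      show ?case
      proof
        fix k
        show "\<bar>b k n\<bar> \<le> gauss_term 0 1 (1 / (8 * s)) k"
        proof (cases "k < n")
          case True
          define u where "u = pi * real (Suc k) / l n"
          have "pi * (2 * real (Suc k)) \<le> pi * l n" using True by (intro mult_left_mono) (auto simp: l_def)
          then have u: "0 \<le> u" "u \<le> pi / 2" using l_pos[of n] by (simp_all add: u_def field_simps)
          have "(u / 2)\<^sup>2 \<le> (sin u)\<^sup>2" using u by (intro power_mono sin_ge_half) auto
          then have "((cos u)\<^sup>2) ^ m n \<le> exp (- ((u / 2)\<^sup>2)) ^ m n"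
            using exp_ge_add_one_self[of "- ((u / 2)\<^sup>2)"] by (intro power_mono[OF _ zero_le_power2]) (simp add: cos_squared_eq)
          also have "\<dots> = exp (- (real (m n) / (l n)\<^sup>2 * (pi * real (Suc k) / 2)\<^sup>2))"
            using l_pos[of n] by (simp add: exp_of_nat_mult[symmetric] u_def power_divide)
          also have "\<dots> \<le> exp (- (1 / (2 * pi * s) * (pi * real (Suc k) / 2)\<^sup>2))"
            using elim by (intro iffD2[OF exp_le_cancel_iff] le_imp_neg_le mult_right_mono) auto
          also have "1 / (2 * pi * s) * (pi * real (Suc k) / 2)\<^sup>2 = pi * (real k + 1)\<^sup>2 * (1 / (8 * s))"
            using s by (simp add: power2_eq_square field_simps)
          finally have "((cos u)\<^sup>2) ^ m n \<le> exp (- (pi * (real k + 1)\<^sup>2 * (1 / (8 * s))))" .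
          moreover have "b k n = ((cos u)\<^sup>2) ^ m n"
            using True by (simp only: b_def u_def power_mult if_True)
          ultimately show ?thesis by simp
        qed (simp add: b_def)
      qed
    qed
    show "summable (\<lambda>k. gauss_term 0 1 (1 / (8 * s)) k)"
      using s by (intro summable_gauss_sum) auto
  qed
  then have B: "(\<lambda>n. 1 + 2 * (\<Sum>k. b k n)) \<longlonglongrightarrow> theta3 (1 / s)"
    unfolding theta3_def gauss_sum_def by (intro tendsto_intros)

  \<comment> \<open>The prefactor is squared so that Wallis applies: (2m+1)/l^2 converges to 2/(pi
    s), which cancels pi/2 and leaves 1/s.\<close>
  have "(\<lambda>n. (4 ^ m n / C n)\<^sup>2 / (2 * real (m n) + 1) * (2 * (real (m n) / (l n)\<^sup>2) + (1 / l n)\<^sup>2)) \<longlonglongrightarrow> pi / 2 * (2 * (1 / (pi * s)) + 0\<^sup>2)"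
    unfolding C_def
    by (intro tendsto_intros m_lim inv_l filterlim_compose[OF wallis_central_binomial m_top])
  moreover have "(4 ^ m n / C n)\<^sup>2 / (2 * real (m n) + 1) * (2 * (real (m n) / (l n)\<^sup>2) + (1 / l n)\<^sup>2) = (4 ^ m n / (C n * l n))\<^sup>2" for n
  proof -
    have "2 * (real (m n) / (l n)\<^sup>2) + (1 / l n)\<^sup>2 = (2 * real (m n) + 1) / (l n)\<^sup>2"
      by (simp add: add_divide_distrib power_divide)
    moreover have "2 * real (m n) + 1 \<noteq> 0" by (metis add_pos_nonneg less_irrefl mult_nonneg_nonneg of_nat_0_le_iff zero_le_numeral zero_less_one add.commute)
    ultimately show ?thesis by (simp add: power_divide power_mult_distrib)
  qed
  ultimately have "(\<lambda>n. (4 ^ m n / (C n * l n))\<^sup>2) \<longlonglongrightarrow> 1 / s"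
    using s by simp
  then have "(\<lambda>n. sqrt ((4 ^ m n / (C n * l n))\<^sup>2)) \<longlonglongrightarrow> sqrt (1 / s)"
    by (rule tendsto_real_sqrt)
  then have w: "(\<lambda>n. 4 ^ m n / (C n * l n)) \<longlonglongrightarrow> 1 / sqrt s"
    using C_pos l_pos by (simp add: real_sqrt_divide less_imp_le)

  have "1 + 2 * (\<Sum>j. a j n) = 4 ^ m n / (C n * l n) * (1 + 2 * (\<Sum>k. b k n))" for n
  proof -
    have "(\<Sum>j. a j n) = (\<Sum>j<m n. a j n)"
    proof (rule suminf_finite)
      fix j assume "j \<notin> {..<m n}"
      then have "m n < Suc j * (2 * n + 1)" by auto
      then show "a j n = 0" by (simp add: a_def binomial_eq_0 del: mult_Suc mult_Suc_right)
    qed simp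
    also have "\<dots> = (\<Sum>j<m n. real (2 * m n choose (m n + Suc j * (2 * n + 1)))) / C n"
      by (simp add: a_def sum_divide_distrib)
    finally have a: "1 + 2 * (\<Sum>j. a j n) = (C n + 2 * (\<Sum>j<m n. real (2 * m n choose (m n + Suc j * (2 * n + 1))))) / C n"
      using C_pos[of n] by (simp add: add_divide_distrib)
    have "(\<Sum>k. b k n) = (\<Sum>k<n. b k n)"
      by (rule suminf_finite) (auto simp: b_def)
    also have "\<dots> = (\<Sum>k<n. cos (pi * real (Suc k) / l n) ^ (2 * m n))"
      by (simp add: b_def)
    finally have b: "(\<Sum>k. b k n) = \<dots>" .
    have "1 + 2 * (\<Sum>j. a j n) =
        (l n * (C n + 2 * (\<Sum>j<m n. real (2 * m n choose (m n + Suc j * (2 * n + 1)))))) / (C n * l n)"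
      unfolding a using C_pos[of n] l_pos[of n] by simp
    also have "l n * (C n + 2 * (\<Sum>j<m n. real (2 * m n choose (m n + Suc j * (2 * n + 1))))) =
        4 ^ m n * (1 + 2 * (\<Sum>k. b k n))"
      unfolding b l_def C_def by (rule polya_identity)
    finally show ?thesis by simp
  qed
  then have "(\<lambda>n. 1 + 2 * (\<Sum>j. a j n)) \<longlonglongrightarrow> 1 / sqrt s * theta3 (1 / s)"
    using tendsto_mult[OF w B] by simp
  with A have "theta3 s = 1 / sqrt s * theta3 (1 / s)" by (rule LIMSEQ_unique)
  then show ?thesis by simp
qed

lemma theta3_add_theta2: "s > 0 \<Longrightarrow> theta3 s + theta2 s = 2 / sqrt s * theta3 (4 / s)"
  using theta3_inverse[of "s / 4"] theta3_quarter[of s] by (simp add: real_sqrt_divide)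

text \<open>Poisson summation with alternating signs, obtained from \<open>theta3_inverse\<close>
  and the splitting by parity. The right side is positive, which gives
  \<open>theta2 < theta3\<close>, and exponentially small as \<open>s\<close> tends to 0, which
  makes the two weights merge for small \<open>t\<close>.\<close>

lemma theta3_diff_theta2:
  assumes "s > 0"
  shows "theta3 s - theta2 s = 2 / sqrt s * theta2 (4 / s)"
proof -
  have "theta2 (4 / s) = theta3 (1 / s) - theta3 (4 / s)"
    using theta3_quarter[of "4 / s"] assms by simp
  also have "\<dots> = sqrt s * theta3 s - sqrt s / 2 * (theta3 s + theta2 s)"
  proof -
    have "theta3 (1 / s) = sqrt s * theta3 s" using theta3_inverse[OF assms] assms by simp
    moreover have "theta3 (4 / s) = sqrt s / 2 * theta3 (s / 4)"
      using theta3_inverse[of "s / 4"] assms by (simp add: real_sqrt_divide)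
    ultimately show ?thesis using theta3_quarter[OF assms] by simp
  qed
  finally show ?thesis using assms by (simp add: field_simps)
qed

lemma theta2_less_theta3: "s > 0 \<Longrightarrow> theta2 s < theta3 s"
  using theta3_diff_theta2[of s] theta2_pos[of "4 / s"]
  by (metis diff_gt_0_iff_gt divide_pos_pos mult_pos_pos real_sqrt_gt_0_iff zero_less_numeral)

section \<open>Monotonicity of products of theta constants\<close>

lemma DERIV_theta3:
  "s > 0 \<Longrightarrow> (theta3 has_real_derivative - (2 * gauss_sum 1 1 s)) (at s)"
  unfolding theta3_def by (auto intro!: derivative_eq_intros)

lemma DERIV_theta2:
  "s > 0 \<Longrightarrow> (theta2 has_real_derivative - (2 * gauss_sum 1 (1/2) s)) (at s)"
  unfolding theta2_def by (auto intro!: derivative_eq_intros)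

lemmas DERIV_theta_chain [derivative_intros] =
  DERIV_chain2[OF DERIV_theta3] DERIV_chain2[OF DERIV_theta2]

text \<open>The logarithmic derivative of \<open>theta3\<close> with respect to \<open>- ln s\<close>.\<close>

definition theta3_slope :: "real \<Rightarrow> real" where
  "theta3_slope s = 2 * s * gauss_sum 1 1 s / theta3 s"

text \<open>The logarithmic derivative of the inversion formula. At \<open>s = 1\<close> it yields
  the exact value 1/4.\<close>

lemma theta3_slope_inverse:
  assumes s: "s > 0"
  shows "theta3_slope s + theta3_slope (1 / s) = 1 / 2"
proof -
  have "((\<lambda>s. theta3 (1 / s) / sqrt s) has_real_derivative - (2 * gauss_sum 1 1 s)) (at s)"
  proof -
    have ev: "\<forall>\<^sub>F x in nhds s. theta3 x = theta3 (1 / x) / sqrt x"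
      using eventually_nhds_in_open[of "{0<..}" s] s
      by (auto elim!: eventually_mono intro: theta3_inverse)
    show ?thesis
      using DERIV_theta3[OF s] unfolding DERIV_cong_ev[OF refl ev refl] .
  qed
  moreover have "((\<lambda>s. theta3 (1 / s) / sqrt s) has_real_derivative
     (2 * gauss_sum 1 1 (1 / s) / s\<^sup>2 * sqrt s - theta3 (1 / s) * (1 / (2 * sqrt s))) / s) (at s)"
    using s by (auto intro!: derivative_eq_intros simp: power2_eq_square field_simps)
  ultimately have "- (2 * gauss_sum 1 1 s) = (2 * gauss_sum 1 1 (1 / s) / s\<^sup>2 * sqrt s - theta3 (1 / s) * (1 / (2 * sqrt s))) / s"
    by (rule DERIV_unique)
  then have *: "2 * s * gauss_sum 1 1 s = theta3 (1 / s) / (2 * sqrt s) - 2 * gauss_sum 1 1 (1 / s) / s * (sqrt s / s)"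
    using s by (simp add: field_simps power2_eq_square)
  have "sqrt s / s = 1 / sqrt s" using s by (simp add: field_simps)
  then have *: "2 * s * gauss_sum 1 1 s = (theta3 (1 / s) / 2 - 2 * (1 / s) * gauss_sum 1 1 (1 / s)) / sqrt s"
    unfolding * by (simp add: diff_divide_distrib)
  show ?thesis
    unfolding theta3_slope_def * theta3_inverse[OF s]
    using s theta3_gt_1[of "1 / s"] by (simp add: field_simps)
qed

text \<open>With x = pi (n+1)^2 s, the estimates x exp(-x) \<le> exp(-x/2) and x/2 \<ge> n + 1 bound
  the terms by 1/2, 1/4, 1/8 and so on, whose sum is 1.\<close>

lemma gauss_sum_1_le:
  assumes "s \<ge> 1"
  shows "s * gauss_sum 1 1 s \<le> 1"
proof -
  have e: "exp (- 1) \<le> (1 / 2 :: real)"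
    using le_imp_inverse_le[of 2 "exp 1"] exp_ge_add_one_self[of 1] by (simp add: exp_minus inverse_eq_divide)
  have "s * gauss_term 1 1 s n \<le> (1 / 2) ^ Suc n" for n
  proof -
    define x where "x = pi * (real n + 1)\<^sup>2 * s"
    have "real n + 1 \<le> (real n + 1)\<^sup>2" by (simp add: power2_eq_square algebra_simps)
    also have "\<dots> \<le> x / 2"
      using assms pi_ge_two mult_mono[of 2 "pi" 1 s] by (simp add: x_def mult_ac mult_le_cancel_right1)
    finally have x: "real n + 1 \<le> x / 2" .
    have "x * exp (- x) \<le> exp (x / 2) * exp (- x)"
    proof (rule mult_right_mono)
      have "x \<le> 1 + x / 2 + (x / 2)\<^sup>2 / 2"
        using zero_le_power2[of "x / 2 - 1"] by (simp add: power2_eq_square algebra_simps)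
      also have "\<dots> \<le> exp (x / 2)" using x by (intro exp_lower_Taylor_quadratic) auto
      finally show "x \<le> exp (x / 2)" .
    qed simp
    also have "\<dots> = exp (- (x / 2))" by (simp flip: exp_add)
    also have "\<dots> \<le> exp (- (real (Suc n)))" using x by simp
    also have "\<dots> = exp (- 1) ^ Suc n" using exp_of_nat_mult[of "Suc n" "-1::real"] by (simp only: mult_minus_right mult_1_right)
    also have "\<dots> \<le> (1 / 2) ^ Suc n" using e by (intro power_mono) auto
    finally show ?thesis by (simp add: x_def mult_ac)
  qed
  moreover have "(\<lambda>n. s * gauss_term 1 1 s n) sums (s * gauss_sum 1 1 s)"
    using assms by (intro sums_mult gauss_sum_sums) auto
  ultimately show ?thesis
    by (rule sums_le[OF _ _ power_half_series])
qed

lemma gauss_sum_2_ge: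
  assumes "s > 0" "a \<ge> 1"
  shows "gauss_sum 2 a s \<ge> pi * gauss_sum 1 a s"
proof (rule sums_le)
  show "(\<lambda>n. pi * gauss_term 1 a s n) sums (pi * gauss_sum 1 a s)"
    using assms by (intro sums_mult gauss_sum_sums) auto
  show "(\<lambda>n. gauss_term 2 a s n) sums gauss_sum 2 a s"
    using assms by (intro gauss_sum_sums) auto
  fix n
  have "pi * (pi * (real n + a)\<^sup>2) \<le> (pi * (real n + a)\<^sup>2) * (pi * (real n + a)\<^sup>2)"
    using power_mono[of 1 "real n + a" 2] assms by (intro mult_right_mono) auto
  then show "pi * gauss_term 1 a s n \<le> gauss_term 2 a s n"
    by (simp add: power2_eq_square mult.assoc[symmetric] mult_right_mono del: power_one_right)
qed

text \<open>By \<open>gauss_sum_2_ge\<close> the numerator of the derivative is at most 2 G1 (2 x G1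
  - (pi x - 1) T). Here x G1 \<le> 1, while pi - 1 > 2 and T > 1, so the bracket is
  negative.\<close>

lemma theta3_slope_strict_antimono:
  assumes "1 \<le> s" "s < s'"
  shows "theta3_slope s' < theta3_slope s"
proof (rule DERIV_neg_imp_decreasing[OF assms(2)])
  fix x assume "s \<le> x" "x \<le> s'"
  then have x: "x \<ge> 1" using assms by simp
  define G1 G2 T where "G1 = gauss_sum 1 1 x" and "G2 = gauss_sum 2 1 x" and "T = theta3 x"
  have T: "T > 1" unfolding T_def using x by (intro theta3_gt_1) auto
  have G1: "G1 > 0" unfolding G1_def using x by (intro gauss_sum_pos) auto
  have "(theta3_slope has_real_derivative ((2 * G1 - 2 * x * G2) * T + 2 * x * G1 * (2 * G1)) / T\<^sup>2) (at x)"
    unfolding theta3_slope_def[abs_def] G1_def G2_def T_def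
    using x T by (auto intro!: derivative_eq_intros simp: T_def power2_eq_square numeral_2_eq_2)
  moreover have "(2 * G1 - 2 * x * G2) * T + 2 * x * G1 * (2 * G1) < 0"
  proof -
    have "x * (pi * G1) \<le> x * G2"
      unfolding G1_def G2_def using x gauss_sum_2_ge[of x] by (intro mult_left_mono) auto
    then have "(2 * G1 - 2 * x * G2) * T \<le> (2 * G1 - 2 * (x * (pi * G1))) * T"
      using T by (intro mult_right_mono) auto
    also have "\<dots> = - (2 * G1) * ((x * pi - 1) * T)" by (simp add: algebra_simps)
    finally have "(2 * G1 - 2 * x * G2) * T + 2 * x * G1 * (2 * G1) \<le> 2 * G1 * (2 * (x * G1) - (x * pi - 1) * T)"
      by (simp add: algebra_simps)
    moreover have "(x * pi - 1) * T > 2"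
    proof -
      have "x * pi \<ge> 1 * pi" using x by (intro mult_right_mono) auto
      moreover have "pi > 3" using pi_approx by simp
      ultimately have "x * pi - 1 > 2" by linarith
      then have "(x * pi - 1) * T > 2 * 1" using T by (intro mult_strict_mono) auto
      then show ?thesis by simp
    qed
    moreover have "x * G1 \<le> 1" unfolding G1_def by (rule gauss_sum_1_le[OF x])
    ultimately show ?thesis
      using G1 mult_pos_neg[of "2 * G1" "2 * (x * G1) - (x * pi - 1) * T"] by linarith
  qed
  ultimately show "\<exists>D. (theta3_slope has_real_derivative D) (at x) \<and> D < 0"
    using T by (intro exI[of _ "((2 * G1 - 2 * x * G2) * T + 2 * x * G1 * (2 * G1)) / T\<^sup>2"] conjI)
      (simp_all add: divide_neg_pos)
qed

text \<open>When \<open>a / y\<close> falls below 1, outside the range of the monotonicity lemma,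
  the reflection \<open>theta3_slope_inverse\<close> shows that its slope exceeds 1/4, whereas
  \<open>a * y > 1\<close> has slope below 1/4.\<close>

lemma theta3_slope_less:
  assumes "a \<ge> 1" "y > 1"
  shows "theta3_slope (a * y) < theta3_slope (a / y)"
proof -
  have half: "theta3_slope 1 = 1 / 4" using theta3_slope_inverse[of 1] by simp
  have ay: "a * y > 1"
  proof -
    have "1 * y \<le> a * y" using assms by (intro mult_right_mono) auto
    then show ?thesis using assms(2) by linarith
  qed
  show ?thesis
  proof (cases "a / y \<ge> 1")
    case True
    have "a / y < a * y"
    proof -
      have "1 / y < y" using assms less_1_mult[of y y] by (simp add: divide_less_eq)
      then have "a * (1 / y) < a * y" using assms by (intro mult_strict_left_mono) auto
      then show ?thesis by simp
    qed
    then show ?thesis using True by (rule theta3_slope_strict_antimono[rotated])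
  next
    case False
    then have "y / a > 1" using assms by (simp add: field_simps)
    then have "theta3_slope (y / a) < 1 / 4" using theta3_slope_strict_antimono[of 1 "y / a"] half by simp
    moreover have "theta3_slope (a * y) < 1 / 4" using theta3_slope_strict_antimono[of 1 "a * y"] half ay by simp
    moreover have "theta3_slope (a / y) + theta3_slope (y / a) = 1 / 2"
      using theta3_slope_inverse[of "a / y"] assms by simp
    ultimately show ?thesis by linarith
  qed
qed

lemma theta3_prod_dual:
  assumes "a > 0" "y > 0"
  shows "theta3 (a * y) * theta3 (a / y) = theta3 (1 / a * y) * theta3 (1 / a / y) / a"
proof -
  have "sqrt (a * y) * sqrt (a / y) = a"
    using assms by (simp add: real_sqrt_mult[symmetric] power2_eq_square[symmetric])
  moreover have "theta3 (a * y) * theta3 (a / y) =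
      theta3 (1 / (a * y)) * theta3 (1 / (a / y)) / (sqrt (a * y) * sqrt (a / y))"
    using theta3_inverse[of "a * y"] theta3_inverse[of "a / y"] assms by simp
  ultimately show ?thesis by (simp add: mult.commute)
qed

text \<open>By \<open>theta3_inverse\<close> it suffices to treat \<open>a \<ge> 1\<close>, where the claim is the log-convexity of
  \<open>u \<mapsto> theta3 (exp u)\<close>.\<close>

lemma theta3_prod_strict_mono:
  assumes "a > 0" "1 \<le> y" "y < y'"
  shows "theta3 (a * y) * theta3 (a / y) < theta3 (a * y') * theta3 (a / y')"
proof -
  have *: "theta3 (a * y) * theta3 (a / y) < theta3 (a * y') * theta3 (a / y')" if a: "a \<ge> 1" for a
  proof (rule DERIV_pos_imp_increasing_open[OF assms(3)])
    fix x assume x: "y < x" "x < y'"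
    then have x1: "x > 1" using assms by simp
    define N where "N s = 2 * s * gauss_sum 1 1 s" for s
    have "((\<lambda>y. theta3 (a * y) * theta3 (a / y)) has_real_derivative
       (N (a / x) * theta3 (a * x) - N (a * x) * theta3 (a / x)) / x) (at x)"
      using a x1 by (auto intro!: derivative_eq_intros simp: N_def power2_eq_square field_simps)
    moreover have "N (a * x) * theta3 (a / x) < N (a / x) * theta3 (a * x)"
    proof -
      have "theta3 (a * x) > 0" "theta3 (a / x) > 0"
        using theta3_gt_1[of "a * x"] theta3_gt_1[of "a / x"] a x1 by auto
      moreover from this have "N (a * x) / theta3 (a * x) * (theta3 (a * x) * theta3 (a / x)) <
          N (a / x) / theta3 (a / x) * (theta3 (a * x) * theta3 (a / x))"
        by (intro mult_strict_right_mono mult_pos_pos)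
          (use theta3_slope_less[OF a x1] in \<open>simp_all add: theta3_slope_def N_def\<close>)
      ultimately show ?thesis by (simp add: mult.assoc)
    qed
    ultimately show "\<exists>D. ((\<lambda>y. theta3 (a * y) * theta3 (a / y)) has_real_derivative D) (at x) \<and> D > 0"
      using x1 by (intro exI conjI) auto
  next
    have "isCont (\<lambda>y. theta3 (a * y) * theta3 (a / y)) x" if "x > 0" for x
      using that a by (intro continuous_intros DERIV_isCont[OF DERIV_theta3, THEN isCont_o2[rotated]]) auto
    then show "continuous_on {y..y'} (\<lambda>y. theta3 (a * y) * theta3 (a / y))"
      using assms by (intro continuous_at_imp_continuous_on) auto
  qed
  show ?thesis
  proof (cases "a \<ge> 1")
    case False
    have "theta3 (1 / a * y) * theta3 (1 / a / y) / a < theta3 (1 / a * y') * theta3 (1 / a / y') / a"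
      using *[of "1 / a"] False assms by (intro divide_strict_right_mono) auto
    then show ?thesis
      using assms by (subst (1 2) theta3_prod_dual) auto
  qed (rule *)
qed

section \<open>Minimality of the triangular lattice\<close>

text \<open>The inequality (n + a)^2 \<ge> a^2 + 2 a n compares the series with a geometric
  one.\<close>

lemma gauss_sum_0_le:
  assumes "s > 0" "a > 0"
  shows "gauss_sum 0 a s \<le> exp (- (pi * a\<^sup>2 * s)) / (1 - exp (- (2 * pi * a * s)))"
proof (rule sums_le)
  show "(\<lambda>n. gauss_term 0 a s n) sums gauss_sum 0 a s"
    using assms by (intro gauss_sum_sums) auto
  have "(\<lambda>n. exp (- (pi * a\<^sup>2 * s)) * exp (- (2 * pi * a * s)) ^ n) sums
      (exp (- (pi * a\<^sup>2 * s)) * (1 / (1 - exp (- (2 * pi * a * s)))))"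
    using assms by (intro sums_mult geometric_sums) auto
  then show "(\<lambda>n. exp (- (pi * a\<^sup>2 * s)) * exp (- (2 * pi * a * s)) ^ n) sums
      (exp (- (pi * a\<^sup>2 * s)) / (1 - exp (- (2 * pi * a * s))))"
    by simp
  fix n
  have "a\<^sup>2 + 2 * a * real n \<le> (real n + a)\<^sup>2" by (simp add: power2_eq_square algebra_simps)
  then have "pi * s * (a\<^sup>2 + 2 * a * real n) \<le> pi * s * (real n + a)\<^sup>2"
    using assms by (intro mult_left_mono) auto
  then have "exp (- (pi * (real n + a)\<^sup>2 * s)) \<le> exp (- (pi * a\<^sup>2 * s) + real n * (- (2 * pi * a * s)))"
    by (simp add: algebra_simps)
  then show "gauss_term 0 a s n \<le>
      exp (- (pi * a\<^sup>2 * s)) * exp (- (2 * pi * a * s)) ^ n"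
    by (simp only: exp_add exp_of_nat_mult power_0 mult_1)
qed

lemma exp_Taylor_bound:
  fixes x :: real
  assumes "\<bar>x\<bar> \<le> 1"
  shows "\<bar>exp x - (\<Sum>m<n. x ^ m / fact m)\<bar> \<le> 3 * \<bar>x\<bar> ^ n / fact n"
proof -
  obtain t where t: "\<bar>t\<bar> \<le> \<bar>x\<bar>" "exp x = (\<Sum>m<n. x ^ m / fact m) + (exp t / fact n) * x ^ n"
    using Maclaurin_exp_le by blast
  have "exp t \<le> exp 1" using t(1) assms by simp
  also have "\<dots> \<le> 3" by (rule exp_le)
  finally have "exp t \<le> 3" .
  then have "exp t * \<bar>x\<bar> ^ n \<le> 3 * \<bar>x\<bar> ^ n" by (intro mult_right_mono) auto
  then show ?thesis using t(2) by (simp add: abs_mult power_abs divide_right_mono)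
qed

lemma exp_ge_Taylor:
  fixes x :: real
  assumes "x \<ge> 0"
  shows "(\<Sum>m<n. x ^ m / fact m) \<le> exp x"
proof -
  have "(\<Sum>m<n. x ^ m /\<^sub>R fact m) \<le> (\<Sum>m. x ^ m /\<^sub>R fact m)"
    using assms by (intro sum_le_suminf summable_exp_generic) auto
  then show ?thesis by (simp add: exp_def divide_inverse mult.commute)
qed

lemma exp_ge_Taylor_even:
  fixes x :: real
  assumes "even n"
  shows "(\<Sum>m<n. x ^ m / fact m) \<le> exp x"
proof -
  obtain t where "exp x = (\<Sum>m<n. x ^ m / fact m) + (exp t / fact n) * x ^ n"
    using Maclaurin_exp_le by blast
  moreover have "(exp t / fact n) * x ^ n \<ge> 0" using assms by (simp add: zero_le_even_power)
  ultimately show ?thesis by linarith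
qed

lemma exp_minus_ge_cubic:
  fixes z :: real
  shows "exp (- z) \<ge> 1 - z + z\<^sup>2 / 2 - z ^ 3 / 6"
proof -
  have "(\<Sum>m<4. (- z) ^ m / fact m) \<le> exp (- z)" by (rule exp_ge_Taylor_even) simp
  then show ?thesis by (simp add: eval_nat_numeral lessThan_Suc)
qed

text \<open>Theta function of the planar centred rectangular lattice with cell \<open>sqrt y\<close>
  by \<open>1 / sqrt y\<close>: a square lattice for \<open>y = 1\<close>, the triangular one for
  \<open>y = sqrt 3\<close>.\<close>

definition bcc_sum :: "real \<Rightarrow> real \<Rightarrow> real" where
  "bcc_sum a y = theta3 (a * y) * theta3 (a / y) + theta2 (a * y) * theta2 (a / y)"

text \<open>A change of basis: the parity of \<open>n\<close> sorts the points of a sheared lattice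
  into a rectangular lattice and its centred translate. The rotation by which the triangular case is
  treated is an integer matrix in the sheared coordinates.\<close>

lemma has_sum_hex:
  fixes b Y :: real
  assumes b: "b > 0" and Y: "Y > 0"
  shows "((\<lambda>(n::int, m::int). exp (- (pi * b * ((of_int n)\<^sup>2 * Y + (of_int m + of_int n / 2)\<^sup>2 / Y)))) has_sum
    bcc_sum (2 * b) (2 * Y)) UNIV"
    (is "(?f has_sum _) _")
proof -
  have arg: "2 * b * (2 * Y) = 4 * b * Y" "2 * b / (2 * Y) = b / Y" by simp_all
  have pos: "4 * b * Y > 0" "b / Y > 0" using assms by auto
  have even: "(?f has_sum (theta3 (4 * b * Y) * theta3 (b / Y))) (range (\<lambda>(j, m). (2 * j, m - j)))"
  proof (subst has_sum_reindex)
    have "((\<lambda>(j, m). exp (- (pi * (4 * b * Y) * (of_int j)\<^sup>2)) * exp (- (pi * (b / Y) * (of_int m)\<^sup>2)))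
        has_sum (theta3 (4 * b * Y) * theta3 (b / Y))) (UNIV \<times> UNIV)"
      by (intro has_sum_mult_Times has_sum_theta3 pos) auto
    moreover have "?f (2 * j, m - j) = exp (- (pi * (4 * b * Y) * (of_int j)\<^sup>2)) * exp (- (pi * (b / Y) * (of_int m)\<^sup>2))" for j m
      by (simp add: power2_eq_square algebra_simps flip: exp_add)
    ultimately show "(?f \<circ> (\<lambda>(j, m). (2 * j, m - j)) has_sum (theta3 (4 * b * Y) * theta3 (b / Y))) UNIV"
      by (simp add: o_def case_prod_unfold)
  qed (auto simp: inj_on_def)
  have odd: "(?f has_sum (theta2 (4 * b * Y) * theta2 (b / Y))) (range (\<lambda>(j, m). (2 * j + 1, m - j)))"
  proof (subst has_sum_reindex)
    have "((\<lambda>(j, m). exp (- (pi * (4 * b * Y) * (of_int j + 1/2)\<^sup>2)) * exp (- (pi * (b / Y) * (of_int m + 1/2)\<^sup>2)))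
        has_sum (theta2 (4 * b * Y) * theta2 (b / Y))) (UNIV \<times> UNIV)"
      by (intro has_sum_mult_Times has_sum_theta2 pos) auto
    moreover have "?f (2 * j + 1, m - j) = exp (- (pi * (4 * b * Y) * (of_int j + 1/2)\<^sup>2)) * exp (- (pi * (b / Y) * (of_int m + 1/2)\<^sup>2))" for j m
    proof -
      have "(real_of_int (2 * j + 1))\<^sup>2 = 4 * (of_int j + 1/2)\<^sup>2"
        "real_of_int (m - j) + of_int (2 * j + 1) / 2 = of_int m + 1/2"
        by (simp_all add: power2_eq_square field_simps)
      then show ?thesis by (simp only: prod.case) (simp add: algebra_simps flip: exp_add)
    qed
    ultimately show "(?f \<circ> (\<lambda>(j, m). (2 * j + 1, m - j)) has_sum (theta2 (4 * b * Y) * theta2 (b / Y))) UNIV"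
      by (simp add: o_def case_prod_unfold)
  qed (auto simp: inj_on_def)
  have "range (\<lambda>(j::int, m::int). (2 * j, m - j)) \<inter> range (\<lambda>(j, m). (2 * j + 1, m - j)) = {}"
    by (auto simp: set_eq_iff) presburger
  from has_sum_Un_disjoint[OF even odd this]
  have "(?f has_sum bcc_sum (2 * b) (2 * Y))
    (range (\<lambda>(j, m). (2 * j, m - j)) \<union> range (\<lambda>(j, m). (2 * j + 1, m - j)))"
    unfolding bcc_sum_def arg .
  moreover have "(n, m) \<in> range (\<lambda>(j, m). (2 * j, m - j)) \<union> range (\<lambda>(j, m). (2 * j + 1, m - j))" for n m :: int
  proof (cases "even n")
    case True
    then obtain j where "n = 2 * j" by blast
    then have "(n, m) = (\<lambda>(j, m). (2 * j, m - j)) (j, m + j)" by simp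
    then show ?thesis by blast
  next
    case False
    then obtain j where "n = 2 * j + 1" by (auto elim: oddE)
    then have "(n, m) = (\<lambda>(j, m). (2 * j + 1, m - j)) (j, m + j)" by simp
    then show ?thesis by blast
  qed
  then have "range (\<lambda>(j, m). (2 * j, m - j)) \<union> range (\<lambda>(j, m). (2 * j + 1, m - j)) = (UNIV :: (int \<times> int) set)"
    by auto
  ultimately show ?thesis by simp
qed

text \<open>Twice the sum is the product of the sums \<open>theta3 + theta2\<close> plus the product
  of the differences \<open>theta3 - theta2\<close>, and inversion turns each of these into a single
  theta constant at four times the inverse argument. Since \<open>a\<close> and \<open>4 / a\<close>
  are exchanged, only \<open>a \<ge> 2\<close> has to be estimated.\<close>

lemma bcc_sum_dual:
  assumes "a > 0" "y > 0"
  shows "bcc_sum a y = 2 / a * bcc_sum (4 / a) y"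
proof -
  define u v where "u = a * y" and "v = a / y"
  have pos: "u > 0" "v > 0" using assms by (auto simp: u_def v_def)
  have uv: "sqrt u * sqrt v = a"
    using assms by (simp add: u_def v_def real_sqrt_mult[symmetric] power2_eq_square[symmetric])
  have "2 * bcc_sum a y = (theta3 u + theta2 u) * (theta3 v + theta2 v) + (theta3 u - theta2 u) * (theta3 v - theta2 v)"
    by (simp add: bcc_sum_def u_def v_def algebra_simps)
  also have "\<dots> = 4 / (sqrt u * sqrt v) * (theta3 (4 / u) * theta3 (4 / v) + theta2 (4 / u) * theta2 (4 / v))"
    unfolding theta3_add_theta2[OF pos(1)] theta3_add_theta2[OF pos(2)] theta3_diff_theta2[OF pos(1)] theta3_diff_theta2[OF pos(2)]
    by (simp add: algebra_simps)
  finally have "2 * bcc_sum a y = 4 / a * (theta3 (4 / u) * theta3 (4 / v) + theta2 (4 / u) * theta2 (4 / v))"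
    unfolding uv .
  moreover have "4 / u = 4 / a / y" "4 / v = 4 / a * y" by (simp_all add: u_def v_def)
  ultimately have "2 * bcc_sum a y = 2 * (2 / a * bcc_sum (4 / a) y)"
    by (simp only: bcc_sum_def mult.commute[of "theta3 (4 / a / y)"] mult.commute[of "theta2 (4 / a / y)"])
  then show ?thesis by simp
qed

text \<open>Four times the norm is a square plus three times a square, so only entries of modulus at
  most 1 need checking. The norm 2 is not attained, which leaves room between the six shortest
  vectors and the tail.\<close>

lemma eisenstein_norm_ge_3:
  fixes m n :: int
  assumes "(n, m) \<notin> {(0, 0), (0, 1), (0, -1), (1, 0), (-1, 0), (1, -1), (-1, 1)}"
  shows "m\<^sup>2 + m * n + n\<^sup>2 \<ge> 3"
proof -
  have *: "4 * (m\<^sup>2 + m * n + n\<^sup>2) = (2 * m + n)\<^sup>2 + 3 * n\<^sup>2"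
    "4 * (m\<^sup>2 + m * n + n\<^sup>2) = (2 * n + m)\<^sup>2 + 3 * m\<^sup>2"
    by (simp_all add: power2_eq_square algebra_simps)
  have sq: "4 \<le> k\<^sup>2" if "\<bar>k\<bar> \<ge> 2" for k :: int
    using power_mono[of 2 "\<bar>k\<bar>" 2] that by simp
  consider "\<bar>m\<bar> \<ge> 2" | "\<bar>n\<bar> \<ge> 2" | "m \<in> {-1, 0, 1}" "n \<in> {-1, 0, 1}" by fastforce
  then show ?thesis
  proof cases
    case 1
    have "4 * (m\<^sup>2 + m * n + n\<^sup>2) \<ge> 12"
      unfolding *(2) using sq[OF 1] zero_le_power2[of "2 * n + m"] by linarith
    then show ?thesis by simp
  next
    case 2
    have "4 * (m\<^sup>2 + m * n + n\<^sup>2) \<ge> 12"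
      unfolding *(1) using sq[OF 2] zero_le_power2[of "2 * m + n"] by linarith
    then show ?thesis by simp
  next
    case 3
    then show ?thesis using assms by auto
  qed
qed

text \<open>For \<open>E = exp \<tau>\<close> the quadratic form of the triangular lattice, deformed by \<open>\<tau>\<close>, equals
  \<open>N cosh \<tau> - X sinh \<tau>\<close>, where the values of \<open>X\<close> along an orbit of the rotation
  \<open>(n, m) \<mapsto> (m, - m - n)\<close> of order three add up to zero.  By the inequality between the arithmetic and the
  geometric mean each orbit therefore loses at most a term proportional to \<open>cosh \<tau> - 1\<close>,
  and the excess \<open>J\<close> of the shortest vectors pays for all of these losses.\<close>

lemma bcc_sum_compare:
  fixes a E :: real
  defines "s \<equiv> pi * a / sqrt 3" and "d \<equiv> (E - 1)\<^sup>2 / (2 * E)" and "S \<equiv> (E - 1 / E) / 2"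
  defines "J \<equiv> exp (s * (S - d)) + 2 * exp (- (s * (S / 2 + d))) - 3"
  assumes a: "a \<ge> 2" and E: "E > 0"
  shows "3 * (bcc_sum a (sqrt 3 * E) - bcc_sum a (sqrt 3)) \<ge> exp (- s) * (6 * J - 6 / 5 * min 1 (s * d))"
proof -
  \<comment> \<open>The loss 1 - exp(-s N d) of a vector of norm N \<ge> 1 is at most N times this
    minimum: s N d controls small deformations, 1 controls large ones.\<close>
  define \<mu> where "\<mu> = min 1 (s * d)"
  have s0: "s \<ge> 36 / 10"
  proof -
    have "sqrt 3 \<le> 174 / 100" by (rule real_le_lsqrt) (auto simp: power2_eq_square)
    then have "36 / 10 * sqrt 3 \<le> 2 * pi" using pi_approx by simp
    also have "\<dots> \<le> pi * a" using a by simp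
    finally show ?thesis by (simp add: s_def pos_le_divide_eq)
  qed
  have d0: "d \<ge> 0" using E by (simp add: d_def)
  have mu: "0 \<le> \<mu>" "\<mu> \<le> 1" "\<mu> \<le> s * d" using s0 d0 by (auto simp: \<mu>_def)
  define Q :: "real \<Rightarrow> int \<times> int \<Rightarrow> real" where
    "Q E = (\<lambda>(n, m). (of_int m + of_int n / 2)\<^sup>2 / E + 3 / 4 * (of_int n)\<^sup>2 * E)" for E
  define N :: "int \<times> int \<Rightarrow> real" where "N = (\<lambda>(n, m). of_int (m\<^sup>2 + m * n + n\<^sup>2))"
  define X :: "int \<times> int \<Rightarrow> real" where "X = (\<lambda>(n, m). of_int (m\<^sup>2 + m * n) - of_int (n\<^sup>2) / 2)"
  define \<rho> :: "int \<times> int \<Rightarrow> int \<times> int" where "\<rho> = (\<lambda>(n, m). (m, - m - n))"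
  define e where "e E p = exp (- (s * Q E p))" for E p
  define W where "W E p = e E p + e E (\<rho> p) + e E (\<rho> (\<rho> p))" for E p
  \<comment> \<open>The majorant exp(-(n^2 + m^2)/4) of the tail, written with the parameter 1/(4
    pi) so that its total is \<open>?T\<close>, which the inversion formula makes explicit.\<close>
  let ?G = "\<lambda>(n::int, m::int). exp (- (pi * (1 / (4 * pi)) * (of_int n)\<^sup>2)) * exp (- (pi * (1 / (4 * pi)) * (of_int m)\<^sup>2))"
  let ?V = "\<lambda>p. exp (s * X p * S) + exp (s * X (\<rho> p) * S) + exp (s * X (\<rho> (\<rho> p)) * S)"
  let ?T = "theta3 (1 / (4 * pi)) * theta3 (1 / (4 * pi))"
  have bij: "bij \<rho>"
    by (rule bij_betwI[where g = "\<lambda>(n, m). (- m - n, n)"]) (auto simp: \<rho>_def)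
  have N_rho: "N (\<rho> p) = N p" for p
    by (cases p) (simp add: N_def \<rho>_def power2_eq_square algebra_simps)
  have X_rho: "X p + X (\<rho> p) + X (\<rho> (\<rho> p)) = 0" for p
    by (cases p) (simp add: X_def \<rho>_def power2_eq_square field_simps)
  have Q_eq: "Q E p = N p * (1 + (E - 1)\<^sup>2 / (2 * E)) - X p * ((E - 1 / E) / 2)" if "E > 0" for E p
    using that by (cases p) (simp add: Q_def N_def X_def power2_eq_square field_simps)
  have e_eq: "e E p = exp (- (s * N p * (1 + d))) * exp (s * X p * S)" for p
  proof -
    have eq: "Q E p = N p * (1 + d) - X p * S"
      using Q_eq[OF E, of p] unfolding d_def[symmetric] S_def[symmetric] .
    show ?thesis unfolding e_def eq by (simp add: algebra_simps flip: exp_add)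
  qed
  have e1: "e 1 p = exp (- (s * N p))" for p
    using Q_eq[of 1 p] by (simp add: e_def)

  have has_sum_e: "(e E has_sum bcc_sum a (sqrt 3 * E)) UNIV" if "E > 0" for E
  proof -
    have "((\<lambda>(n, m). exp (- (pi * (a / 2) * ((of_int n)\<^sup>2 * (sqrt 3 / 2 * E) + (of_int m + of_int n / 2)\<^sup>2 / (sqrt 3 / 2 * E))))) has_sum
      bcc_sum (2 * (a / 2)) (2 * (sqrt 3 / 2 * E))) UNIV"
      using that a by (intro has_sum_hex) auto
    moreover have "s * Q E (n, m) = pi * (a / 2) * ((of_int n)\<^sup>2 * (sqrt 3 / 2 * E) + (of_int m + of_int n / 2)\<^sup>2 / (sqrt 3 / 2 * E))" for n m
    proof -
      define r where "r = sqrt 3 / 2"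
      have r: "pi * (a / 2) = s * r" "r * r = 3 / 4" "r > 0" by (simp_all add: s_def r_def)
      have eq: "s * r * (k * (r * E) + M / (r * E)) = s * (k * (r * r) * E + M / E)" for k M
        using r(3) that by (simp add: field_simps)
      show ?thesis unfolding r_def[symmetric] r(1) eq r(2) by (simp add: Q_def add.commute mult.commute)
    qed
    ultimately have "((\<lambda>(n, m). exp (- (s * Q E (n, m)))) has_sum bcc_sum (2 * (a / 2)) (2 * (sqrt 3 / 2 * E))) UNIV"
      by (simp only:)
    then show ?thesis by (simp add: e_def[abs_def] case_prod_unfold)
  qed
  have has_sum_W: "(W E has_sum 3 * bcc_sum a (sqrt 3 * E)) UNIV" if "E > 0" for E
  proof -
    have rho: "((\<lambda>p. f (\<rho> p)) has_sum c) UNIV" if "(f has_sum c) UNIV" for f :: "int \<times> int \<Rightarrow> real" and c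
      using has_sum_reindex_bij_betw[OF bij, of f c] that by simp
    have "(W E has_sum (bcc_sum a (sqrt 3 * E) + bcc_sum a (sqrt 3 * E) + bcc_sum a (sqrt 3 * E))) UNIV"
      unfolding W_def using has_sum_e[OF that] by (intro has_sum_add rho)
    then show ?thesis by simp
  qed

  define six :: "(int \<times> int) set" where "six = {(0, 1), (0, -1), (1, 0), (-1, 0), (1, -1), (-1, 1)}"
  define L where "L p = (if p \<in> six then exp (- s) * J else 0) -
      3 * \<mu> * exp (- s) / 32 * ?G p" for p
  have L: "(L has_sum (6 * (exp (- s) * J) - 3 * \<mu> * exp (- s) / 32 * (?T))) UNIV"
  proof -
    have "((\<lambda>p. if p \<in> six then exp (- s) * J else 0) has_sum (\<Sum>p\<in>six. exp (- s) * J)) UNIV"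
      by (rule has_sum_finite_neutralI[where B = six]) (auto simp: six_def)
    moreover have "card six = 6" by (simp add: six_def)
    ultimately have "((\<lambda>p. if p \<in> six then exp (- s) * J else 0) has_sum (6 * (exp (- s) * J))) UNIV" by (simp only: sum_constant) simp
    moreover have "(?G
        has_sum (?T)) (UNIV \<times> UNIV :: (int \<times> int) set)"
      by (intro has_sum_mult_Times has_sum_theta3) auto
    ultimately show ?thesis
      unfolding L_def[abs_def] UNIV_Times_UNIV by (intro has_sum_diff has_sum_cmult_right)
  qed

  have low: "L p \<le> W E p - W 1 p" for p
  proof -
    define tail where "tail = 3 * \<mu> * exp (- s) / 32 * ?G p"
    have L_eq: "L p = (if p \<in> six then exp (- s) * J else 0) - tail" by (simp only: L_def tail_def)
    have tail: "tail \<ge> 0" unfolding tail_def using mu by (auto split: prod.splits)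
    have W: "W E p - W 1 p = exp (- (s * N p * (1 + d))) * (?V p) - 3 * exp (- (s * N p))"
      unfolding W_def e_eq e1 by (simp add: N_rho algebra_simps)
    obtain n m where p: "p = (n, m)" by (cases p)
    consider "p = (0, 0)" | "p \<in> six" | "p \<notin> six" "N p \<ge> 3"
    proof -
      have "p = (0, 0) \<or> p \<in> six \<or> (n, m) \<notin> {(0, 0), (0, 1), (0, -1), (1, 0), (-1, 0), (1, -1), (-1, 1)}"
        unfolding p six_def by blast
      moreover have "N p \<ge> 3" if "(n, m) \<notin> {(0, 0), (0, 1), (0, -1), (1, 0), (-1, 0), (1, -1), (-1, 1)}"
        using of_int_le_iff[where 'a = real, THEN iffD2, OF eisenstein_norm_ge_3[OF that]] by (simp add: N_def p)
      ultimately show ?thesis using that by blast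
    qed
    then show ?thesis
    proof cases
      case 1
      have "W E p - W 1 p = 0" unfolding W using 1 by (simp add: N_def X_def \<rho>_def)
      moreover have "p \<notin> six" using 1 by (simp add: six_def)
      ultimately show ?thesis using tail by (simp add: L_eq)
    next
      case 2
      have N: "N p = 1" using 2 by (auto simp: six_def N_def)
      have "?V p = exp (s * S) + 2 * exp (- (s * S / 2))"
        using 2 by (auto simp: six_def X_def \<rho>_def)
      then have "W E p - W 1 p = exp (- s) * (exp (- (s * d)) * (exp (s * S) + 2 * exp (- (s * S / 2))) - 3)"
        unfolding W N by (simp add: algebra_simps flip: exp_add)
      also have "\<dots> = exp (- s) * J"
        by (simp add: J_def algebra_simps flip: exp_add)
      finally show ?thesis using tail 2 by (simp add: L_eq)
    next
      case 3
      have "?V p \<ge> 3"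
      proof -
        have "?V p \<ge>
          (1 + s * X p * S) + (1 + s * X (\<rho> p) * S) + (1 + s * X (\<rho> (\<rho> p)) * S)"
          by (intro add_mono exp_ge_add_one_self)
        moreover have "s * X p * S + s * X (\<rho> p) * S + s * X (\<rho> (\<rho> p)) * S = s * S * (X p + X (\<rho> p) + X (\<rho> (\<rho> p)))"
          by (simp add: algebra_simps)
        ultimately show ?thesis unfolding X_rho by simp
      qed
      then have "W E p - W 1 p \<ge> exp (- (s * N p * (1 + d))) * 3 - 3 * exp (- (s * N p))"
        unfolding W by (intro diff_right_mono mult_left_mono) auto
      moreover have "exp (- (s * N p * (1 + d))) * 3 - 3 * exp (- (s * N p)) = - (3 * exp (- (s * N p)) * (1 - exp (- (s * N p * d))))"
        by (simp add: algebra_simps flip: exp_add)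
      moreover have "1 - exp (- (s * N p * d)) \<le> N p * \<mu>"
      proof (cases "s * d \<le> 1")
        case True
        then show ?thesis using exp_ge_add_one_self[of "- (s * N p * d)"] by (simp add: \<mu>_def mult_ac)
      next
        case False
        have "0 \<le> exp (- (s * N p * d))" by simp
        then have "1 - exp (- (s * N p * d)) \<le> 1" by linarith
        moreover have "N p * \<mu> = N p" using False by (simp add: \<mu>_def)
        ultimately show ?thesis using 3(2) by linarith
      qed
      then have "3 * exp (- (s * N p)) * (1 - exp (- (s * N p * d))) \<le> 3 * exp (- (s * N p)) * (N p * \<mu>)"
        by (intro mult_left_mono) auto
      moreover have "3 * exp (- (s * N p)) * (N p * \<mu>) \<le> tail"
      proof -
        have e35: "exp (- (37 / 10)) \<le> (1 / 32 :: real)"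
        proof -
          have "32 \<le> exp (37 / 10 :: real)"
            using exp_ge_Taylor[of "37/10" 8] by (simp add: eval_nat_numeral lessThan_Suc)
          then show ?thesis using le_imp_inverse_le[of 32 "exp (37 / 10 :: real)"] by (simp add: exp_minus)
        qed
        have "N p * exp (- (s * (N p - 1))) \<le> exp (N p - 1) * exp (- (36 / 10 * (N p - 1)))"
        proof (rule mult_mono)
          have "36 / 10 * (N p - 1) \<le> s * (N p - 1)" using 3 s0 by (intro mult_right_mono) auto
          then show "exp (- (s * (N p - 1))) \<le> exp (- (36 / 10 * (N p - 1)))" by simp
        qed (use exp_ge_add_one_self[of "N p - 1"] in auto)
        also have "\<dots> = exp (- (26 / 10 * (N p - 1)))" by (simp add: field_simps flip: exp_add)
        \<comment> \<open>Equality at N = 3, where both exponents are -5.2. The part N/2 of the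
          exponent is kept to dominate (n^2 + m^2)/4.\<close>
        also have "\<dots> \<le> exp (- (37 / 10) + - (N p / 2))"
          unfolding exp_le_cancel_iff using 3(2) by (simp add: field_simps)
        also have "\<dots> \<le> 1 / 32 * exp (- (N p / 2))" unfolding exp_add using e35 by (intro mult_right_mono) auto
        also have "\<dots> \<le> 1 / 32 * exp (- ((of_int n)\<^sup>2 / 4) + - ((of_int m)\<^sup>2 / 4))"
        proof -
          have "N p / 2 = (real_of_int n)\<^sup>2 / 4 + (real_of_int m)\<^sup>2 / 4 + (real_of_int n + real_of_int m)\<^sup>2 / 4"
            by (simp add: N_def p power2_eq_square field_simps)
          moreover have "(real_of_int n + real_of_int m)\<^sup>2 / 4 \<ge> 0" by simp
          ultimately have "- (N p / 2) \<le> - ((of_int n)\<^sup>2 / 4) + - ((of_int m)\<^sup>2 / 4)" by linarith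
          then show ?thesis by simp
        qed
        finally have *: "N p * exp (- (s * (N p - 1))) \<le> 1 / 32 * exp (- ((of_int n)\<^sup>2 / 4) + - ((of_int m)\<^sup>2 / 4))" .
        have "3 * exp (- (s * N p)) * (N p * \<mu>) = 3 * \<mu> * exp (- s) * (N p * exp (- (s * (N p - 1))))"
          by (simp add: algebra_simps flip: exp_add)
        also have "\<dots> \<le> 3 * \<mu> * exp (- s) * (1 / 32 * exp (- ((of_int n)\<^sup>2 / 4) + - ((of_int m)\<^sup>2 / 4)))"
          using mu by (intro mult_left_mono *) auto
        also have "\<dots> = tail" by (simp add: tail_def p flip: exp_add)
        finally show ?thesis .
      qed
      moreover have "L p = - tail" using 3 by (simp add: L_eq)
      ultimately show ?thesis by linarith
    qed
  qed
  have "((\<lambda>p. W E p - W 1 p) has_sum (3 * bcc_sum a (sqrt 3 * E) - 3 * bcc_sum a (sqrt 3 * 1))) UNIV"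
    by (intro has_sum_diff has_sum_W E zero_less_one)
  from has_sum_mono[OF L this low]
  have "6 * (exp (- s) * J) - 3 * \<mu> * exp (- s) / 32 * (?T) \<le> 3 * (bcc_sum a (sqrt 3 * E) - bcc_sum a (sqrt 3))"
    by simp
  \<comment> \<open>The total is 4 pi times a number close to 1. The bound 64/5 times 3/32 is the
    coefficient 6/5 of the claim.\<close>
  moreover have "?T \<le> 64 / 5"
  proof -
    have "theta3 (4 * pi) = theta3 (1 / (4 * pi)) / sqrt (4 * pi)" by (rule theta3_inverse) simp
    then have "theta3 (1 / (4 * pi)) = sqrt (4 * pi) * theta3 (4 * pi)" by simp
    then have eq: "?T = 4 * pi * (theta3 (4 * pi) * theta3 (4 * pi))"
      by simp
    have "pi * (4 * pi) \<ge> 3 * (4 * 3)" using pi_approx by (intro mult_mono) auto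
    then have x: "exp (- (pi * (4 * pi))) \<le> exp (- 36)" "exp (- (2 * pi * (4 * pi))) \<le> exp (- 36)" by (auto intro: order_trans)
    have "(1000 :: real) \<le> exp 36" using exp_ge_Taylor[of 36 4] by (simp add: eval_nat_numeral lessThan_Suc)
    then have e: "exp (- 36) \<le> (1 / 1000 :: real)" using le_imp_inverse_le[of 1000 "exp (36::real)"] by (simp add: exp_minus)
    have "exp (- (pi * (4 * pi))) / (1 - exp (- (2 * pi * (4 * pi)))) \<le> (1 / 1000) / (1 - 1 / 1000)"
      using order_trans[OF x(1) e] order_trans[OF x(2) e] by (intro frac_le) auto
    also have "(1 / 1000) / (1 - 1 / 1000) = (1 / 999 :: real)" by simp
    finally have "exp (- (pi * (4 * pi))) / (1 - exp (- (2 * pi * (4 * pi)))) \<le> 1 / 999" .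
    moreover have "gauss_sum 0 1 (4 * pi) \<le> exp (- (pi * (4 * pi))) / (1 - exp (- (2 * pi * (4 * pi))))"
      using gauss_sum_0_le[of "4 * pi" 1] by simp
    ultimately have "gauss_sum 0 1 (4 * pi) \<le> 1 / 999" by linarith
    then have "theta3 (4 * pi) \<le> 1003 / 1000"
      unfolding theta3_def by linarith
    then have tt: "theta3 (4 * pi) * theta3 (4 * pi) \<le> 1003 / 1000 * (1003 / 1000)"
      using theta3_gt_1[of "4 * pi"] by (intro mult_mono) auto
    have "4 * pi \<le> 4 * (315 / 100)" using pi_approx by simp
    from mult_mono[OF this tt] have "4 * pi * (theta3 (4 * pi) * theta3 (4 * pi)) \<le> 4 * (315 / 100) * (1003 / 1000 * (1003 / 1000))"
      by simp
    then show ?thesis unfolding eq by simp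
  qed
  then have "3 * \<mu> * exp (- s) / 32 * (?T) \<le> 3 * \<mu> * exp (- s) / 32 * (64 / 5)"
    using mu by (intro mult_left_mono) auto
  moreover have "3 * \<mu> * exp (- s) / 32 * (64 / 5) = exp (- s) * (6 / 5 * \<mu>)" by simp
  moreover have "exp (- s) * (6 * J - 6 / 5 * \<mu>) = 6 * (exp (- s) * J) - exp (- s) * (6 / 5 * \<mu>)"
    by (simp add: algebra_simps)
  ultimately have "exp (- s) * (6 * J - 6 / 5 * \<mu>) \<le> 3 * (bcc_sum a (sqrt 3 * E) - bcc_sum a (sqrt 3))"
    by linarith
  then show ?thesis unfolding \<mu>_def .
qed

text \<open>With q = 1 - 1/E one has S = q + d and d (1 - q) = q^2/2, so x = s q and D = s d turn
  the exponents into x and -(x/2 + 3D/2). The terms linear in x cancel and leave the cost 3D, where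
  D (1 - 5x/18) \<le> 5x^2/36, against a gain of more than x^2/2. For x \<ge> 7/5 the first
  exponential alone suffices.\<close>

lemma first_shell_bound:
  fixes s E :: real
  defines "d \<equiv> (E - 1)\<^sup>2 / (2 * E)" and "S \<equiv> (E - 1 / E) / 2"
  assumes s: "s \<ge> 36 / 10" and E: "E \<ge> 1"
  shows "min 1 (s * d) / 5 \<le> exp (s * (S - d)) + 2 * exp (- (s * (S / 2 + d))) - 3"
proof -
  define q where "q = 1 - 1 / E"
  have q: "0 \<le> q" "q < 1" using E by (auto simp: q_def)
  have d: "d * (1 - q) = q\<^sup>2 / 2" unfolding d_def q_def using E by (simp add: power2_eq_square field_simps)
  have d0: "d \<ge> 0" using E by (simp add: d_def)
  have Sd: "S = q + d"
    unfolding S_def d_def q_def using E by (simp add: power2_eq_square field_simps)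
  define x where "x = s * q"
  have x0: "x \<ge> 0" using s q by (simp add: x_def)
  define D where "D = s * d"
  have D0: "D \<ge> 0" using s d0 by (simp add: D_def)
  have J: "exp (s * (S - d)) + 2 * exp (- (s * (S / 2 + d))) - 3 = exp x + 2 * exp (- (x / 2 + 3 / 2 * D)) - 3"
    by (simp add: Sd x_def D_def field_simps)
  show ?thesis
  proof (cases "x \<ge> 7 / 5")
    case True
    have "4 \<le> exp (7 / 5 :: real)"
      using exp_ge_Taylor[of "7/5" 7] by (simp add: eval_nat_numeral lessThan_Suc)
    also have "\<dots> \<le> exp x" using True by simp
    finally have "exp x \<ge> 4" .
    moreover have "2 * exp (- (x / 2 + 3 / 2 * D)) > 0" by simp
    ultimately have "1 \<le> exp (s * (S - d)) + 2 * exp (- (s * (S / 2 + d))) - 3"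
      unfolding J by linarith
    then show ?thesis by linarith
  next
    case False
    then have x1: "x \<le> 7 / 5" by simp
    have qx: "q \<le> x * 5 / 18" using s q mult_right_mono[of "36/10" s q] by (simp add: x_def)
    have w: "1 - x * 5 / 18 \<ge> 11 / 18" using x1 by simp
    have "D * (1 - q) = x * q / 2"
      using d by (simp add: D_def x_def mult.assoc power2_eq_square)
    also have "\<dots> \<le> x * (x * 5 / 18) / 2" using qx x0 by (intro divide_right_mono mult_left_mono) auto
    finally have "D * (1 - q) \<le> x\<^sup>2 * 5 / 36" by (simp add: power2_eq_square)
    moreover have "D * (1 - x * 5 / 18) \<le> D * (1 - q)" using qx D0 by (intro mult_left_mono) auto
    ultimately have Dw: "D * (1 - x * 5 / 18) \<le> x\<^sup>2 * 5 / 36" by linarith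
    have "D * (11 / 18) \<le> D * (1 - x * 5 / 18)" using w D0 by (intro mult_left_mono) auto
    also note Dw
    also have "x\<^sup>2 * 5 / 36 \<le> x * (7 / 5) * 5 / 36" using mult_left_mono[OF x1 x0] by (simp add: power2_eq_square)
    finally have Dx: "D \<le> x / 3" using x0 by linarith
    define z where "z = x / 2 + 3 / 2 * D"
    have z: "x / 2 \<le> z" "z \<le> x" using D0 Dx by (auto simp: z_def)
    have "(x / 2)\<^sup>2 * (8 / 15) \<le> z\<^sup>2 * (1 - z / 3)"
      using z x0 x1 by (intro mult_mono power_mono) auto
    then have "z\<^sup>2 - z ^ 3 / 3 \<ge> x\<^sup>2 * (2 / 15)"
      by (simp add: power2_eq_square power3_eq_cube algebra_simps)
    moreover have "exp (- z) \<ge> 1 - z + z\<^sup>2 / 2 - z ^ 3 / 6"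
      by (rule exp_minus_ge_cubic)
    moreover have "exp x \<ge> 1 + x + x\<^sup>2 / 2 + x ^ 3 / 6"
      using exp_ge_Taylor[OF x0, of 4] by (simp add: eval_nat_numeral lessThan_Suc power2_eq_square)
    ultimately have "exp x + 2 * exp (- z) - 3 \<ge> x\<^sup>2 / 2 + x ^ 3 / 6 + x\<^sup>2 * (2 / 15) - 3 * D"
      by (simp add: z_def)
    \<comment> \<open>The factor 16/5 is the cost 3 plus the 1/5 that the claim demands. Both sides
      are compared after multiplication by 1 - 5x/18, where \<open>Dw\<close> applies.\<close>
    moreover have "x\<^sup>2 / 2 + x ^ 3 / 6 + x\<^sup>2 * (2 / 15) \<ge> D * (16 / 5)"
    proof -
      have "(x - 0) * (7 / 5 - x) \<ge> 0" using x0 x1 by (intro mult_nonneg_nonneg) auto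
      then have "(19 / 30 + x / 6) * (1 - x * 5 / 18) \<ge> 4 / 9"
        using x0 x1 by (simp add: algebra_simps)
      then have "x\<^sup>2 * ((19 / 30 + x / 6) * (1 - x * 5 / 18)) \<ge> x\<^sup>2 * (4 / 9)"
        by (intro mult_left_mono) auto
      moreover have "x\<^sup>2 * ((19 / 30 + x / 6) * (1 - x * 5 / 18)) = (x\<^sup>2 * (19 / 30 + x / 6)) * (1 - x * 5 / 18)"
        by (simp only: mult.assoc)
      moreover have "(D * (16 / 5)) * (1 - x * 5 / 18) = 16 / 5 * (D * (1 - x * 5 / 18))" by simp
      ultimately have "(D * (16 / 5)) * (1 - x * 5 / 18) \<le> (x\<^sup>2 * (19 / 30 + x / 6)) * (1 - x * 5 / 18)"
        using Dw by linarith
      then have "D * (16 / 5) \<le> x\<^sup>2 * (19 / 30 + x / 6)"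
        by (rule mult_right_le_imp_le) (use w in linarith)
      then show ?thesis by (simp add: power2_eq_square power3_eq_cube algebra_simps)
    qed
    ultimately have "exp x + 2 * exp (- z) - 3 \<ge> D / 5" by linarith
    then show ?thesis unfolding J D_def[symmetric] z_def[symmetric] by linarith
  qed
qed

lemma pi_div_sqrt3_ge:
  assumes "a \<ge> 2" shows "pi * a / sqrt 3 \<ge> 36 / 10"
proof -
  have "sqrt 3 \<le> 174 / 100" by (rule real_le_lsqrt) (auto simp: power2_eq_square)
  then have "36 / 10 * sqrt 3 \<le> 2 * pi" using pi_approx by simp
  also have "\<dots> \<le> pi * a" using assms by simp
  finally show ?thesis by (simp add: pos_le_divide_eq)
qed

lemma bcc_sum_min_sqrt3:
  assumes "a > 0" "y \<ge> sqrt 3"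
  shows "bcc_sum a (sqrt 3) \<le> bcc_sum a y"
proof -
  have *: "bcc_sum a (sqrt 3) \<le> bcc_sum a y" if a: "a \<ge> 2" for a
  proof -
    define E where "E = y / sqrt 3"
    have E: "E \<ge> 1" "y = sqrt 3 * E" using assms by (simp_all add: E_def pos_le_divide_eq)
    define s d S where "s = pi * a / sqrt 3" and "d = (E - 1)\<^sup>2 / (2 * E)" and "S = (E - 1 / E) / 2"
    have "min 1 (s * d) / 5 \<le> exp (s * (S - d)) + 2 * exp (- (s * (S / 2 + d))) - 3"
      unfolding s_def d_def S_def by (rule first_shell_bound[OF pi_div_sqrt3_ge[OF a] E(1)])
    then have "0 \<le> exp (- s) * (6 * (exp (s * (S - d)) + 2 * exp (- (s * (S / 2 + d))) - 3) - 6 / 5 * min 1 (s * d))"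
      by (intro mult_nonneg_nonneg) auto
    also have "\<dots> \<le> 3 * (bcc_sum a (sqrt 3 * E) - bcc_sum a (sqrt 3))"
      unfolding s_def d_def S_def using E(1) by (intro bcc_sum_compare[OF a]) auto
    finally have "0 \<le> 3 * (bcc_sum a (sqrt 3 * E) - bcc_sum a (sqrt 3))" .
    then show ?thesis by (simp add: E(2))
  qed
  have y: "y > 0" using assms by (metis less_le_trans real_sqrt_gt_zero zero_less_numeral)
  show ?thesis
  proof (cases "a \<ge> 2")
    case False
    then have "4 / a \<ge> 2" using assms by (simp add: field_simps)
    then show ?thesis
      using *[of "4 / a"] assms y by (simp add: bcc_sum_dual[of a] divide_right_mono)
  qed (rule *)
qed

text \<open>The square lattice is the deformation E = 1/\<open>sqrt 3\<close>, outside the range of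
  \<open>first_shell_bound\<close>. There S/2 + d is negative, and the doubled exponential alone
  exceeds 3 + 1/5, which beats the largest possible loss in \<open>bcc_sum_compare\<close>.\<close>

lemma bcc_sum_sqrt3_less:
  assumes "a > 0"
  shows "bcc_sum a (sqrt 3) < bcc_sum a 1"
proof -
  have *: "bcc_sum a (sqrt 3) < bcc_sum a 1" if a: "a \<ge> 2" for a
  proof -
    define s E d S where "s = pi * a / sqrt 3" and "E = 1 / sqrt 3" and "d = (E - 1)\<^sup>2 / (2 * E)" and "S = (E - 1 / E) / 2"
    have s: "s \<ge> 36 / 10" unfolding s_def by (rule pi_div_sqrt3_ge[OF a])
    have E: "E > 0" by (simp add: E_def)
    have r3: "sqrt 3 * sqrt 3 = 3" by simp
    have "S / 2 + d = sqrt 3 / 2 - 1"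
      unfolding S_def d_def E_def by (simp add: field_simps power2_eq_square r3)
    moreover have "sqrt 3 \<le> 17321 / 10000" by (rule real_le_lsqrt) (auto simp: power2_eq_square)
    ultimately have "S / 2 + d \<le> - (1339 / 10000)" by simp
    then have "36 / 10 * (1339 / 10000) \<le> s * (- (S / 2 + d))"
      using s by (intro mult_mono) auto
    then have "exp (48204 / 100000) \<le> exp (- (s * (S / 2 + d)))"
      unfolding mult_minus_right exp_le_cancel_iff by simp
    moreover have "(16 / 10 :: real) < exp (48204 / 100000)"
      by (rule less_le_trans[OF _ exp_ge_Taylor[of _ 5]]) (simp_all add: eval_nat_numeral lessThan_Suc)
    ultimately have "exp (s * (S - d)) + 2 * exp (- (s * (S / 2 + d))) - 3 > 1 / 5"
      using exp_gt_zero[of "s * (S - d)"] by linarith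
    then have "exp (- s) * (6 * (exp (s * (S - d)) + 2 * exp (- (s * (S / 2 + d))) - 3) - 6 / 5 * min 1 (s * d)) > 0"
      by (intro mult_pos_pos) auto
    then have "0 < 3 * (bcc_sum a (sqrt 3 * E) - bcc_sum a (sqrt 3))"
      using bcc_sum_compare[OF a E] unfolding s_def d_def S_def by (rule less_le_trans)
    then show ?thesis by (simp add: E_def)
  qed
  show ?thesis
  proof (cases "a \<ge> 2")
    case False
    then have "4 / a \<ge> 2" using assms by (simp add: field_simps)
    then show ?thesis
      using *[of "4 / a"] assms by (simp add: bcc_sum_dual[of a] divide_strict_right_mono)
  qed (rule *)
qed

section \<open>Theta functions of box lattices and dilations\<close>

lemma norm_vec3_squared: "(norm p)\<^sup>2 = (p $ 1)\<^sup>2 + (p $ 2)\<^sup>2 + (p $ 3)\<^sup>2" for p :: "real^3"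
  unfolding power2_norm_eq_inner inner_vec_def sum_3 by (simp add: power2_eq_square)

definition lattice_box :: "real^3 \<Rightarrow> real^3 \<Rightarrow> (real^3) set" where
  "lattice_box a u = range (\<lambda>(l, m, n). vector [a $ 1 * (of_int l + u $ 1), a $ 2 * (of_int m + u $ 2), a $ 3 * (of_int n + u $ 3)])"

lemma mem_lattice_box_iff:
  "p \<in> lattice_box a u \<longleftrightarrow> (\<exists>l m n :: int. p $ 1 = a $ 1 * (of_int l + u $ 1) \<and> p $ 2 = a $ 2 * (of_int m + u $ 2) \<and>
    p $ 3 = a $ 3 * (of_int n + u $ 3))"
  by (auto simp: lattice_box_def image_iff vec_eq_iff forall_3)

lemma has_sum_lattice_box:
  fixes \<alpha> :: real
  assumes "\<And>i. a $ i \<noteq> 0"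
    and "\<And>i. ((\<lambda>n::int. exp (- (pi * (\<alpha> * (a $ i)\<^sup>2) * (of_int n + u $ i)\<^sup>2))) has_sum A i) UNIV"
  shows "((\<lambda>p. exp (- pi * \<alpha> * (norm p)\<^sup>2)) has_sum (A 1 * A 2 * A 3)) (lattice_box a u)"
  unfolding lattice_box_def
proof (subst has_sum_reindex)
  show "inj (\<lambda>(l, m, n). vector [a $ 1 * (real_of_int l + u $ 1), a $ 2 * (real_of_int m + u $ 2), a $ 3 * (real_of_int n + u $ 3)] :: real^3)"
    using assms(1) by (auto simp: inj_on_def vec_eq_iff forall_3)
  define g where "g i n = exp (- (pi * (\<alpha> * (a $ i)\<^sup>2) * (real_of_int n + u $ i)\<^sup>2))" for i n
  have g: "(g i has_sum A i) UNIV" for i using assms(2)[of i] by (simp add: g_def[abs_def])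
  have "((\<lambda>(m, n). g 2 m * g 3 n) has_sum (A 2 * A 3)) (UNIV \<times> UNIV)"
    by (intro has_sum_mult_Times g) (auto simp: g_def)
  then have "((\<lambda>(l, mn). g 1 l * (case mn of (m, n) \<Rightarrow> g 2 m * g 3 n)) has_sum (A 1 * (A 2 * A 3))) (UNIV \<times> (UNIV \<times> UNIV))"
    by (intro has_sum_mult_Times g) (auto simp: g_def)
  moreover have "exp (- pi * \<alpha> * (norm (vector [a $ 1 * (real_of_int l + u $ 1), a $ 2 * (real_of_int m + u $ 2), a $ 3 * (real_of_int n + u $ 3)] :: real^3))\<^sup>2) =
      g 1 l * (g 2 m * g 3 n)" for l m n
    by (simp only: norm_vec3_squared vector_3 power_mult_distrib g_def exp_add[symmetric]) (simp add: algebra_simps)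
  then have "(\<lambda>p. exp (- pi * \<alpha> * (norm p)\<^sup>2)) \<circ>
      (\<lambda>(l, m, n). vector [a $ 1 * (real_of_int l + u $ 1), a $ 2 * (real_of_int m + u $ 2), a $ 3 * (real_of_int n + u $ 3)] :: real^3) =
      (\<lambda>(l, mn). g 1 l * (case mn of (m, n) \<Rightarrow> g 2 m * g 3 n))"
    by (intro ext) (simp add: o_def split: prod.split)
  ultimately show "((\<lambda>p. exp (- pi * \<alpha> * (norm p)\<^sup>2)) \<circ>
      (\<lambda>(l, m, n). vector [a $ 1 * (real_of_int l + u $ 1), a $ 2 * (real_of_int m + u $ 2), a $ 3 * (real_of_int n + u $ 3)] :: real^3) has_sum
      A 1 * A 2 * A 3) UNIV"
    by (simp only: UNIV_Times_UNIV mult.assoc)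
qed

lemma has_sum_lattice_box_theta:
  fixes \<alpha> :: real
  assumes "\<alpha> > 0" "\<And>i. a $ i \<noteq> 0" "\<And>i. u $ i = 0 \<or> u $ i = 1 / 2"
  defines "A \<equiv> \<lambda>i. (if u $ i = 0 then theta3 else theta2) (\<alpha> * (a $ i)\<^sup>2)"
  shows "((\<lambda>p. exp (- pi * \<alpha> * (norm p)\<^sup>2)) has_sum (A 1 * A 2 * A 3)) (lattice_box a u)"
proof (rule has_sum_lattice_box[OF assms(2)])
  fix i
  have "\<alpha> * (a $ i)\<^sup>2 > 0" using assms(1,2) by simp
  then show "((\<lambda>n::int. exp (- (pi * (\<alpha> * (a $ i)\<^sup>2) * (of_int n + u $ i)\<^sup>2))) has_sum A i) UNIV"
  proof (cases "u $ i = 0")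
    case True
    then show ?thesis using has_sum_theta3[of "\<alpha> * (a $ i)\<^sup>2"] \<open>\<alpha> * (a $ i)\<^sup>2 > 0\<close> by (simp add: A_def)
  next
    case False
    then have "u $ i = 1 / 2" using assms(3) by metis
    moreover have "A i = theta2 (\<alpha> * (a $ i)\<^sup>2)" using False by (simp add: A_def)
    ultimately show ?thesis
      using has_sum_theta2[OF \<open>\<alpha> * (a $ i)\<^sup>2 > 0\<close>] by (simp only:)
  qed
qed

lemma lattice_box_disjoint:
  assumes "a $ i \<noteq> 0" "u $ i = 0" "v $ i = 1 / 2"
  shows "lattice_box a u \<inter> lattice_box a v = {}"
proof -
  have *: "real_of_int k \<noteq> of_int l + 1 / 2" for k l
  proof
    assume "real_of_int k = of_int l + 1 / 2"
    then have "real_of_int (2 * k) = real_of_int (2 * l + 1)" by simp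
    then have "2 * k = 2 * l + 1" by (simp only: of_int_eq_iff)
    then show False by presburger
  qed
  have "\<exists>k :: int. p $ i = a $ i * (of_int k + w $ i)" if "p \<in> lattice_box a w" for p w
    using that exhaust_3[of i] unfolding mem_lattice_box_iff by (elim disjE) auto
  from this[of _ u] this[of _ v] assms show ?thesis
    using * by fastforce
qed

text \<open>The layers with even \<open>k\<close> form a rectangular lattice, those with odd
  \<open>k\<close> its translate by half the cell diagonal, and a Gaussian sum over a rectangular
  lattice factorizes along the axes.\<close>

lemma lattice_theta_bco:
  assumes "y > 0" "t > 0" "\<alpha> > 0"
  shows "lattice_theta (bco y t) \<alpha> =
    theta3 (\<alpha> * t\<^sup>2) * (theta3 (\<alpha> * y) * theta3 (\<alpha> / y)) + theta2 (\<alpha> * t\<^sup>2) * (theta2 (\<alpha> * y) * theta2 (\<alpha> / y))"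
proof -
  let ?w = "\<lambda>p. exp (- pi * \<alpha> * (norm p)\<^sup>2)"
  define a :: "real^3" where "a = vector [sqrt y, 1 / sqrt y, t]"
  define h :: "real^3" where "h = vector [1/2, 1/2, 1/2]"
  have a: "a $ i \<noteq> 0" for i using assms exhaust_3[of i] by (auto simp: a_def)
  have h: "h $ i = 1 / 2" for i using exhaust_3[of i] by (auto simp: h_def)
  have "(?w has_sum (theta3 (\<alpha> * y) * theta3 (\<alpha> / y) * theta3 (\<alpha> * t\<^sup>2))) (lattice_box a 0)"
    using has_sum_lattice_box_theta[OF assms(3), of a 0] a assms by (simp add: a_def power_divide)
  moreover have "(?w has_sum (theta2 (\<alpha> * y) * theta2 (\<alpha> / y) * theta2 (\<alpha> * t\<^sup>2))) (lattice_box a h)"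
    using has_sum_lattice_box_theta[OF assms(3), of a h] a h assms by (simp add: a_def power_divide)
  moreover have "lattice_box a 0 \<inter> lattice_box a h = {}"
    using a h by (intro lattice_box_disjoint[of a 1]) auto
  ultimately have "(?w has_sum
      (theta3 (\<alpha> * y) * theta3 (\<alpha> / y) * theta3 (\<alpha> * t\<^sup>2) + theta2 (\<alpha> * y) * theta2 (\<alpha> / y) * theta2 (\<alpha> * t\<^sup>2))) (lattice_box a 0 \<union> lattice_box a h)"
    by (rule has_sum_Un_disjoint)
  moreover have "lattice_box a 0 \<union> lattice_box a h = bco y t"
  proof (intro set_eqI iffI)
    fix p assume "p \<in> lattice_box a 0 \<union> lattice_box a h"
    then consider l m n :: int where "p $ 1 = sqrt y * l" "p $ 2 = m / sqrt y" "p $ 3 = t * n"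
      | l m n :: int where "p $ 1 = sqrt y * (l + 1/2)" "p $ 2 = (m + 1/2) / sqrt y" "p $ 3 = t * (n + 1/2)"
    proof -
      have "(\<exists>l m n :: int. p $ 1 = sqrt y * of_int l \<and> p $ 2 = of_int m / sqrt y \<and> p $ 3 = t * of_int n) \<or>
        (\<exists>l m n :: int. p $ 1 = sqrt y * (of_int l + 1/2) \<and> p $ 2 = (of_int m + 1/2) / sqrt y \<and> p $ 3 = t * (of_int n + 1/2))"
        using \<open>p \<in> lattice_box a 0 \<union> lattice_box a h\<close> unfolding Un_iff mem_lattice_box_iff by (simp add: a_def h)
      then show ?thesis using that by blast
    qed
    then show "p \<in> bco y t"
    proof cases
      case 1
      then show ?thesis unfolding mem_bco_iff
        by (intro exI[of _ "2 * n"] exI[of _ l] exI[of _ m]) simp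
    next
      case 2
      then show ?thesis unfolding mem_bco_iff
        by (intro exI[of _ "2 * n + 1"] exI[of _ l] exI[of _ m]) (simp add: field_simps)
    qed
  next
    fix p assume "p \<in> bco y t"
    then obtain k m n :: int where p: "p $ 1 = sqrt y * (m + (if odd k then 1/2 else 0))"
      "p $ 2 = (n + (if odd k then 1/2 else 0)) / sqrt y" "p $ 3 = t * k / 2"
      unfolding mem_bco_iff by blast
    show "p \<in> lattice_box a 0 \<union> lattice_box a h"
    proof (cases "even k")
      case True
      then obtain j where "k = 2 * j" by blast
      then have "p \<in> lattice_box a 0" unfolding mem_lattice_box_iff
        using p by (intro exI[of _ m] exI[of _ n] exI[of _ j]) (simp add: a_def)
      then show ?thesis by blast
    next
      case False
      then obtain j where "k = 2 * j + 1" by (auto elim: oddE)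
      then have "p \<in> lattice_box a h" unfolding mem_lattice_box_iff
        using p by (intro exI[of _ m] exI[of _ n] exI[of _ j]) (simp add: a_def h field_simps)
      then show ?thesis by blast
    qed
  qed
  ultimately show ?thesis
    unfolding lattice_theta_def by (simp add: infsumI algebra_simps)
qed

section \<open>Volume preserving deformations of the cubic lattices and the duality of BCC and
  FCC\<close>

lemma lattice_theta_scaleR:
  assumes "c \<noteq> 0"
  shows "lattice_theta ((*\<^sub>R) c ` \<Lambda>) \<alpha> = lattice_theta \<Lambda> (c\<^sup>2 * \<alpha>)"
  unfolding lattice_theta_def using assms
  by (subst infsum_reindex) (auto simp: inj_on_def o_def power_mult_distrib mult_ac)

definition dilation_factors :: "real \<Rightarrow> real^3" where
  "dilation_factors y = vector [sqrt y, 1 / sqrt y, 1]"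

definition dilate :: "real \<Rightarrow> real^3 \<Rightarrow> real^3" where
  "dilate y p = (\<chi> i. dilation_factors y $ i * p $ i)"

lemma dilate_lattice_of:
  "dilate y ` lattice_of B = lattice_of (\<chi> i j. dilation_factors y $ i * B $ i $ j)"
  unfolding lattice_of_def image_image dilate_def
  by (intro image_cong refl) (simp add: vec_eq_iff matrix_vector_mult_def sum_distrib_left mult.assoc)

text \<open>Local minimality is tested along one curve. The deformed bases \<open>M y\<close> depend
  continuously on \<open>y\<close> and keep their determinant, and an open set of lattices is by
  definition an open set of bases.\<close>

lemma local_minimizer_imp_eventually_dilate:
  assumes "local_minimizer unit_density_lattices F \<Lambda>"
  shows "\<forall>\<^sub>F y in at_right 1. F \<Lambda> \<le> F (dilate y ` \<Lambda>)"
proof -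
  obtain U where U: "openin unit_density_lattices U" "\<Lambda> \<in> U" "\<forall>\<Lambda>'\<in>U. F \<Lambda> \<le> F \<Lambda>'"
    and "\<Lambda> \<in> topspace unit_density_lattices"
    using assms by (auto simp: local_minimizer_def)
  then obtain B where B: "\<bar>det B\<bar> = 1" "\<Lambda> = lattice_of B"
    unfolding topspace_unit_density_lattices unit_density_def by auto
  obtain W where W: "openin lattice_topology W" "U = W \<inter> Collect unit_density"
    using U(1) by (auto simp: openin_subtopology)
  define M where "M y = (\<chi> i j. dilation_factors y $ i * B $ i $ j)" for y
  have det: "det (M y) = det B" if "y > 0" for y
    using that unfolding det_3 M_def dilation_factors_def by (simp add: field_simps)
  have M1: "M 1 = B"
    by (simp add: M_def dilation_factors_def vec_eq_iff forall_3)
  have "(M \<longlongrightarrow> M 1) (at_right 1)"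
  proof (intro vec_tendstoI)
    fix i j
    have "\<forall>i. ((\<lambda>y. dilation_factors y $ i) \<longlongrightarrow> dilation_factors 1 $ i) (at_right 1)"
      unfolding forall_3 dilation_factors_def vector_3 by (auto intro!: tendsto_eq_intros)
    then show "((\<lambda>y. M y $ i $ j) \<longlongrightarrow> M 1 $ i $ j) (at_right 1)"
      unfolding M_def by (simp add: tendsto_mult)
  qed
  moreover have "open {B. invertible B \<and> lattice_of B \<in> W}" "B \<in> {B. invertible B \<and> lattice_of B \<in> W}"
    using W U(2) B by (auto simp: openin_lattice_topology invertible_det_nz)
  ultimately have "\<forall>\<^sub>F y in at_right 1. M y \<in> {B. invertible B \<and> lattice_of B \<in> W}"
    unfolding M1 by (rule topological_tendstoD)
  moreover have "\<forall>\<^sub>F y::real in at_right 1. y > 1"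
    by (simp add: eventually_at_right_less)
  ultimately show ?thesis
  proof eventually_elim
    case (elim y)
    have "dilate y ` \<Lambda> = lattice_of (M y)" unfolding B(2) M_def by (rule dilate_lattice_of)
    moreover have "unit_density (lattice_of (M y))"
      unfolding unit_density_def using det[of y] B(1) elim by (intro exI[of _ "M y"]) auto
    ultimately have "dilate y ` \<Lambda> \<in> U" using elim W(2) by auto
    then show ?case using U(3) by blast
  qed
qed

lemma lattice_theta_dilate_bcc_unit:
  "lattice_theta (dilate y ` bcc_unit) \<alpha> = lattice_theta (bco y 1) ((root 3 2)\<^sup>2 * \<alpha>)"
proof -
  have "dilate y ` bcc_unit = (*\<^sub>R) (root 3 2) ` bco y 1"
    unfolding bcc_unit_def bco_eq_dilation_bcc image_image
    by (intro image_cong refl) (simp add: dilate_def dilation_factors_def vec_eq_iff forall_3)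
  then show ?thesis by (simp add: lattice_theta_scaleR)
qed

lemma dilate_fcc_unit_boxes:
  fixes y :: real
  defines "a \<equiv> root 3 4 *\<^sub>R dilation_factors y"
  shows "dilate y ` fcc_unit = lattice_box a (vector [0, 0, 0]) \<union> lattice_box a (vector [1/2, 1/2, 0]) \<union>
     lattice_box a (vector [1/2, 0, 1/2]) \<union> lattice_box a (vector [0, 1/2, 1/2])"
proof -
  have "(\<lambda>p. dilate y (root 3 4 *\<^sub>R p)) ` (+) (vector [u, v, w]) ` cubic_lattice = lattice_box a (vector [u, v, w])" for u v w
  proof (intro set_eqI iffI)
    fix p assume "p \<in> (\<lambda>p. dilate y (root 3 4 *\<^sub>R p)) ` (+) (vector [u, v, w]) ` cubic_lattice"
    then obtain q where q: "q \<in> (+) (vector [u, v, w]) ` cubic_lattice" "p = dilate y (root 3 4 *\<^sub>R q)"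
      by blast
    then show "p \<in> lattice_box a (vector [u, v, w])"
      unfolding mem_cubic_translate_iff mem_lattice_box_iff by (auto simp: dilate_def a_def mult_ac add.commute)
  next
    fix p assume "p \<in> lattice_box a (vector [u, v, w])"
    then obtain l m n :: int where p: "p $ 1 = a $ 1 * (l + u)" "p $ 2 = a $ 2 * (m + v)" "p $ 3 = a $ 3 * (n + w)"
      unfolding mem_lattice_box_iff by auto
    define q :: "real^3" where "q = vector [u + l, v + m, w + n]"
    have "q \<in> (+) (vector [u, v, w]) ` cubic_lattice"
      unfolding mem_cubic_translate_iff q_def by auto
    moreover have "p = dilate y (root 3 4 *\<^sub>R q)"
      using p by (simp add: vec_eq_iff forall_3 dilate_def a_def q_def mult_ac add.commute)
    ultimately show "p \<in> (\<lambda>p. dilate y (root 3 4 *\<^sub>R p)) ` (+) (vector [u, v, w]) ` cubic_lattice"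
      by blast
  qed
  then show ?thesis
    unfolding fcc_unit_def fcc_def image_image by (simp add: image_UN image_Un image_image Un_assoc)
qed

text \<open>The four cosets of FCC give the products with an even number of \<open>theta2\<close>
  factors; twice their sum is the product of the three sums \<open>theta3 + theta2\<close> plus the
  product of the three differences. Inverting each factor leaves the pure \<open>theta3\<close> and
  the pure \<open>theta2\<close> product, which is the dual lattice BCC.\<close>

lemma lattice_theta_dilate_fcc_unit:
  fixes y \<alpha> :: real
  assumes y: "y > 0" and \<alpha>: "\<alpha> > 0"
  defines "\<beta> \<equiv> 4 / ((root 3 4)\<^sup>2 * \<alpha>)"
  shows "lattice_theta (dilate y ` fcc_unit) \<alpha> = \<beta> * sqrt \<beta> / 2 * lattice_theta (bco y 1) \<beta>"
proof -
  define r where "r = root 3 4"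
  have r: "r > 0" by (simp add: r_def)
  define a where "a = r *\<^sub>R dilation_factors y"
  have a: "a $ i \<noteq> 0" for i using y r exhaust_3[of i] by (auto simp: a_def dilation_factors_def)
  define s1 s2 s3 where "s1 = \<alpha> * r\<^sup>2 * y" and "s2 = \<alpha> * r\<^sup>2 / y" and "s3 = \<alpha> * r\<^sup>2"
  have s: "s1 > 0" "s2 > 0" "s3 > 0" using y \<alpha> r by (auto simp: s1_def s2_def s3_def)
  have as: "\<alpha> * (a $ 1)\<^sup>2 = s1" "\<alpha> * (a $ 2)\<^sup>2 = s2" "\<alpha> * (a $ 3)\<^sup>2 = s3"
    using y by (simp_all add: a_def dilation_factors_def s1_def s2_def s3_def power_mult_distrib power_divide)
  define \<Phi> where "\<Phi> = (\<lambda>p :: real^3. exp (- pi * \<alpha> * (norm p)\<^sup>2))"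
  have u: "(vector [u, v, w] :: real^3) $ i = 0 \<or> (vector [u, v, w] :: real^3) $ i = 1 / 2"
    if "u = 0 \<or> u = 1/2" "v = 0 \<or> v = 1/2" "w = 0 \<or> w = 1/2" for u v w :: real and i
    using that exhaust_3[of i] by auto
  have 1: "(\<Phi> has_sum (theta3 s1 * theta3 s2 * theta3 s3)) (lattice_box a (vector [0, 0, 0]))"
    unfolding \<Phi>_def using has_sum_lattice_box_theta[OF \<alpha> a u[of "0" "0" "0"]] by (simp add: as)
  have 2: "(\<Phi> has_sum (theta2 s1 * theta2 s2 * theta3 s3)) (lattice_box a (vector [1/2, 1/2, 0]))"
    unfolding \<Phi>_def using has_sum_lattice_box_theta[OF \<alpha> a u[of "1/2" "1/2" "0"]] by (simp add: as)
  have 3: "(\<Phi> has_sum (theta2 s1 * theta3 s2 * theta2 s3)) (lattice_box a (vector [1/2, 0, 1/2]))"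
    unfolding \<Phi>_def using has_sum_lattice_box_theta[OF \<alpha> a u[of "1/2" "0" "1/2"]] by (simp add: as)
  have 4: "(\<Phi> has_sum (theta3 s1 * theta2 s2 * theta2 s3)) (lattice_box a (vector [0, 1/2, 1/2]))"
    unfolding \<Phi>_def using has_sum_lattice_box_theta[OF \<alpha> a u[of "0" "1/2" "1/2"]] by (simp add: as)
  have "(\<Phi> has_sum (theta3 s1 * theta3 s2 * theta3 s3 + theta2 s1 * theta2 s2 * theta3 s3 +
      theta2 s1 * theta3 s2 * theta2 s3 + theta3 s1 * theta2 s2 * theta2 s3)) (dilate y ` fcc_unit)"
    unfolding dilate_fcc_unit_boxes r_def[symmetric] a_def[symmetric]
  proof (intro has_sum_Un_disjoint 1 2 3 4)
    have d: "lattice_box a (vector [0, 0, 0]) \<inter> lattice_box a (vector [1/2, 1/2, 0]) = {}"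
      "lattice_box a (vector [0, 0, 0]) \<inter> lattice_box a (vector [1/2, 0, 1/2]) = {}"
      "lattice_box a (vector [0, 1/2, 1/2]) \<inter> lattice_box a (vector [1/2, 1/2, 0]) = {}"
      "lattice_box a (vector [0, 1/2, 1/2]) \<inter> lattice_box a (vector [1/2, 0, 1/2]) = {}"
      by (rule lattice_box_disjoint[of a 1]; simp add: a)+
    have d': "lattice_box a (vector [0, 0, 0]) \<inter> lattice_box a (vector [0, 1/2, 1/2]) = {}"
      "lattice_box a (vector [1/2, 0, 1/2]) \<inter> lattice_box a (vector [1/2, 1/2, 0]) = {}"
      by (rule lattice_box_disjoint[of a 2]; simp add: a)+
    show "lattice_box a (vector [0, 0, 0]) \<inter> lattice_box a (vector [1/2, 1/2, 0]) = {}" by (rule d)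
    show "(lattice_box a (vector [0, 0, 0]) \<union> lattice_box a (vector [1/2, 1/2, 0])) \<inter> lattice_box a (vector [1/2, 0, 1/2]) = {}"
      using d d' by blast
    show "(lattice_box a (vector [0, 0, 0]) \<union> lattice_box a (vector [1/2, 1/2, 0]) \<union> lattice_box a (vector [1/2, 0, 1/2])) \<inter> lattice_box a (vector [0, 1/2, 1/2]) = {}"
      using d d' by blast
  qed
  then have eq: "lattice_theta (dilate y ` fcc_unit) \<alpha> = theta3 s1 * theta3 s2 * theta3 s3 + theta2 s1 * theta2 s2 * theta3 s3 +
      theta2 s1 * theta3 s2 * theta2 s3 + theta3 s1 * theta2 s2 * theta2 s3"
    unfolding lattice_theta_def \<Phi>_def by (rule infsumI)
  have "2 * lattice_theta (dilate y ` fcc_unit) \<alpha> =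
      (theta3 s1 + theta2 s1) * (theta3 s2 + theta2 s2) * (theta3 s3 + theta2 s3) +
      (theta3 s1 - theta2 s1) * (theta3 s2 - theta2 s2) * (theta3 s3 - theta2 s3)"
    unfolding eq by (simp add: algebra_simps)
  also have "\<dots> = 8 / (sqrt s1 * sqrt s2 * sqrt s3) *
      (theta3 (4 / s1) * theta3 (4 / s2) * theta3 (4 / s3) + theta2 (4 / s1) * theta2 (4 / s2) * theta2 (4 / s3))"
    unfolding theta3_add_theta2[OF s(1)] theta3_add_theta2[OF s(2)] theta3_add_theta2[OF s(3)]
      theta3_diff_theta2[OF s(1)] theta3_diff_theta2[OF s(2)] theta3_diff_theta2[OF s(3)]
    by (simp add: algebra_simps)
  also have "4 / s1 = \<beta> / y" by (simp add: s1_def \<beta>_def r_def mult_ac)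
  also have "4 / s2 = \<beta> * y" by (simp add: s2_def \<beta>_def r_def mult_ac)
  also have "4 / s3 = \<beta>" by (simp add: s3_def \<beta>_def r_def mult_ac)
  finally have fin: "2 * lattice_theta (dilate y ` fcc_unit) \<alpha> = 8 / (sqrt s1 * sqrt s2 * sqrt s3) *
      (theta3 (\<beta> / y) * theta3 (\<beta> * y) * theta3 \<beta> + theta2 (\<beta> / y) * theta2 (\<beta> * y) * theta2 \<beta>)" .
  have \<beta>: "\<beta> > 0" using \<alpha> r by (simp add: \<beta>_def r_def)
  have "s1 * s2 = s3\<^sup>2" using y by (simp add: s1_def s2_def s3_def power2_eq_square)
  then have "sqrt s1 * sqrt s2 = s3" using s(3) by (simp add: real_sqrt_mult[symmetric])
  moreover have "s3 = 4 / \<beta>" using \<alpha> r by (simp add: s3_def \<beta>_def r_def)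
  ultimately have "8 / (sqrt s1 * sqrt s2 * sqrt s3) = \<beta> * sqrt \<beta>"
    using \<beta> by (simp add: real_sqrt_divide)
  then show ?thesis
    using fin lattice_theta_bco[OF y zero_less_one \<beta>] by (simp add: mult_ac)
qed

section \<open>Existence and location of the minimizers in y\<close>

lemma lattice_theta_bco_eq_bcc_sum:
  assumes "y > 0" "t > 0" "\<alpha> > 0"
  shows "lattice_theta (bco y t) \<alpha> =
    (theta3 (\<alpha> * t\<^sup>2) - theta2 (\<alpha> * t\<^sup>2)) * (theta3 (\<alpha> * y) * theta3 (\<alpha> / y)) + theta2 (\<alpha> * t\<^sup>2) * bcc_sum \<alpha> y"
  unfolding lattice_theta_bco[OF assms] bcc_sum_def by (simp add: algebra_simps)

text \<open>Both coefficients in \<open>lattice_theta_bco_eq_bcc_sum\<close> are positive.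
  Strictness comes from the \<open>theta3\<close> product, so weak minimality of the triangular
  lattice is enough.\<close>

lemma lattice_theta_bco_sqrt3_less:
  assumes "t > 0" "\<alpha> > 0" "y > sqrt 3"
  shows "lattice_theta (bco (sqrt 3) t) \<alpha> < lattice_theta (bco y t) \<alpha>"
proof -
  have s: "\<alpha> * t\<^sup>2 > 0" using assms by simp
  have y: "y > 0" using assms(3) real_sqrt_gt_zero[of 3] by linarith
  have "theta3 (\<alpha> * sqrt 3) * theta3 (\<alpha> / sqrt 3) < theta3 (\<alpha> * y) * theta3 (\<alpha> / y)"
    using assms by (intro theta3_prod_strict_mono) auto
  then have "(theta3 (\<alpha> * t\<^sup>2) - theta2 (\<alpha> * t\<^sup>2)) * (theta3 (\<alpha> * sqrt 3) * theta3 (\<alpha> / sqrt 3)) <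
      (theta3 (\<alpha> * t\<^sup>2) - theta2 (\<alpha> * t\<^sup>2)) * (theta3 (\<alpha> * y) * theta3 (\<alpha> / y))"
    using theta2_less_theta3[OF s] by (intro mult_strict_left_mono) auto
  moreover have "theta2 (\<alpha> * t\<^sup>2) * bcc_sum \<alpha> (sqrt 3) \<le> theta2 (\<alpha> * t\<^sup>2) * bcc_sum \<alpha> y"
    using assms theta2_pos[OF s] by (intro mult_left_mono bcc_sum_min_sqrt3) auto
  ultimately show ?thesis
    using y assms by (simp add: lattice_theta_bco_eq_bcc_sum)
qed

lemma continuous_on_lattice_theta_bco:
  assumes "t > 0" "\<alpha> > 0"
  shows "continuous_on {0<..} (\<lambda>y. lattice_theta (bco y t) \<alpha>)"
proof -
  have c: "continuous_on {0<..} theta3" "continuous_on {0<..} theta2"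
    by (auto intro!: continuous_at_imp_continuous_on DERIV_isCont[OF DERIV_theta3] DERIV_isCont[OF DERIV_theta2])
  have "continuous_on {0<..} (\<lambda>y. theta3 (\<alpha> * t\<^sup>2) * (theta3 (\<alpha> * y) * theta3 (\<alpha> / y)) +
      theta2 (\<alpha> * t\<^sup>2) * (theta2 (\<alpha> * y) * theta2 (\<alpha> / y)))"
    using assms by (intro continuous_intros continuous_on_compose2[OF c(1)] continuous_on_compose2[OF c(2)]) auto
  then show ?thesis
    by (rule continuous_on_cong[THEN iffD1, rotated -1]) (use assms in \<open>auto simp: lattice_theta_bco\<close>)
qed

lemma bco_minimizer_exists:
  assumes "t > 0" "\<alpha> > 0"
  shows "\<exists>y. is_arg_min (\<lambda>y. lattice_theta (bco y t) \<alpha>) (\<lambda>y. 1 \<le> y) y"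
proof -
  define F where "F y = lattice_theta (bco y t) \<alpha>" for y
  have s3: "1 \<le> sqrt 3" by simp
  have "continuous_on {1..sqrt 3} F"
    unfolding F_def by (rule continuous_on_subset[OF continuous_on_lattice_theta_bco[OF assms]]) auto
  then obtain y where y: "y \<in> {1..sqrt 3}" "\<forall>z\<in>{1..sqrt 3}. F y \<le> F z"
    using continuous_attains_inf[of "{1..sqrt 3}" F] s3 by auto
  have "F y \<le> F z" if "z \<ge> 1" for z
  proof (cases "z \<le> sqrt 3")
    case False
    then have "F (sqrt 3) < F z" unfolding F_def using assms by (intro lattice_theta_bco_sqrt3_less) auto
    then show ?thesis using y(2)[rule_format, of "sqrt 3"] s3 by simp
  qed (use y that in auto)
  then show ?thesis
    unfolding is_arg_min_def F_def[symmetric] using y by (intro exI[of _ y]) (auto simp: not_less)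
qed

lemma bco_minimizer_le_sqrt3:
  assumes "t > 0" "\<alpha> > 0" "is_arg_min (\<lambda>y. lattice_theta (bco y t) \<alpha>) (\<lambda>y. 1 \<le> y) y"
  shows "y \<in> {1..sqrt 3}"
proof -
  have "1 \<le> y" "\<not> lattice_theta (bco (sqrt 3) t) \<alpha> < lattice_theta (bco y t) \<alpha>"
    using assms(3) by (auto simp: is_arg_min_def)
  then show ?thesis
    using lattice_theta_bco_sqrt3_less[OF assms(1,2), of y] by (cases "sqrt 3 < y") auto
qed

section \<open>Exponential bounds, and the failure of y = 1 for small t or large \<alpha>\<close>

lemma exp_minus_le_inverse:
  fixes x :: real
  assumes "x > 0" shows "exp (- x) \<le> 1 / x"
  using le_imp_inverse_le[of x "exp x"] exp_ge_add_one_self[of x] assms by (simp add: exp_minus inverse_eq_divide)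

lemma exp_minus_pi_le_half:
  assumes "u \<ge> 1" shows "exp (- (pi * u)) \<le> 1 / 2"
proof -
  have "pi * u \<ge> 2 * 1" using assms pi_ge_two by (intro mult_mono) auto
  then have "exp (- (pi * u)) \<le> 1 / (pi * u)" "1 / (pi * u) \<le> 1 / 2"
    by (auto intro!: exp_minus_le_inverse frac_le)
  then show ?thesis by linarith
qed

lemma theta3_le:
  assumes "u \<ge> 1"
  shows "theta3 u \<le> 1 + 4 * exp (- (pi * u))"
proof -
  have "exp (- (pi * u)) / (1 - exp (- (pi * (2 * u)))) \<le> exp (- (pi * u)) / (1 / 2)"
    using exp_minus_pi_le_half[of "2 * u"] assms by (intro divide_left_mono) auto
  then show ?thesis
    using gauss_sum_0_le[of u 1] assms by (simp add: theta3_def mult_ac)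
qed

lemma theta2_le:
  assumes "u \<ge> 1"
  shows "theta2 u \<le> 4 * exp (- (pi * u / 4))"
proof -
  have "exp (- (pi * u / 4)) / (1 - exp (- (pi * u))) \<le> exp (- (pi * u / 4)) / (1 / 2)"
    using exp_minus_pi_le_half[of u] assms by (intro divide_left_mono) auto
  then show ?thesis
    using gauss_sum_0_le[of u "1/2"] assms by (simp add: theta2_def power2_eq_square)
qed

lemma gauss_sum_split:
  assumes "s > 0" "a \<ge> 0"
  shows "gauss_sum j a s = (pi * a\<^sup>2) ^ j * exp (- (pi * a\<^sup>2 * s)) + gauss_sum j (a + 1) s"
  using suminf_split_head[OF summable_gauss_sum[OF assms, of j]]
  by (simp add: gauss_sum_def add_ac)

lemma theta2_ge:
  assumes "u > 0"
  shows "theta2 u \<ge> 2 * exp (- (pi * u / 4))"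
  using gauss_sum_split[of u "1/2" 0] gauss_sum_pos[of u "3/2" 0] assms
  by (simp add: theta2_def power2_eq_square)

lemma bco_1_not_minimizer_if:
  assumes "y \<ge> 1" "lattice_theta (bco y t) \<alpha> < lattice_theta (bco 1 t) \<alpha>"
  shows "\<not> is_arg_min (\<lambda>y. lattice_theta (bco y t) \<alpha>) (\<lambda>y. 1 \<le> y) 1"
  using assms by (auto simp: is_arg_min_def)

text \<open>As s = \<alpha> t^2 tends to 0, \<open>theta3 s\<close> is at least
  1/\<open>sqrt s\<close> while the difference of the weights is smaller by the factor 2
  \<open>theta2 (4 / s)\<close>. So the gain \<open>Dh\<close> of the triangular over the square
  planar lattice outweighs the loss \<open>Df\<close> of the rectangular one.\<close>

lemma bco_1_not_minimizer_small_t: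
  assumes \<alpha>: "\<alpha> > 0"
  shows "\<exists>t0>0. \<forall>t. 0 < t \<and> t < t0 \<longrightarrow> \<not> is_arg_min (\<lambda>y. lattice_theta (bco y t) \<alpha>) (\<lambda>y. 1 \<le> y) 1"
proof -
  define f where "f y = theta3 (\<alpha> * y) * theta3 (\<alpha> / y)" for y
  define Df Dh where "Df = f (sqrt 3) - f 1" and "Dh = bcc_sum \<alpha> 1 - bcc_sum \<alpha> (sqrt 3)"
  have Df: "Df > 0" unfolding Df_def f_def using theta3_prod_strict_mono[OF \<alpha>, of 1 "sqrt 3"] by simp
  have Dh: "Dh > 0" unfolding Dh_def using bcc_sum_sqrt3_less[OF \<alpha>] by simp
  \<comment> \<open>Chosen so that \<open>theta2 (4 / s) < \<epsilon>\<close> makes 2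
    \<open>theta2 (4 / s)\<close> times Df + Dh smaller than Dh.\<close>
  define \<epsilon> where "\<epsilon> = Dh / (2 * (Df + Dh))"
  have \<epsilon>: "\<epsilon> > 0" using Df Dh by (simp add: \<epsilon>_def)
  \<comment> \<open>The entry 4 ensures \<open>4 / s \<ge> 1\<close> for \<open>theta2_le\<close>;
    the entry \<epsilon>/4 closes the chain that starts from
    \<open>theta2 (4 / s) \<le> 4 * s\<close>.\<close>
  define m where "m = min 4 (\<epsilon> / 4)"
  have m: "m > 0" using \<epsilon> by (simp add: m_def)
  show ?thesis
  proof (intro exI[of _ "sqrt (m / \<alpha>)"] conjI allI impI)
    show "sqrt (m / \<alpha>) > 0" using m \<alpha> by simp
    fix t assume t: "0 < t \<and> t < sqrt (m / \<alpha>)"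
    define s where "s = \<alpha> * t\<^sup>2"
    have s: "s > 0" using t \<alpha> by (simp add: s_def)
    have "t\<^sup>2 < (sqrt (m / \<alpha>))\<^sup>2" using t by (intro power_strict_mono) auto
    then have sm: "s < m" using m \<alpha> by (simp add: s_def field_simps)
    have "4 / s \<ge> 1" using sm s by (simp add: m_def)
    then have "theta2 (4 / s) \<le> 4 * exp (- (pi / s))" using theta2_le[of "4 / s"] by simp
    also have "\<dots> \<le> 4 * (1 / (pi / s))" using s by (intro mult_left_mono exp_minus_le_inverse) auto
    also have "\<dots> \<le> 4 * s" using s pi_ge_two by (simp add: field_simps)
    also have "\<dots> < \<epsilon>" using sm by (simp add: m_def)
    finally have "theta2 (4 / s) < \<epsilon>" .
    then have "theta2 (4 / s) * (2 * (Df + Dh)) < Dh"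
      using Df Dh by (simp add: \<epsilon>_def pos_less_divide_eq)
    then have "2 * theta2 (4 / s) * Df < (1 - 2 * theta2 (4 / s)) * Dh" by (simp add: algebra_simps)
    then have "2 * theta2 (4 / s) * Df / sqrt s < (1 - 2 * theta2 (4 / s)) * Dh / sqrt s"
      using s by (intro divide_strict_right_mono) auto
    then have "(theta3 s - theta2 s) * Df < (1 / sqrt s - (theta3 s - theta2 s)) * Dh"
      unfolding theta3_diff_theta2[OF s] by (simp add: algebra_simps diff_divide_distrib)
    also have "\<dots> \<le> theta2 s * Dh"
    proof (rule mult_right_mono)
      have "1 / sqrt s \<le> theta3 s"
        using theta3_inverse[OF s] theta3_gt_1[of "1 / s"] s by (simp add: divide_right_mono)
      then show "1 / sqrt s - (theta3 s - theta2 s) \<le> theta2 s" by simp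
    qed (use Dh in simp)
    finally have "lattice_theta (bco (sqrt 3) t) \<alpha> < lattice_theta (bco 1 t) \<alpha>"
      using t \<alpha> by (simp add: lattice_theta_bco_eq_bcc_sum s_def Df_def Dh_def f_def algebra_simps)
    then show "\<not> is_arg_min (\<lambda>y. lattice_theta (bco y t) \<alpha>) (\<lambda>y. 1 \<le> y) 1"
      by (intro bco_1_not_minimizer_if[of "sqrt 3"]) auto
  qed
qed

text \<open>The increase of the \<open>theta3\<close> product is of order at most exp(-pi \<alpha> /
  y), while the weighted \<open>theta2\<close> product at 1 is of order exp(-pi \<alpha> c) with c =
  (2 + t^2)/4. The hypothesis t < \<open>sqrt 2\<close> says c < 1, so some y > 1 satisfies c <
  1/y.\<close>

lemma bco_1_not_minimizer_large_alpha:
  assumes t: "0 < t" "t < sqrt 2"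
  shows "\<exists>\<alpha>t>0. \<forall>\<alpha>>\<alpha>t. \<not> is_arg_min (\<lambda>y. lattice_theta (bco y t) \<alpha>) (\<lambda>y. 1 \<le> y) 1"
proof -
  define d where "d = t\<^sup>2"
  have "t\<^sup>2 < (sqrt 2)\<^sup>2" using t by (intro power_strict_mono) auto
  then have d: "0 < d" "d < 2" using t by (auto simp: d_def)
  define c where "c = (2 + d) / 4"
  have c: "0 < c" "c < 1" using d by (auto simp: c_def)
  \<comment> \<open>This makes 1/y the midpoint of c and 1.\<close>
  define y where "y = 2 / (1 + c)"
  have y: "1 < y" "1 / y = (1 + c) / 2" using c by (auto simp: y_def)
  \<comment> \<open>Multiplied by pi \<alpha>, \<open>k1\<close> is the exponent by which g y falls
    below g 1, and \<open>k2\<close> the one by which the gain beats the loss.\<close>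
  define k1 k2 where "k1 = (y + 1 / y - 2) / 4" and "k2 = 1 / y - c"
  have k2: "k2 > 0" using c by (simp add: k2_def y(2))
  have "y + 1 / y - 2 = (y - 1)\<^sup>2 / y" using y(1) by (simp add: power2_eq_square field_simps)
  then have k1: "k1 > 0" using y(1) by (simp add: k1_def)
  \<comment> \<open>Above this value both exponentials exceed 30: then 4 - 16/30 \<ge> 2 in the
    bound for g 1 - g y, and 4 times 30 exceeds 48 in the final comparison.\<close>
  define \<alpha>0 where "\<alpha>0 = y + 1 / d + 30 / k1 + 30 / k2"
  have "\<alpha>0 > 0" using y d k1 k2 by (simp add: \<alpha>0_def add_pos_pos)
  moreover have "\<not> is_arg_min (\<lambda>y. lattice_theta (bco y t) \<alpha>) (\<lambda>y. 1 \<le> y) 1" if "\<alpha> > \<alpha>0" for \<alpha>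
  proof -
    have pos: "y > 0" "1 / d > 0" "30 / k1 > 0" "30 / k2 > 0" using y d k1 k2 by auto
    have "\<alpha> > y" "\<alpha> > 1 / d" "\<alpha> > 30 / k1" "\<alpha> > 30 / k2"
      using that pos unfolding \<alpha>0_def by linarith+
    then have \<alpha>: "\<alpha> > 1" "\<alpha> / y \<ge> 1" "\<alpha> * d \<ge> 1" "\<alpha> * k1 \<ge> 30" "\<alpha> * k2 \<ge> 30"
      using y d k1 k2 by (auto simp: field_simps)
    have \<alpha>y: "\<alpha> * y \<ge> \<alpha> / y"
    proof -
      have "1 / y \<le> 1" using y(1) by simp
      then have "1 / y \<le> y" using y(1) by linarith
      then have "\<alpha> * (1 / y) \<le> \<alpha> * y" using \<alpha> by (intro mult_left_mono) auto
      then show ?thesis by simp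
    qed
    have \<alpha>y1: "\<alpha> * y \<ge> 1" using \<alpha>y \<alpha>(2) by linarith
    have big: "30 < exp (pi * (\<alpha> * k))" if "\<alpha> * k \<ge> 30" for k
    proof -
      have "1 * 30 \<le> pi * (\<alpha> * k)" using that pi_ge_two by (intro mult_mono) auto
      then show ?thesis using exp_ge_add_one_self[of "pi * (\<alpha> * k)"] by linarith
    qed
    define E where "E = exp (- (pi * (\<alpha> / y)))"
    have E: "0 < E" "E \<le> 1 / 2" unfolding E_def using exp_minus_pi_le_half[OF \<alpha>(2)] by auto
    define f g where "f y = theta3 (\<alpha> * y) * theta3 (\<alpha> / y)" and "g y = theta2 (\<alpha> * y) * theta2 (\<alpha> / y)" for y
    have "theta3 (\<alpha> / y) \<le> 1 + 4 * E" unfolding E_def by (rule theta3_le[OF \<alpha>(2)])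
    moreover have "theta3 (\<alpha> * y) \<le> 1 + 4 * E"
    proof -
      have "theta3 (\<alpha> * y) \<le> 1 + 4 * exp (- (pi * (\<alpha> * y)))" using \<alpha> \<alpha>y by (intro theta3_le) auto
      moreover have "exp (- (pi * (\<alpha> * y))) \<le> E"
        unfolding E_def exp_le_cancel_iff neg_le_iff_le using \<alpha>y by (intro mult_left_mono) auto
      ultimately show ?thesis by linarith
    qed
    ultimately have "f y \<le> (1 + 4 * E) * (1 + 4 * E)"
      unfolding f_def using theta3_gt_1[of "\<alpha> / y"] theta3_gt_1[of "\<alpha> * y"] \<alpha> y E by (intro mult_mono) auto
    also have "\<dots> = 1 + 8 * E + 16 * (E * E)" by (simp add: algebra_simps)
    also have "E * E \<le> E * (1 / 2)" using E by (intro mult_left_mono) auto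
    finally have fy: "f y \<le> 1 + 16 * E" by simp
    have "1 * 1 \<le> f 1"
      unfolding f_def using theta3_gt_1[of \<alpha>] \<alpha> by (intro mult_mono) auto
    then have f: "f y - f 1 \<le> 16 * E" using fy by simp
    define A where "A = theta3 (\<alpha> * d)"
    define B where "B = theta2 (\<alpha> * d)"
    have A: "A > 0" "A \<le> 3"
      unfolding A_def using theta3_gt_1[of "\<alpha> * d"] theta3_le[OF \<alpha>(3)] exp_minus_pi_le_half[OF \<alpha>(3)] \<alpha>(3) by auto
    have "A * (f y - f 1) \<le> A * (16 * E)" using A f by (intro mult_left_mono) auto
    also have "\<dots> \<le> 3 * (16 * E)" using A E by (intro mult_right_mono) auto
    finally have Af: "A * (f y - f 1) \<le> 48 * E" by simp
    define H where "H = exp (- (pi * \<alpha> / 2))"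
    have "theta2 \<alpha> * theta2 \<alpha> \<ge> (2 * exp (- (pi * \<alpha> / 4))) * (2 * exp (- (pi * \<alpha> / 4)))"
      using \<alpha> theta2_pos[of \<alpha>] by (intro mult_mono theta2_ge) auto
    then have g1: "g 1 \<ge> 4 * H" by (simp add: g_def H_def flip: exp_add)
    have "g y \<le> (4 * exp (- (pi * (\<alpha> * y) / 4))) * (4 * exp (- (pi * (\<alpha> / y) / 4)))"
      unfolding g_def using \<alpha> \<alpha>y1 y theta2_pos[of "\<alpha> / y"] by (intro mult_mono theta2_le) auto
    also have "\<dots> = 16 * (exp (- (pi * (\<alpha> * k1))) * H)"
    proof -
      have "- (pi * (\<alpha> * y) / 4) + - (pi * (\<alpha> / y) / 4) = - (pi * (\<alpha> * k1)) + - (pi * \<alpha> / 2)"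
        using y(1) by (simp add: k1_def field_simps)
      then show ?thesis unfolding H_def exp_add[symmetric] by (simp flip: exp_add)
    qed
    also have "\<dots> \<le> 16 * (1 / 30 * H)"
    proof -
      have "exp (- (pi * (\<alpha> * k1))) \<le> 1 / 30"
        using le_imp_inverse_le[of 30 "exp (pi * (\<alpha> * k1))"] big[OF \<alpha>(4)] by (simp add: exp_minus)
      then show ?thesis by (intro mult_left_mono mult_right_mono) (auto simp: H_def)
    qed
    finally have gy: "g y \<le> 16 * (1 / 30 * H)" .
    have "H > 0" by (simp add: H_def)
    with gy g1 have "g 1 - g y \<ge> 2 * H" by linarith
    moreover have "B \<ge> 2 * exp (- (pi * (\<alpha> * d) / 4))" unfolding B_def using \<alpha> by (intro theta2_ge) auto
    ultimately have "B * (g 1 - g y) \<ge> (2 * exp (- (pi * (\<alpha> * d) / 4))) * (2 * H)"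
      by (intro mult_mono) (auto simp: H_def B_def theta2_pos less_imp_le \<alpha> intro: order_trans[rotated])
    moreover have "(2 * exp (- (pi * (\<alpha> * d) / 4))) * (2 * H) = 4 * (exp (pi * (\<alpha> * k2)) * E)"
    proof -
      have "- (pi * (\<alpha> * d) / 4) + - (pi * \<alpha> / 2) = pi * (\<alpha> * k2) + - (pi * (\<alpha> / y))"
        using y(1) by (simp add: k2_def c_def field_simps)
      then show ?thesis unfolding H_def E_def exp_add[symmetric] by (simp flip: exp_add)
    qed
    moreover have "exp (pi * (\<alpha> * k2)) * E > 30 * E" using big[OF \<alpha>(5)] E by (intro mult_strict_right_mono) auto
    ultimately have "A * (f y - f 1) < B * (g 1 - g y)" using Af E by linarith
    then have "lattice_theta (bco y t) \<alpha> < lattice_theta (bco 1 t) \<alpha>"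
      using t \<alpha>(1) y(1) by (simp add: lattice_theta_bco A_def B_def f_def g_def d_def algebra_simps)
    then show ?thesis using y(1) by (intro bco_1_not_minimizer_if[of y]) auto
  qed
  ultimately show ?thesis by blast
qed

section \<open>Moment bounds and a second derivative test\<close>

lemma square_le_exp:
  fixes v :: real assumes "v \<ge> 0" shows "v\<^sup>2 \<le> 2 * exp v"
  using exp_lower_Taylor_quadratic[OF assms] assms by linarith

text \<open>One eighth of the exponent is given up to remove the quadratic factor, so second moments
  of tails reduce to plain sums at 7/8 of the argument.\<close>

lemma gauss_sum_2_le:
  assumes "s > 0" "a > 0"
  shows "s\<^sup>2 * gauss_sum 2 a s \<le> 128 * gauss_sum 0 a (7 / 8 * s)"
proof (rule sums_le)
  show "(\<lambda>n. s\<^sup>2 * gauss_term 2 a s n) sums (s\<^sup>2 * gauss_sum 2 a s)"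
    using assms by (intro sums_mult gauss_sum_sums) auto
  show "(\<lambda>n. 128 * gauss_term 0 a (7 / 8 * s) n) sums (128 * gauss_sum 0 a (7 / 8 * s))"
    using assms by (intro sums_mult gauss_sum_sums) auto
  fix n
  define u where "u = pi * (real n + a)\<^sup>2 * s"
  have u: "u \<ge> 0" using assms by (simp add: u_def)
  have "u\<^sup>2 * exp (- u) \<le> 128 * exp (u / 8) * exp (- u)"
    using square_le_exp[of "u / 8"] u by (intro mult_right_mono) (auto simp: power_divide)
  also have "\<dots> = 128 * exp (- (7 / 8 * u))" by (simp flip: exp_add)
  finally show "s\<^sup>2 * gauss_term 2 a s n \<le>
      128 * gauss_term 0 a (7 / 8 * s) n"
    by (simp add: u_def power_mult_distrib mult_ac)
qed

lemma gauss_sum_0_le_double: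
  assumes "s > 0" "a > 0" "pi * a * s \<ge> 1"
  shows "gauss_sum 0 a s \<le> 2 * exp (- (pi * a\<^sup>2 * s))"
proof -
  have "exp (- (2 * pi * a * s)) \<le> 1 / (2 * pi * a * s)"
    using assms by (intro exp_minus_le_inverse mult_pos_pos) auto
  also have "\<dots> \<le> 1 / 2" using assms by (intro frac_le) (auto simp: mult.assoc)
  finally have "exp (- (pi * a\<^sup>2 * s)) / (1 - exp (- (2 * pi * a * s))) \<le> exp (- (pi * a\<^sup>2 * s)) / (1 / 2)"
    using assms(1,2) by (intro divide_left_mono) auto
  then show ?thesis using gauss_sum_0_le[OF assms(1,2)] by simp
qed

text \<open>The combination is even in \<open>x\<close>, so its derivative vanishes at 0; the left
  side of \<open>neg\<close> is half of its second derivative there.\<close>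

lemma even_product_decreasing:
  fixes p p' q q' :: "real \<Rightarrow> real"
  assumes "\<And>x. (p has_real_derivative p' x) (at x)" "(p' has_real_derivative p2) (at 0)"
    and "\<And>x. (q has_real_derivative q' x) (at x)" "(q' has_real_derivative q2) (at 0)"
    and neg: "A * (p 0 * p2 - (p' 0)\<^sup>2) + B * (q 0 * q2 - (q' 0)\<^sup>2) < 0"
  shows "\<exists>e>0. \<forall>x. 0 < x \<and> x < e \<longrightarrow> A * (p x * p (- x)) + B * (q x * q (- x)) < A * (p 0 * p 0) + B * (q 0 * q 0)"
proof -
  define G where "G x = A * (p x * p (- x)) + B * (q x * q (- x))" for x
  define G' where "G' x = A * (p' x * p (- x) - p x * p' (- x)) + B * (q' x * q (- x) - q x * q' (- x))" for x
  have G: "(G has_real_derivative G' x) (at x)" for x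
    unfolding G_def[abs_def] G'_def
    by (rule derivative_eq_intros assms(1,3) DERIV_chain2[OF assms(1)] DERIV_chain2[OF assms(3)] refl)+ (simp add: algebra_simps)
  have um: "(uminus has_real_derivative - 1) (at x within S)" for x :: real and S
    by (auto intro!: derivative_eq_intros)
  have m: "((\<lambda>x. p (- x)) has_real_derivative - p' (- x)) (at x)" "((\<lambda>x. q (- x)) has_real_derivative - q' (- x)) (at x)" for x
    using DERIV_chain2[OF assms(1) um] DERIV_chain2[OF assms(3) um] by simp_all
  have m': "((\<lambda>x. p' (- x)) has_real_derivative - p2) (at 0)" "((\<lambda>x. q' (- x)) has_real_derivative - q2) (at 0)"
    using DERIV_chain2[OF _ um, of p' p2 0] DERIV_chain2[OF _ um, of q' q2 0] assms(2,4) by simp_all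
  have "(G' has_real_derivative 2 * (A * (p 0 * p2 - (p' 0)\<^sup>2) + B * (q 0 * q2 - (q' 0)\<^sup>2))) (at 0)"
    unfolding G'_def[abs_def]
    by (rule DERIV_cong[OF DERIV_add[OF
          DERIV_cmult[OF DERIV_diff[OF DERIV_mult[OF assms(2) m(1)] DERIV_mult[OF assms(1) m'(1)]]]
          DERIV_cmult[OF DERIV_diff[OF DERIV_mult[OF assms(4) m(2)] DERIV_mult[OF assms(3) m'(2)]]]]])
      (simp add: power2_eq_square algebra_simps)
  from DERIV_neg_dec_right[OF this] neg obtain e where e: "e > 0" "\<forall>h>0. h < e \<longrightarrow> G' h < G' 0" by auto
  have "G x < G 0" if "0 < x" "x < e" for x
  proof (rule DERIV_neg_imp_decreasing_open[OF that(1)])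
    show "\<exists>D. (G has_real_derivative D) (at z) \<and> D < 0" if "0 < z" "z < x" for z
      using G[of z] e that \<open>x < e\<close> by (intro exI[of _ "G' z"]) (auto simp: G'_def)
    show "continuous_on {0..x} G"
      using G by (auto intro!: continuous_at_imp_continuous_on DERIV_isCont)
  qed
  then show ?thesis using e(1) by (intro exI[of _ e]) (auto simp: G_def)
qed

section \<open>The second-order condition at the cubic lattices\<close>

text \<open>Half of the second derivative at y = 1 with respect to ln y. With x = pi \<beta>, r =
  exp(-x) and \<rho> = exp(-x/4), the dominant terms are 2 r (x^2 - x) and -2 \<rho>^3 x. Because
  \<rho>^3 = r exp(x/4), their sum has the sign of x - 1 - exp(x/4); the rest is error
  control.\<close>

lemma bco_1_second_order:
  fixes \<beta> :: real
  defines "T \<equiv> theta3 \<beta>" and "X1 \<equiv> \<beta> * gauss_sum 1 1 \<beta>" and "X2 \<equiv> \<beta>\<^sup>2 * gauss_sum 2 1 \<beta>"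
    and "W \<equiv> theta2 \<beta>" and "Z1 \<equiv> \<beta> * gauss_sum 1 (1/2) \<beta>" and "Z2 \<equiv> \<beta>\<^sup>2 * gauss_sum 2 (1/2) \<beta>"
  assumes \<beta>: "\<beta> > 2385 / 1000"
  shows "T * (T * (2 * X2 - 2 * X1) - (2 * X1)\<^sup>2) + W * (W * (2 * Z2 - 2 * Z1) - (2 * Z1)\<^sup>2) < 0"
proof -
  define x where "x = pi * \<beta>"
  have x0: "x \<ge> 74926 / 10000"
  proof -
    have "pi * \<beta> \<ge> 314159 / 100000 * (2385 / 1000)" using \<beta> pi_approx by (intro mult_mono) auto
    then show ?thesis by (simp add: x_def)
  qed
  define e4 where "e4 = exp (x / 4)"
  \<comment> \<open>The tangent of the exponential at x = 7.4926, just below pi times 2.385; its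
    slope exceeds 1. The slack 0.016 over x - 1 has to pay for all corrections.\<close>
  have e4: "e4 \<ge> x - 984 / 1000"
  proof -
    have "(65087 / 10000 :: real) \<le> exp (187315 / 100000)"
      by (rule order_trans[OF _ exp_ge_Taylor[of _ 13]]) (simp_all add: eval_nat_numeral lessThan_Suc)
    then have "65087 / 10000 * (1 + (x - 74926 / 10000) / 4) \<le> exp (187315 / 100000) * exp ((x - 74926 / 10000) / 4)"
      using x0 exp_ge_add_one_self[of "(x - 74926 / 10000) / 4"] by (intro mult_mono) auto
    also have "\<dots> = e4" by (simp add: e4_def field_simps flip: exp_add)
    finally show ?thesis using x0 by (simp add: field_simps)
  qed
  then have e4': "e4 \<ge> 65 / 10" using x0 by linarith
  define \<rho> where "\<rho> = exp (- (x / 4))"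
  define r where "r = exp (- x)"
  have \<rho>: "\<rho> > 0" "\<rho> * e4 = 1" by (simp_all add: \<rho>_def e4_def flip: exp_add)
  have r: "r > 0" by (simp add: r_def)
  have e4_power: "e4 ^ k = exp (real k * x / 4)" for k
    unfolding e4_def by (simp flip: exp_of_nat_mult)
  have r4: "r * e4 ^ 4 = 1" by (simp add: e4_power r_def flip: exp_add)
  have rho3: "\<rho> ^ 3 = r * e4"
  proof -
    have "\<rho> ^ 3 = exp (real 3 * (- (x / 4)))" unfolding \<rho>_def by (simp only: exp_of_nat_mult)
    then show ?thesis by (simp add: r_def e4_def flip: exp_add)
  qed
  \<comment> \<open>\<open>e4\<close> dominates a multiple of x and r is its inverse fourth power,
    so r x^2 is of size at most x^(-2); this product controls the corrections below.\<close>
  have rx2: "r * x\<^sup>2 \<le> 33 / 1000"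
  proof -
    have "86 / 100 * x \<le> e4" using e4 x0 by linarith
    then have "(86 / 100 * x) ^ 4 \<le> e4 ^ 4" using x0 by (intro power_mono) auto
    then have "r * (86 / 100 * x) ^ 4 \<le> r * e4 ^ 4" using r by (intro mult_left_mono) auto
    then have "(86 / 100) ^ 4 * (r * x\<^sup>2) * x\<^sup>2 \<le> 1"
      unfolding r4 by (simp add: power_mult_distrib eval_nat_numeral mult_ac)
    moreover have "(86 / 100) ^ 4 * (r * x\<^sup>2) * 56 \<le> (86 / 100) ^ 4 * (r * x\<^sup>2) * x\<^sup>2"
    proof (rule mult_left_mono)
      have "(74926 / 10000)\<^sup>2 \<le> x\<^sup>2" using x0 by (intro power_mono) auto
      then show "56 \<le> x\<^sup>2" by (simp add: power2_eq_square)
    qed (use r in auto)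
    ultimately show ?thesis by (simp add: eval_nat_numeral)
  qed
  have r_small: "r \<le> 1 / 1000"
  proof -
    have "(74926 / 10000)\<^sup>2 \<le> x\<^sup>2" using x0 by (intro power_mono) auto
    then have "r * 56 \<le> r * x\<^sup>2" using r by (intro mult_left_mono) (auto simp: power2_eq_square)
    then show ?thesis using rx2 by linarith
  qed
  have \<beta>0: "\<beta> > 0" using \<beta> by simp
  have e6: "e4 ^ 6 \<ge> 75418"
    using power_mono[OF e4', of 6] by (simp add: eval_nat_numeral)
  have rr: "r\<^sup>2 = exp (- (2 * x))" by (simp add: r_def power2_eq_square flip: exp_add)

  have "X2 = x\<^sup>2 * r + \<beta>\<^sup>2 * gauss_sum 2 2 \<beta>"
    unfolding X2_def x_def r_def using gauss_sum_split[OF \<beta>0, of 1 2] by (simp add: power_mult_distrib algebra_simps)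
  moreover have "\<beta>\<^sup>2 * gauss_sum 2 2 \<beta> \<le> r\<^sup>2"
  proof -
    have "\<beta>\<^sup>2 * gauss_sum 2 2 \<beta> \<le> 128 * gauss_sum 0 2 (7 / 8 * \<beta>)" by (rule gauss_sum_2_le) (use \<beta>0 in auto)
    also have "\<dots> \<le> 128 * (2 * exp (- (pi * 2\<^sup>2 * (7 / 8 * \<beta>))))"
      using \<beta>0 x0 by (intro mult_left_mono gauss_sum_0_le_double) (auto simp: x_def)
    also have "\<dots> = 256 * (r\<^sup>2 / e4 ^ 6)"
      by (simp add: rr e4_power x_def flip: exp_diff)
    also have "\<dots> \<le> 256 * (r\<^sup>2 / 256)"
      using e6 by (intro mult_left_mono divide_left_mono) auto
    finally show ?thesis by simp
  qed
  ultimately have X2: "X2 \<le> x\<^sup>2 * r + r\<^sup>2" by simp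
  have X1: "X1 \<ge> x * r"
    unfolding X1_def x_def r_def using gauss_sum_split[OF \<beta>0, of 1 1] gauss_sum_pos[of \<beta> 2 1] \<beta>0
    by (simp add: algebra_simps)
  have T: "1 \<le> T" "T \<le> 1 + 2 * r + r\<^sup>2"
  proof -
    show "1 \<le> T" unfolding T_def using theta3_gt_1[OF \<beta>0] by simp
    have "gauss_sum 0 2 \<beta> \<le> 2 * exp (- (pi * 2\<^sup>2 * \<beta>))"
      using \<beta>0 x0 by (intro gauss_sum_0_le_double) (auto simp: x_def)
    also have "\<dots> = 2 * (r\<^sup>2 * r\<^sup>2)" by (simp add: rr x_def flip: exp_add)
    also have "\<dots> \<le> 2 * (r\<^sup>2 * (1 / 4))"
      using r_small r power_mono[of r "1/2" 2] by (intro mult_left_mono) (auto simp: power_divide)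
    finally have "gauss_sum 0 2 \<beta> \<le> r\<^sup>2 / 2" by simp
    then show "T \<le> 1 + 2 * r + r\<^sup>2"
      unfolding T_def theta3_def using gauss_sum_split[OF \<beta>0, of 1 0] by (simp add: r_def x_def)
  qed
  have Z1: "Z1 \<ge> x / 4 * \<rho>"
    unfolding Z1_def x_def \<rho>_def using gauss_sum_split[OF \<beta>0, of "1/2" 1] gauss_sum_pos[of \<beta> "3/2" 1] \<beta>0
    by (simp add: algebra_simps power2_eq_square)
  have "Z2 = x\<^sup>2 / 16 * \<rho> + \<beta>\<^sup>2 * gauss_sum 2 (3/2) \<beta>"
    unfolding Z2_def x_def \<rho>_def using gauss_sum_split[OF \<beta>0, of "1/2" 2]
    by (simp add: power_mult_distrib algebra_simps power2_eq_square)
  moreover have "\<beta>\<^sup>2 * gauss_sum 2 (3/2) \<beta> \<le> \<rho> / 1000"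
  proof -
    have "\<beta>\<^sup>2 * gauss_sum 2 (3/2) \<beta> \<le> 128 * gauss_sum 0 (3/2) (7 / 8 * \<beta>)" by (rule gauss_sum_2_le) (use \<beta>0 in auto)
    also have "\<dots> \<le> 128 * (2 * exp (- (pi * (3/2)\<^sup>2 * (7 / 8 * \<beta>))))"
      using \<beta>0 x0 by (intro mult_left_mono gauss_sum_0_le_double) (auto simp: x_def)
    also have "exp (- (pi * (3/2)\<^sup>2 * (7 / 8 * \<beta>))) = \<rho> / (e4 ^ 6 * exp (7 / 32 * x))"
      by (simp add: \<rho>_def e4_power x_def power2_eq_square flip: exp_add exp_diff)
    also have "128 * (2 * (\<rho> / (e4 ^ 6 * exp (7 / 32 * x)))) \<le> 128 * (2 * (\<rho> / 256000))"
    proof -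
      have "exp (7 / 32 * x) \<ge> exp (7 / 32 * (74926 / 10000))" using x0 by simp
      moreover have "exp (7 / 32 * (74926 / 10000)) \<ge> (35 / 10 :: real)"
        by (rule order_trans[OF _ exp_ge_Taylor[of _ 4]]) (simp_all add: eval_nat_numeral lessThan_Suc)
      ultimately have "35 / 10 \<le> exp (7 / 32 * x)" by linarith
      from mult_mono[OF e6 this] have "e4 ^ 6 * exp (7 / 32 * x) \<ge> 75418 * (35 / 10)" using e6 by simp
      then have "256000 \<le> e4 ^ 6 * exp (7 / 32 * x)" by simp
      then show ?thesis using \<rho> by (intro mult_left_mono divide_left_mono) auto
    qed
    finally show ?thesis by simp
  qed
  ultimately have Z2: "Z2 \<le> x\<^sup>2 / 16 * \<rho> + \<rho> / 1000" by simp
  have W: "W \<ge> 2 * \<rho>" "W \<le> 2 * \<rho> * (1 + 2 * r\<^sup>2)"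
  proof -
    show "W \<ge> 2 * \<rho>" unfolding W_def \<rho>_def x_def using theta2_ge[OF \<beta>0] by simp
    have "gauss_sum 0 (3/2) \<beta> \<le> 2 * exp (- (pi * (3/2)\<^sup>2 * \<beta>))"
      using \<beta>0 x0 by (intro gauss_sum_0_le_double) (auto simp: x_def)
    also have "- (pi * (3/2)\<^sup>2 * \<beta>) = - (x / 4) + - (2 * x)" by (simp add: x_def power2_eq_square)
    also have "2 * exp (- (x / 4) + - (2 * x)) = 2 * (\<rho> * r\<^sup>2)" unfolding exp_add rr \<rho>_def ..
    finally show "W \<le> 2 * \<rho> * (1 + 2 * r\<^sup>2)"
      unfolding W_def theta2_def using gauss_sum_split[OF \<beta>0, of "1/2" 0]
      by (simp add: \<rho>_def x_def power2_eq_square algebra_simps)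
  qed

  have xx: "x\<^sup>2 - x \<ge> 0" using x0 by (simp add: power2_eq_square)
  have r2: "r\<^sup>2 \<le> r / 1000" using r r_small by (simp add: power2_eq_square mult_left_mono)
  have first: "T * (T * (2 * X2 - 2 * X1) - (2 * X1)\<^sup>2) \<le> 2 * r * (x\<^sup>2 - x + 7 / 100)"
  proof -
    have "T * (2 * X1)\<^sup>2 \<ge> 1 * (2 * (x * r))\<^sup>2"
      using T X1 x0 r by (intro mult_mono power_mono) auto
    moreover have "T * T * (2 * X2 - 2 * X1) \<le> (1 + 41 / 10 * r) * (2 * r * (x\<^sup>2 - x + r))"
    proof -
      have "T * T * (2 * X2 - 2 * X1) \<le> T * T * (2 * r * (x\<^sup>2 - x + r))"
        using X1 X2 by (intro mult_left_mono) (auto simp: algebra_simps power2_eq_square)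
      also have "\<dots> \<le> (1 + 41 / 10 * r) * (2 * r * (x\<^sup>2 - x + r))"
      proof (rule mult_right_mono)
        have "T * T \<le> (1 + (2 + 1 / 1000) * r) * (1 + (2 + 1 / 1000) * r)"
          using T r2 by (intro mult_mono) (auto simp: algebra_simps)
        also have "\<dots> = 1 + 4002 / 1000 * r + (2 + 1 / 1000)\<^sup>2 * r\<^sup>2"
          by (simp add: algebra_simps power2_eq_square)
        also have "\<dots> \<le> 1 + 41 / 10 * r"
        proof -
          have "(2 + 1 / 1000)\<^sup>2 * r\<^sup>2 \<le> 5 * r\<^sup>2"
            by (intro mult_right_mono) (auto simp: power2_eq_square)
          then show ?thesis using r2 r by linarith
        qed
        finally show "T * T \<le> 1 + 41 / 10 * r" .
      qed (use r xx in auto)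
      finally show ?thesis .
    qed
    moreover have "(1 + 41 / 10 * r) * (2 * r * (x\<^sup>2 - x + r)) - (2 * (x * r))\<^sup>2 \<le> 2 * r * (x\<^sup>2 - x + 7 / 100)"
    proof -
      have "(1 + 41 / 10 * r) * (x\<^sup>2 - x + r) - 2 * (r * x\<^sup>2) \<le> x\<^sup>2 - x + 7 / 100"
      proof -
        have "r * 7 \<le> r * x" using r x0 by (intro mult_left_mono) auto
        moreover have "(1 + 41 / 10 * r) * (x\<^sup>2 - x + r) - 2 * (r * x\<^sup>2) =
            x\<^sup>2 - x + 21 / 10 * (r * x\<^sup>2) + r - 41 / 10 * (r * x) + 41 / 10 * r\<^sup>2"
          by (simp add: field_simps power2_eq_square)
        ultimately show ?thesis using rx2 r2 r by linarith
      qed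
      then have "2 * r * ((1 + 41 / 10 * r) * (x\<^sup>2 - x + r) - 2 * (r * x\<^sup>2)) \<le> 2 * r * (x\<^sup>2 - x + 7 / 100)"
        using r by (intro mult_left_mono) auto
      moreover have "2 * r * ((1 + 41 / 10 * r) * (x\<^sup>2 - x + r) - 2 * (r * x\<^sup>2)) =
          (1 + 41 / 10 * r) * (2 * r * (x\<^sup>2 - x + r)) - (2 * (x * r))\<^sup>2"
        by (simp add: field_simps power2_eq_square)
      ultimately show ?thesis by simp
    qed
    moreover have "T * (T * (2 * X2 - 2 * X1) - (2 * X1)\<^sup>2) = T * T * (2 * X2 - 2 * X1) - T * (2 * X1)\<^sup>2"
      by (simp add: algebra_simps)
    ultimately show ?thesis by linarith
  qed
  have second: "W * (W * (2 * Z2 - 2 * Z1) - (2 * Z1)\<^sup>2) \<le> - (2 * \<rho> ^ 3 * (x - 5 / 1000))"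
  proof -
    define E where "E = x\<^sup>2 / 16 - x / 4 + 1 / 1000"
    have "x * 4 \<le> x * x" using x0 by (intro mult_left_mono) auto
    then have E: "E \<ge> 0" by (simp add: E_def power2_eq_square)
    have "W * (2 * Z2 - 2 * Z1) \<le> W * (2 * \<rho> * E)"
      using Z1 Z2 W \<rho> by (intro mult_left_mono) (auto simp: E_def algebra_simps)
    also have "\<dots> \<le> 2 * \<rho> * (1 + 2 * r\<^sup>2) * (2 * \<rho> * E)"
      using W E \<rho> by (intro mult_right_mono) auto
    finally have "W * (2 * Z2 - 2 * Z1) \<le> 2 * \<rho> * (1 + 2 * r\<^sup>2) * (2 * \<rho> * E)" .
    moreover have "(2 * Z1)\<^sup>2 \<ge> (x / 2 * \<rho>)\<^sup>2" using Z1 x0 \<rho> by (intro power_mono) auto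
    moreover have "2 * \<rho> * (1 + 2 * r\<^sup>2) * (2 * \<rho> * E) - (x / 2 * \<rho>)\<^sup>2 = \<rho>\<^sup>2 * (4 * (1 + 2 * r\<^sup>2) * E - x\<^sup>2 / 4)"
      by (simp add: algebra_simps power2_eq_square)
    moreover have "\<rho>\<^sup>2 * (4 * (1 + 2 * r\<^sup>2) * E - x\<^sup>2 / 4) \<le> \<rho>\<^sup>2 * - (x - 5 / 1000)"
    proof (rule mult_left_mono)
      have "r\<^sup>2 * x\<^sup>2 \<le> r / 1000 * x\<^sup>2" using r2 by (intro mult_right_mono) auto
      also have "\<dots> \<le> 33 / 1000000" using rx2 by simp
      finally have "r\<^sup>2 * x\<^sup>2 \<le> 33 / 1000000" .
      moreover have "r\<^sup>2 \<le> 1 / 1000000" using r2 r_small by linarith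
      moreover have "r\<^sup>2 * x \<ge> 0" using x0 by simp
      moreover have "4 * (1 + 2 * r\<^sup>2) * E - x\<^sup>2 / 4 = - x + 4 / 1000 + (r\<^sup>2 * x\<^sup>2) / 2 - 2 * (r\<^sup>2 * x) + 8 / 1000 * r\<^sup>2"
        by (simp add: E_def algebra_simps)
      ultimately show "4 * (1 + 2 * r\<^sup>2) * E - x\<^sup>2 / 4 \<le> - (x - 5 / 1000)" by linarith
    qed simp
    ultimately have "W * (2 * Z2 - 2 * Z1) - (2 * Z1)\<^sup>2 \<le> - (\<rho>\<^sup>2 * (x - 5 / 1000))"
      unfolding mult_minus_right by linarith
    then have "W * (W * (2 * Z2 - 2 * Z1) - (2 * Z1)\<^sup>2) \<le> W * - (\<rho>\<^sup>2 * (x - 5 / 1000))"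
      using W \<rho> by (intro mult_left_mono) auto
    moreover have "2 * \<rho> * (\<rho>\<^sup>2 * (x - 5 / 1000)) \<le> W * (\<rho>\<^sup>2 * (x - 5 / 1000))"
      using W x0 by (intro mult_right_mono) auto
    moreover have "2 * \<rho> * (\<rho>\<^sup>2 * (x - 5 / 1000)) = 2 * \<rho> ^ 3 * (x - 5 / 1000)"
      by (simp add: power2_eq_square power3_eq_cube)
    ultimately show ?thesis unfolding mult_minus_right by linarith
  qed
  \<comment> \<open>With \<open>e4 \<ge> x - 984 / 1000\<close> this reduces to 0.011 x > 0.06508,
    true from x = 6 on.\<close>
  have "x\<^sup>2 - x + 7 / 100 < e4 * (x - 5 / 1000)"
  proof -
    have "(x - 984 / 1000) * (x - 5 / 1000) \<le> e4 * (x - 5 / 1000)" using e4 x0 by (intro mult_right_mono) auto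
    moreover have "x\<^sup>2 - x + 7 / 100 < (x - 984 / 1000) * (x - 5 / 1000)"
    proof -
      have "(x - 984 / 1000) * (x - 5 / 1000) = x\<^sup>2 - 989 / 1000 * x + 492 / 100000"
        by (simp add: field_simps power2_eq_square)
      then show ?thesis using x0 by linarith
    qed
    ultimately show ?thesis by linarith
  qed
  then have "2 * r * (x\<^sup>2 - x + 7 / 100) < 2 * r * (e4 * (x - 5 / 1000))"
    using r by (intro mult_strict_left_mono) auto
  also have "\<dots> = 2 * \<rho> ^ 3 * (x - 5 / 1000)" unfolding rho3 by simp
  finally show ?thesis using first second by linarith
qed

lemma bco_1_not_local_minimizer:
  assumes \<beta>: "\<beta> > 2385 / 1000"
  shows "\<forall>\<^sub>F y in at_right 1. lattice_theta (bco y 1) \<beta> < lattice_theta (bco 1 1) \<beta>"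
proof -
  have \<beta>0: "\<beta> > 0" using \<beta> by simp
  define p q where "p x = theta3 (\<beta> * exp x)" and "q x = theta2 (\<beta> * exp x)" for x
  define p' q' where "p' x = - (2 * gauss_sum 1 1 (\<beta> * exp x)) * (\<beta> * exp x)"
    and "q' x = - (2 * gauss_sum 1 (1/2) (\<beta> * exp x)) * (\<beta> * exp x)" for x
  have d: "(p has_real_derivative p' x) (at x)" "(q has_real_derivative q' x) (at x)" for x
    unfolding p_def q_def p'_def q'_def using \<beta>0 by (auto intro!: derivative_eq_intros)
  have d': "(p' has_real_derivative 2 * (\<beta>\<^sup>2 * gauss_sum 2 1 \<beta>) - 2 * (\<beta> * gauss_sum 1 1 \<beta>)) (at 0)"
    "(q' has_real_derivative 2 * (\<beta>\<^sup>2 * gauss_sum 2 (1/2) \<beta>) - 2 * (\<beta> * gauss_sum 1 (1/2) \<beta>)) (at 0)"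
    unfolding p'_def q'_def using \<beta>0
    by (auto intro!: derivative_eq_intros simp: power2_eq_square numeral_2_eq_2)
  have "theta3 \<beta> * (p 0 * (2 * (\<beta>\<^sup>2 * gauss_sum 2 1 \<beta>) - 2 * (\<beta> * gauss_sum 1 1 \<beta>)) - (p' 0)\<^sup>2) +
    theta2 \<beta> * (q 0 * (2 * (\<beta>\<^sup>2 * gauss_sum 2 (1/2) \<beta>) - 2 * (\<beta> * gauss_sum 1 (1/2) \<beta>)) - (q' 0)\<^sup>2) < 0"
    using bco_1_second_order[OF \<beta>] by (simp add: p_def q_def p'_def q'_def mult_ac)
  from even_product_decreasing[OF d(1) d'(1) d(2) d'(2) this] obtain e where e: "e > 0"
    "\<And>x. 0 < x \<Longrightarrow> x < e \<Longrightarrow> theta3 \<beta> * (p x * p (- x)) + theta2 \<beta> * (q x * q (- x)) <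
      theta3 \<beta> * (p 0 * p 0) + theta2 \<beta> * (q 0 * q 0)"
    by blast
  have "lattice_theta (bco y 1) \<beta> < lattice_theta (bco 1 1) \<beta>" if y: "1 < y" "y < exp e" for y
  proof -
    have "0 < ln y" "ln y < e" using y ln_less_cancel_iff[of y "exp e"] by auto
    from e(2)[OF this] show ?thesis
      using y \<beta>0 by (simp add: lattice_theta_bco p_def q_def exp_minus divide_inverse)
  qed
  moreover have "\<forall>\<^sub>F y in at_right 1. 1 < y \<and> y < exp e"
    using eventually_at_right_real[of 1 "exp e"] e(1) by (simp add: eventually_mono)
  ultimately show ?thesis by (auto elim!: eventually_mono)
qed

section \<open>Strict minimality at unit inverse temperature\<close>

text \<open>A lower bound for u T over 0 \<le> u \<le> b is the smaller of 0 and b l, attained at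
  one end according to the sign of l; hence two numerical side conditions instead of a case
  distinction.\<close>

lemma horner_step:
  fixes u T l :: real
  assumes "l \<le> T" "0 \<le> u" "u \<le> b" "l' \<le> c" "l' \<le> c + b * l"
  shows "l' \<le> c + u * T"
proof -
  have "u * l \<le> u * T" using assms by (intro mult_left_mono) auto
  moreover have "min 0 (b * l) \<le> u * l"
  proof (cases "l \<ge> 0")
    case True
    then have "u * l \<ge> 0" using assms by simp
    then show ?thesis by linarith
  next
    case False
    then have "b * l \<le> u * l" using assms by (intro mult_right_mono_neg) auto
    then show ?thesis by linarith
  qed
  ultimately show ?thesis using assms by linarith
qed

text \<open>Taylor polynomials of odd degree lie below \<open>exp\<close> on the whole line.
  Averaging those at z and -z removes the odd powers.\<close>

lemma cosh_ge_Taylor: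
  fixes z :: real
  shows "1 + z\<^sup>2 / 2 + (z\<^sup>2)\<^sup>2 / 24 + (z\<^sup>2) ^ 3 / 720 + (z\<^sup>2) ^ 4 / 40320 \<le> cosh z"
proof -
  have le: "(\<Sum>m<10. z ^ m / fact m) + (\<Sum>m<10. (- z) ^ m / fact m) \<le> 2 * cosh z"
    using exp_ge_Taylor_even[of 10 z] exp_ge_Taylor_even[of 10 "- z"] by (simp add: cosh_field_def)
  have eq: "(\<Sum>m<10. z ^ m / fact m) + (\<Sum>m<10. (- z) ^ m / fact m) =
      2 * (1 + z\<^sup>2 / 2 + (z\<^sup>2)\<^sup>2 / 24 + (z\<^sup>2) ^ 3 / 720 + (z\<^sup>2) ^ 4 / 40320)"
    by (simp add: eval_nat_numeral lessThan_Suc field_simps)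
  show ?thesis using le unfolding eq by (simp only: mult_le_cancel_left_pos zero_less_numeral)
qed

lemma exp_minus_ge_quintic:
  fixes v :: real
  shows "exp (- v) \<ge> 1 - v + v\<^sup>2 / 2 - v ^ 3 / 6 + v ^ 4 / 24 - v ^ 5 / 120"
proof -
  have "(\<Sum>m<6. (- v) ^ m / fact m) \<le> exp (- v)" by (rule exp_ge_Taylor_even) simp
  then show ?thesis by (simp add: eval_nat_numeral lessThan_Suc)
qed

text \<open>The coefficients \<open>h0\<close>, ..., \<open>h9\<close> are those of the difference of the two sides, divided by
  \<open>u\<^sup>2\<close>, after replacing \<open>exp\<close> and \<open>cosh\<close> by Taylor polynomials; it is bounded from below by
  interval arithmetic along the Horner scheme.\<close>

lemma first_shell_increment:
  fixes u z :: real
  assumes u: "0 \<le> u" "u \<le> 487 / 1000" and z: "z\<^sup>2 \<ge> 2 * (157 / 50) * u + u\<^sup>2"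
  shows "exp (- u) * cosh z - 1 + u \<ge> 157 / 50 * u - 498 / 1000 * u\<^sup>2 + 8 / 100 * u ^ 3"
proof -
  define w where "w = 2 * (157 / 50) * u + u\<^sup>2"
  have w: "0 \<le> w" "w \<le> z\<^sup>2" using u z by (auto simp: w_def)
  define h9 where "h9 = (- 1 / 86400 :: real)"
  define h8 where "h8 = - 173 / 1080000 + u * h9"
  define h7 where "h7 = - 23161 / 27000000 + u * h8"
  define h6 where "h6 = - 780067 / 337500000 + u * h7"
  define h5 where "h5 = - 1177157 / 270000000 + u * h6"
  define h4 where "h4 = - 431861 / 135000000 + u * h5"
  define h3 where "h3 = 143431 / 7500000 + u * h4"
  define h2 where "h2 = - 802843 / 11250000 + u * h3"
  define h1 where "h1 = 533143 / 11250000 + u * h2"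
  define h0 where "h0 = 19 / 15000 + u * h1"
  have "- 1 / 1000 \<le> h9" by (simp add: h9_def)
  then have "- 1 / 1000 \<le> h8" unfolding h8_def by (rule horner_step[OF _ u]) simp_all
  then have "- 1 / 500 \<le> h7" unfolding h7_def by (rule horner_step[OF _ u]) simp_all
  then have "- 1 / 250 \<le> h6" unfolding h6_def by (rule horner_step[OF _ u]) simp_all
  then have "- 7 / 1000 \<le> h5" unfolding h5_def by (rule horner_step[OF _ u]) simp_all
  then have "- 7 / 1000 \<le> h4" unfolding h4_def by (rule horner_step[OF _ u]) simp_all
  then have "3 / 200 \<le> h3" unfolding h3_def by (rule horner_step[OF _ u]) simp_all
  then have "- 9 / 125 \<le> h2" unfolding h2_def by (rule horner_step[OF _ u]) simp_all
  then have "3 / 250 \<le> h1" unfolding h1_def by (rule horner_step[OF _ u]) simp_all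
  then have "0 \<le> h0" unfolding h0_def by (rule horner_step[OF _ u]) simp_all
  have "1 + w / 2 + w\<^sup>2 / 24 + w ^ 3 / 720 \<le> 1 + z\<^sup>2 / 2 + (z\<^sup>2)\<^sup>2 / 24 + (z\<^sup>2) ^ 3 / 720"
    using w by (intro add_mono divide_right_mono power_mono) auto
  also have "\<dots> \<le> cosh z"
  proof -
    have "0 \<le> (z\<^sup>2) ^ 4" by simp
    then show ?thesis using cosh_ge_Taylor[of z] by linarith
  qed
  finally have c: "1 + w / 2 + w\<^sup>2 / 24 + w ^ 3 / 720 \<le> cosh z" .
  have "(1 - u + u\<^sup>2 / 2 - u ^ 3 / 6 + u ^ 4 / 24 - u ^ 5 / 120) * (1 + w / 2 + w\<^sup>2 / 24 + w ^ 3 / 720) \<le>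
      exp (- u) * (1 + w / 2 + w\<^sup>2 / 24 + w ^ 3 / 720)"
    using w by (intro mult_right_mono[OF exp_minus_ge_quintic]) simp
  also have "\<dots> \<le> exp (- u) * cosh z" using c by (intro mult_left_mono) auto
  finally have "(1 - u + u\<^sup>2 / 2 - u ^ 3 / 6 + u ^ 4 / 24 - u ^ 5 / 120) * (1 + w / 2 + w\<^sup>2 / 24 + w ^ 3 / 720) \<le> exp (- u) * cosh z" .
  moreover have "(1 - u + u\<^sup>2 / 2 - u ^ 3 / 6 + u ^ 4 / 24 - u ^ 5 / 120) * (1 + w / 2 + w\<^sup>2 / 24 + w ^ 3 / 720) =
      1 - u + 157 / 50 * u - 498 / 1000 * u\<^sup>2 + 8 / 100 * u ^ 3 + u\<^sup>2 * h0"
    unfolding w_def h0_def h1_def h2_def h3_def h4_def h5_def h6_def h7_def h8_def h9_def by (simp add: field_simps eval_nat_numeral)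
  moreover have "u\<^sup>2 * h0 \<ge> 0" using \<open>0 \<le> h0\<close> by simp
  ultimately show ?thesis by linarith
qed

text \<open>For vectors of squared length 5/2 whose squared coordinates differ by 2, hence 5/2 in
  the exponent and 2 z in cosh. The method is that of \<open>first_shell_increment\<close>, with
  cosh expanded one term further; 157/50 stands for pi from below, and 487/1000 covers u up to y =
  \<open>sqrt 3\<close>.\<close>

lemma third_shell_increment:
  fixes u z :: real
  assumes u: "0 \<le> u" "u \<le> 487 / 1000" and z: "z\<^sup>2 \<ge> 8 * (157 / 50) * u + 4 * u\<^sup>2"
  shows "exp (- (5 / 2 * u)) * cosh z - 1 + 5 / 2 * u \<ge> 4 * (157 / 50) * u - 2 * u\<^sup>2"
proof -
  define w where "w = 8 * (157 / 50) * u + 4 * u\<^sup>2"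
  have w: "0 \<le> w" "w \<le> z\<^sup>2" using u z by (auto simp: w_def)
  define v where "v = 5 / 2 * u"
  define h11 where "h11 = (- 125 / 24192 :: real)"
  define h10 where "h10 = - 1445 / 12096 + u * h11"
  define h9 where "h9 = - 31811 / 30240 + u * h10"
  define h8 where "h8 = - 6482311 / 1512000 + u * h9"
  define h7 where "h7 = - 24682999 / 3150000 + u * h8"
  define h6 where "h6 = - 62519101 / 9450000 + u * h7"
  define h5 where "h5 = - 693025139 / 94500000 + u * h6"
  define h4 where "h4 = 7898005481 / 1890000000 + u * h5"
  define h3 where "h3 = - 2636865529 / 700000000 + u * h4"
  define h2 where "h2 = 38112503081 / 15750000000 + u * h3"
  define h1 where "h1 = - 41581223 / 11250000 + u * h2"
  define h0 where "h0 = 30259 / 15000 + u * h1"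
  have "- 3 / 500 \<le> h11" by (simp add: h11_def)
  then have "- 123 / 1000 \<le> h10" unfolding h10_def by (rule horner_step[OF _ u]) simp_all
  then have "- 139 / 125 \<le> h9" unfolding h9_def by (rule horner_step[OF _ u]) simp_all
  then have "- 4829 / 1000 \<le> h8" unfolding h8_def by (rule horner_step[OF _ u]) simp_all
  then have "- 2547 / 250 \<le> h7" unfolding h7_def by (rule horner_step[OF _ u]) simp_all
  then have "- 5789 / 500 \<le> h6" unfolding h6_def by (rule horner_step[OF _ u]) simp_all
  then have "- 12973 / 1000 \<le> h5" unfolding h5_def by (rule horner_step[OF _ u]) simp_all
  then have "- 107 / 50 \<le> h4" unfolding h4_def by (rule horner_step[OF _ u]) simp_all
  then have "- 481 / 100 \<le> h3" unfolding h3_def by (rule horner_step[OF _ u]) simp_all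
  then have "77 / 1000 \<le> h2" unfolding h2_def by (rule horner_step[OF _ u]) simp_all
  then have "- 3697 / 1000 \<le> h1" unfolding h1_def by (rule horner_step[OF _ u]) simp_all
  then have "0 \<le> h0" unfolding h0_def by (rule horner_step[OF _ u]) simp_all
  have "1 + w / 2 + w\<^sup>2 / 24 + w ^ 3 / 720 + w ^ 4 / 40320 \<le> 1 + z\<^sup>2 / 2 + (z\<^sup>2)\<^sup>2 / 24 + (z\<^sup>2) ^ 3 / 720 + (z\<^sup>2) ^ 4 / 40320"
    using w by (intro add_mono divide_right_mono power_mono) auto
  also have "\<dots> \<le> cosh z" by (rule cosh_ge_Taylor)
  finally have c: "1 + w / 2 + w\<^sup>2 / 24 + w ^ 3 / 720 + w ^ 4 / 40320 \<le> cosh z" .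
  have "(1 - v + v\<^sup>2 / 2 - v ^ 3 / 6 + v ^ 4 / 24 - v ^ 5 / 120) * (1 + w / 2 + w\<^sup>2 / 24 + w ^ 3 / 720 + w ^ 4 / 40320) \<le>
      exp (- v) * (1 + w / 2 + w\<^sup>2 / 24 + w ^ 3 / 720 + w ^ 4 / 40320)"
    using w by (intro mult_right_mono[OF exp_minus_ge_quintic]) simp
  also have "\<dots> \<le> exp (- v) * cosh z" using c by (intro mult_left_mono) auto
  finally have "(1 - v + v\<^sup>2 / 2 - v ^ 3 / 6 + v ^ 4 / 24 - v ^ 5 / 120) * (1 + w / 2 + w\<^sup>2 / 24 + w ^ 3 / 720 + w ^ 4 / 40320) \<le> exp (- v) * cosh z" .
  moreover have "(1 - v + v\<^sup>2 / 2 - v ^ 3 / 6 + v ^ 4 / 24 - v ^ 5 / 120) * (1 + w / 2 + w\<^sup>2 / 24 + w ^ 3 / 720 + w ^ 4 / 40320) =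
      1 - v + 4 * (157 / 50) * u - 2 * u\<^sup>2 + u\<^sup>2 * h0"
    unfolding w_def v_def h0_def h1_def h2_def h3_def h4_def h5_def h6_def h7_def h8_def h9_def h10_def h11_def by (simp add: field_simps eval_nat_numeral)
  moreover have "u\<^sup>2 * h0 \<ge> 0" using \<open>0 \<le> h0\<close> by simp
  ultimately show ?thesis unfolding v_def by linarith
qed

text \<open>With E = 1 + d + S and 1/E = 1 + d - S the deformed form is N (1 + d) + D S. Averaging
  over the swap of coordinates turns the odd part into cosh \<ge> 1, so a general vector loses at
  most pi N d times its weight, and these losses add up to a first moment. Vectors in
  \<open>P\<close> are kept exactly.\<close>

lemma theta_product_increment:
  fixes \<Theta> :: "real \<Rightarrow> real" and E a M :: real
  defines "d \<equiv> (E - 1)\<^sup>2 / (2 * E)" and "S \<equiv> (E - 1 / E) / 2"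
  defines "N \<equiv> \<lambda>(m, n). (real_of_int m + a)\<^sup>2 + (real_of_int n + a)\<^sup>2"
    and "D \<equiv> \<lambda>(m, n). (real_of_int m + a)\<^sup>2 - (real_of_int n + a)\<^sup>2"
  assumes E: "E > 0"
    and \<Theta>: "\<And>s. s > 0 \<Longrightarrow> ((\<lambda>n::int. exp (- (pi * s * (of_int n + a)\<^sup>2))) has_sum \<Theta> s) UNIV"
    and M: "((\<lambda>n::int. pi * (of_int n + a)\<^sup>2 * exp (- (pi * (of_int n + a)\<^sup>2))) has_sum M) UNIV"
    and P: "finite P"
  shows "2 * (\<Theta> E * \<Theta> (1 / E) - \<Theta> 1 * \<Theta> 1) \<ge>
    (\<Sum>p\<in>P. 2 * exp (- (pi * N p)) * (exp (- (pi * N p * d)) * cosh (pi * D p * S) - 1 + pi * N p * d)) - 4 * d * (\<Theta> 1 * M)"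
proof -
  define e where "e E = (\<lambda>(m, n). exp (- (pi * E * (real_of_int m + a)\<^sup>2)) * exp (- (pi * (1 / E) * (real_of_int n + a)\<^sup>2)))" for E
  have e: "(e E has_sum \<Theta> E * \<Theta> (1 / E)) UNIV" if "E > 0" for E
    using has_sum_mult_Times[OF \<Theta>[of E] \<Theta>[of "1 / E"]] that by (simp add: e_def)
  have swap: "((\<lambda>p. f (snd p, fst p)) has_sum c) UNIV" if "(f has_sum c) UNIV" for f :: "int \<times> int \<Rightarrow> real" and c
  proof -
    have "bij (\<lambda>p :: int \<times> int. (snd p, fst p))"
      by (rule bij_betwI[where g = "\<lambda>p. (snd p, fst p)"]) auto
    from has_sum_reindex_bij_betw[OF this, of f c] that show ?thesis by simp
  qed
  have W: "((\<lambda>p. e E p + e E (snd p, fst p) - 2 * e 1 p) has_sum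
      (\<Theta> E * \<Theta> (1 / E) + \<Theta> E * \<Theta> (1 / E) - 2 * (\<Theta> 1 * \<Theta> (1 / 1)))) UNIV"
    by (intro has_sum_diff has_sum_add has_sum_cmult_right swap e E zero_less_one)
  have sum_N: "((\<lambda>p. pi * N p * exp (- (pi * N p))) has_sum (M * \<Theta> 1 + \<Theta> 1 * M)) UNIV"
  proof -
    let ?F = "\<lambda>(m, n). (pi * (real_of_int m + a)\<^sup>2 * exp (- (pi * (real_of_int m + a)\<^sup>2))) * exp (- (pi * 1 * (real_of_int n + a)\<^sup>2))"
    let ?G = "\<lambda>(m, n). exp (- (pi * 1 * (real_of_int m + a)\<^sup>2)) * (pi * (real_of_int n + a)\<^sup>2 * exp (- (pi * (real_of_int n + a)\<^sup>2)))"
    have "(?F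
        has_sum (M * \<Theta> 1)) (UNIV \<times> UNIV)"
      by (intro has_sum_mult_Times M \<Theta>) auto
    moreover have "(?G
        has_sum (\<Theta> 1 * M)) (UNIV \<times> UNIV)"
      by (intro has_sum_mult_Times M \<Theta>) auto
    ultimately have sum: "((\<lambda>p. ?F p +
        ?G p)
        has_sum (M * \<Theta> 1 + \<Theta> 1 * M)) UNIV"
      unfolding UNIV_Times_UNIV by (rule has_sum_add)
    have eq: "?F p +
        ?G p =
        pi * N p * exp (- (pi * N p))" for p
      by (cases p) (simp add: N_def algebra_simps flip: exp_add)
    show ?thesis using sum unfolding eq .
  qed
  \<comment> \<open>The summand \<open>pi * N p * d\<close> returns to the vectors of
    \<open>P\<close> the linear loss that the moment term charges to every vector.\<close>
  define X where "X p = 2 * exp (- (pi * N p)) * (exp (- (pi * N p * d)) * cosh (pi * D p * S) - 1 + pi * N p * d)" for p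
  have "((\<lambda>p. if p \<in> P then X p else 0) has_sum (\<Sum>p\<in>P. X p)) UNIV"
    by (rule has_sum_finite_neutralI[where B = P]) (use P in auto)
  then have L: "((\<lambda>p. (if p \<in> P then X p else 0) - 2 * d * (pi * N p * exp (- (pi * N p)))) has_sum
      ((\<Sum>p\<in>P. X p) - 2 * d * (M * \<Theta> 1 + \<Theta> 1 * M))) UNIV"
    by (intro has_sum_diff has_sum_cmult_right sum_N)
  have low: "(if p \<in> P then X p else 0) - 2 * d * (pi * N p * exp (- (pi * N p))) \<le> e E p + e E (snd p, fst p) - 2 * e 1 p" for p
  proof -
    obtain m n where p: "p = (m, n)" by (cases p)
    have E2: "E = 1 + d + S" "1 / E = 1 + d - S"
      using E by (simp_all add: d_def S_def power2_eq_square field_simps)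
    have W: "e E p + e E (snd p, fst p) - 2 * e 1 p = 2 * exp (- (pi * N p)) * (exp (- (pi * N p * d)) * cosh (pi * D p * S) - 1)"
    proof -
      have "e E p = exp (- (pi * N p)) * (exp (- (pi * N p * d)) * exp (- (pi * D p * S)))"
        unfolding e_def p prod.case E2(2)
        by (subst E2(1)) (simp add: N_def D_def algebra_simps flip: exp_add)
      moreover have "e E (snd p, fst p) = exp (- (pi * N p)) * (exp (- (pi * N p * d)) * exp (pi * D p * S))"
        unfolding e_def p prod.case fst_conv snd_conv E2(2)
        by (subst E2(1)) (simp add: N_def D_def algebra_simps flip: exp_add)
      moreover have "e 1 p = exp (- (pi * N p))"
        by (simp add: e_def p N_def algebra_simps flip: exp_add)
      ultimately show ?thesis by (simp add: cosh_field_def algebra_simps)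
    qed
    have "1 - pi * N p * d \<le> exp (- (pi * N p * d)) * cosh (pi * D p * S)"
    proof -
      have "exp (- (pi * N p * d)) * 1 \<le> exp (- (pi * N p * d)) * cosh (pi * D p * S)"
        using cosh_real_ge_1[of "pi * D p * S"] by (intro mult_left_mono) auto
      then show ?thesis using exp_ge_add_one_self[of "- (pi * N p * d)"] by linarith
    qed
    then have "2 * exp (- (pi * N p)) * (- (pi * N p * d)) \<le> 2 * exp (- (pi * N p)) * (exp (- (pi * N p * d)) * cosh (pi * D p * S) - 1)"
      by (intro mult_left_mono) auto
    then show ?thesis unfolding W by (simp add: X_def algebra_simps)
  qed
  from has_sum_mono[OF L W low] show ?thesis
    by (simp add: X_def algebra_simps)
qed

text \<open>The values and moments at argument 1 are estimated through powers of this number, so its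
  accuracy limits that of all later constants.\<close>

lemma exp_minus_pi_quarter:
  "455937 / 1000000 \<le> exp (- (pi / 4))" "exp (- (pi / 4)) \<le> 455939 / 1000000"
proof -
  have "exp (- (785399 / 1000000)) \<le> exp (- (pi / 4))" "exp (- (pi / 4)) \<le> exp (- (785398 / 1000000 :: real))"
    using pi_approx by simp_all
  moreover have "\<bar>exp (- (785399 / 1000000 :: real)) - (\<Sum>m<10. (- (785399 / 1000000)) ^ m / fact m)\<bar> \<le> 3 * \<bar>- (785399 / 1000000)\<bar> ^ 10 / fact 10"
    by (rule exp_Taylor_bound) simp
  from abs_le_D2[OF this] have "455937 / 1000000 \<le> exp (- (785399 / 1000000 :: real))"
    by (simp add: eval_nat_numeral lessThan_Suc)
  moreover have "\<bar>exp (- (785398 / 1000000 :: real)) - (\<Sum>m<10. (- (785398 / 1000000)) ^ m / fact m)\<bar> \<le> 3 * \<bar>- (785398 / 1000000)\<bar> ^ 10 / fact 10"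
    by (rule exp_Taylor_bound) simp
  from abs_le_D1[OF this] have "exp (- (785398 / 1000000 :: real)) \<le> 455939 / 1000000"
    by (simp add: eval_nat_numeral lessThan_Suc)
  ultimately show "455937 / 1000000 \<le> exp (- (pi / 4))" "exp (- (pi / 4)) \<le> 455939 / 1000000"
    by linarith+
qed

text \<open>The form with \<open>+ 0\<close> is kept so that both statements match the assumption
  \<open>M\<close> of \<open>theta_product_increment\<close>.\<close>

lemma has_sum_moment_int:
  "((\<lambda>n::int. pi * (of_int n + 0)\<^sup>2 * exp (- (pi * (of_int n + 0)\<^sup>2))) has_sum (2 * gauss_sum 1 1 1)) UNIV"
  "((\<lambda>n::int. pi * (of_int n + 1/2)\<^sup>2 * exp (- (pi * (of_int n + 1/2)\<^sup>2))) has_sum (2 * gauss_sum 1 (1/2) 1)) UNIV"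
proof -
  let ?m = "\<lambda>a (n::int). pi * (of_int n + a)\<^sup>2 * exp (- (pi * (of_int n + a)\<^sup>2))"
  have "gauss_sum 1 0 1 = gauss_sum 1 1 1" using gauss_sum_split[of 1 0 1] by simp
  then have 0: "((\<lambda>n. pi * (real n)\<^sup>2 * exp (- (pi * (real n)\<^sup>2))) has_sum gauss_sum 1 1 1) UNIV"
    using has_sum_gauss_sum[of 1 0 1] by simp
  have 1: "((\<lambda>n. pi * (real n + 1)\<^sup>2 * exp (- (pi * (real n + 1)\<^sup>2))) has_sum gauss_sum 1 1 1) UNIV"
    using has_sum_gauss_sum[of 1 1 1] by simp
  have 2: "((\<lambda>n. pi * (real n + 1/2)\<^sup>2 * exp (- (pi * (real n + 1/2)\<^sup>2))) has_sum gauss_sum 1 (1/2) 1) UNIV"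
    using has_sum_gauss_sum[of 1 "1/2" 1] by simp
  have sq: "(real_of_int (- 1 - int n))\<^sup>2 = (real n + 1)\<^sup>2" "(real_of_int (- 1 - int n) + 1/2)\<^sup>2 = (real n + 1/2)\<^sup>2" for n
    by (simp_all add: power2_eq_square algebra_simps)
  have "(?m 0 has_sum (gauss_sum 1 1 1 + gauss_sum 1 1 1)) UNIV"
    by (rule has_sum_int_split) (use 0 1 in \<open>simp_all only: sq of_int_of_nat_eq add_0_right\<close>)
  then show "(?m 0 has_sum (2 * gauss_sum 1 1 1)) UNIV"
    by simp
  have "(?m (1/2) has_sum (gauss_sum 1 (1/2) 1 + gauss_sum 1 (1/2) 1)) UNIV"
    by (rule has_sum_int_split) (use 2 in \<open>simp_all only: sq of_int_of_nat_eq\<close>)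
  then show "(?m (1/2) has_sum (2 * gauss_sum 1 (1/2) 1)) UNIV"
    by simp
qed

lemma half_le: "x / 2 \<le> y" if "x \<le> 2 * y" for x y :: real
  using that by simp

text \<open>\<open>P\<close> holds the four vectors of length 1. The moment needs no series:
  \<open>theta3_slope_inverse\<close> at 1 gives it exactly as \<open>theta3 1 / 4\<close>.\<close>

lemma theta3_prod_increment:
  fixes y :: real
  defines "u \<equiv> pi * ((y - 1)\<^sup>2 / (2 * y))" and "z \<equiv> pi * ((y - 1 / y) / 2)"
  assumes y: "y > 0"
  shows "theta3 y * theta3 (1 / y) - theta3 1 * theta3 1 \<ge>
    4 * exp (- pi) * (exp (- u) * cosh z - 1 + u) - u / (2 * pi) * (theta3 1)\<^sup>2"
proof -
  define P where "P = {(1, 0), (-1, 0), (0, 1), (0, -1) :: int \<times> int}"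
  let ?N = "\<lambda>(m, n). (real_of_int m + 0)\<^sup>2 + (real_of_int n + 0)\<^sup>2"
  let ?D = "\<lambda>(m, n). (real_of_int m + 0)\<^sup>2 - (real_of_int n + 0)\<^sup>2"
  have "2 * (theta3 y * theta3 (1 / y) - theta3 1 * theta3 1) \<ge>
    (\<Sum>p\<in>P. 2 * exp (- (pi * ?N p)) *
      (exp (- (pi * ?N p * ((y - 1)\<^sup>2 / (2 * y)))) *
        cosh (pi * ?D p * ((y - 1 / y) / 2)) - 1 +
        pi * ?N p * ((y - 1)\<^sup>2 / (2 * y)))) -
      4 * ((y - 1)\<^sup>2 / (2 * y)) * (theta3 1 * (2 * gauss_sum 1 1 1))"
    by (rule theta_product_increment[OF y _ has_sum_moment_int(1)]) (use has_sum_theta3 in \<open>auto simp: P_def\<close>)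
  moreover have "2 * gauss_sum 1 1 1 = theta3 1 / 4"
    using theta3_slope_inverse[of 1] theta3_gt_1[of 1] by (simp add: theta3_slope_def field_simps)
  moreover have "(y - 1)\<^sup>2 / (2 * y) = u / pi" "(y - 1 / y) / 2 = z / pi" by (simp_all add: u_def z_def)
  ultimately have "2 * (theta3 y * theta3 (1 / y) - theta3 1 * theta3 1) \<ge>
      4 * (2 * exp (- pi) * (exp (- u) * cosh z - 1 + u)) - 4 * (u / pi) * (theta3 1 * (theta3 1 / 4))"
    by (simp only:) (simp add: P_def)
  then have "theta3 y * theta3 (1 / y) - theta3 1 * theta3 1 \<ge>
      (4 * (2 * exp (- pi) * (exp (- u) * cosh z - 1 + u)) - 4 * (u / pi) * (theta3 1 * (theta3 1 / 4))) / 2"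
    by (rule half_le)
  also have "(4 * (2 * exp (- pi) * (exp (- u) * cosh z - 1 + u)) - 4 * (u / pi) * (theta3 1 * (theta3 1 / 4))) / 2 =
      4 * exp (- pi) * (exp (- u) * cosh z - 1 + u) - u / (2 * pi) * (theta3 1)\<^sup>2"
    by (simp add: power2_eq_square diff_divide_distrib)
  finally show ?thesis .
qed

text \<open>\<open>P\<close> holds the four half-integer vectors of squared length 1/2, whose
  coordinates have equal squares so that cosh is 1, and the eight of squared length 5/2. Without the
  latter the linear coefficient in \<open>theta_combination_min_1\<close> would be negative.\<close>

lemma theta2_prod_increment:
  fixes y :: real
  defines "u \<equiv> pi * ((y - 1)\<^sup>2 / (2 * y))" and "z \<equiv> pi * ((y - 1 / y) / 2)"
  assumes y: "y > 0"
  shows "theta2 y * theta2 (1 / y) - theta2 1 * theta2 1 \<ge>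
    4 * exp (- (pi / 2)) * (exp (- (u / 2)) - 1 + u / 2) +
    8 * exp (- (5 / 2 * pi)) * (exp (- (5 / 2 * u)) * cosh (2 * z) - 1 + 5 / 2 * u) -
    2 * u / pi * (theta2 1 * (2 * gauss_sum 1 (1/2) 1))"
proof -
  define P where "P = {(0, 0), (0, -1), (-1, 0), (-1, -1), (1, 0), (1, -1), (-2, 0), (-2, -1), (0, 1), (-1, 1), (0, -2), (-1, -2) :: int \<times> int}"
  let ?N = "\<lambda>(m, n). (real_of_int m + 1/2)\<^sup>2 + (real_of_int n + 1/2)\<^sup>2"
  let ?D = "\<lambda>(m, n). (real_of_int m + 1/2)\<^sup>2 - (real_of_int n + 1/2)\<^sup>2"
  have "2 * (theta2 y * theta2 (1 / y) - theta2 1 * theta2 1) \<ge>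
    (\<Sum>p\<in>P. 2 * exp (- (pi * ?N p)) *
      (exp (- (pi * ?N p * ((y - 1)\<^sup>2 / (2 * y)))) *
        cosh (pi * ?D p * ((y - 1 / y) / 2)) - 1 +
        pi * ?N p * ((y - 1)\<^sup>2 / (2 * y)))) -
      4 * ((y - 1)\<^sup>2 / (2 * y)) * (theta2 1 * (2 * gauss_sum 1 (1/2) 1))"
    by (rule theta_product_increment[OF y _ has_sum_moment_int(2)]) (use has_sum_theta2 in \<open>auto simp: P_def\<close>)
  moreover have "(y - 1)\<^sup>2 / (2 * y) = u / pi" "(y - 1 / y) / 2 = z / pi" by (simp_all add: u_def z_def)
  ultimately have "2 * (theta2 y * theta2 (1 / y) - theta2 1 * theta2 1) \<ge>
    4 * (2 * exp (- (pi / 2)) * (exp (- (u / 2)) - 1 + u / 2)) +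
    8 * (2 * exp (- (5 / 2 * pi)) * (exp (- (5 / 2 * u)) * cosh (2 * z) - 1 + 5 / 2 * u)) -
    4 * (u / pi) * (theta2 1 * (2 * gauss_sum 1 (1/2) 1))"
    by (simp only:) (simp add: P_def power2_eq_square mult_ac)
  from half_le[OF this] show ?thesis
    by (simp add: add_divide_distrib diff_divide_distrib)
qed

lemma theta2_theta3_ratio:
  assumes "t \<ge> 9 / 10"
  shows "theta2 (t\<^sup>2) \<le> 921 / 1000 * theta3 (t\<^sup>2)"
proof -
  define s where "s = t\<^sup>2"
  have s: "s \<ge> 81 / 100" using power_mono[OF assms, of 2] by (simp add: s_def power2_eq_square)
  define q where "q = exp (- (pi * s / 4))"
  have q0: "q > 0" by (simp add: q_def)
  have q1: "q \<le> 5294 / 10000"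
  proof -
    have "636171 / 1000000 \<le> pi * s / 4"
    proof -
      have "314159 / 100000 * (81 / 100) \<le> pi * s" using s pi_approx by (intro mult_mono) auto
      then show ?thesis by simp
    qed
    then have "exp (636171 / 1000000) \<le> exp (pi * s / 4)" by simp
    moreover have "(10000 / 5294 :: real) \<le> exp (636171 / 1000000)"
      by (rule order_trans[OF _ exp_ge_Taylor[of _ 8]]) (simp_all add: eval_nat_numeral lessThan_Suc)
    ultimately have "10000 / 5294 \<le> exp (pi * s / 4)" by linarith
    then show ?thesis using le_imp_inverse_le[of "10000 / 5294" "exp (pi * s / 4)"] by (simp add: q_def exp_minus)
  qed
  have q_power: "q ^ k = exp (- (real k * pi * s / 4))" for k
    unfolding q_def exp_of_nat_mult[symmetric] by (simp add: algebra_simps)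
  have "q ^ 12 \<le> (5294 / 10000) ^ 12" using q0 q1 by (intro power_mono) auto
  then have q12: "q ^ 12 \<le> 1 / 2000" by (rule order_trans) (simp add: eval_nat_numeral)
  have q9: "q ^ 9 \<le> (5294 / 10000) ^ 9" using q0 q1 by (intro power_mono) auto
  have "gauss_sum 0 (3/2) s \<le> exp (- (pi * (3/2)\<^sup>2 * s)) / (1 - exp (- (2 * pi * (3/2) * s)))"
    using s by (intro gauss_sum_0_le) auto
  also have "\<dots> = q ^ 9 / (1 - q ^ 12)" by (simp add: q_power power2_eq_square mult_ac)
  also have "\<dots> \<le> (5294 / 10000) ^ 9 / (1 - 1 / 2000)" using q0 q9 q12 by (intro frac_le) auto
  also have "\<dots> \<le> 32680 / 10000000" by (simp add: eval_nat_numeral)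
  finally have g: "gauss_sum 0 (3/2) s \<le> 32680 / 10000000" .
  have "theta2 s = 2 * (q + gauss_sum 0 (3/2) s)"
    unfolding theta2_def using gauss_sum_split[of s "1/2" 0] s by (simp add: q_def power2_eq_square)
  moreover have "theta3 s \<ge> 1 + 2 * q ^ 4"
    unfolding theta3_def using gauss_sum_split[of s 1 0] gauss_sum_pos[of s 2 0] s by (simp add: q_power)
  \<comment> \<open>The tangent of q^4 at 0.5294, the bound for q at t = 0.9, with rounded
    coefficients; the slope is rounded up since q lies to the left.\<close>
  moreover have "785 / 10000 + 594 / 1000 * (q - 5294 / 10000) \<le> q ^ 4"
  proof -
    have "785 / 10000 + 594 / 1000 * (q - 5294 / 10000) \<le> (5294 / 10000) ^ 4 + 4 * (5294 / 10000) ^ 3 * (q - 5294 / 10000)"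
      using q1 by (intro add_mono mult_right_mono_neg) (auto simp: eval_nat_numeral)
    also have "\<dots> \<le> q ^ 4"
    proof -
      have "0 \<le> (q - 5294 / 10000)\<^sup>2 * (q\<^sup>2 + 2 * q * (5294 / 10000) + 3 * (5294 / 10000)\<^sup>2)"
        using q0 by (intro mult_nonneg_nonneg add_nonneg_nonneg) auto
      then show ?thesis by (simp add: eval_nat_numeral field_simps)
    qed
    finally show ?thesis .
  qed
  ultimately show ?thesis
    using g q1 unfolding s_def[symmetric] right_diff_distrib distrib_left by linarith
qed

lemma theta_1_bounds:
  "theta3 1 \<le> 1086444 / 1000000" "theta2 1 \<le> 91359 / 100000" "2 * gauss_sum 1 (1/2) 1 \<le> 72827 / 100000"
proof -
  define e where "e = exp (- (pi / 4))"
  have e: "0 \<le> e" "e \<le> 455939 / 1000000" using exp_minus_pi_quarter by (auto simp: e_def)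
  have e_power: "e ^ k = exp (- (real k * pi / 4))" for k
    unfolding e_def exp_of_nat_mult[symmetric] by (simp add: algebra_simps)
  have pw: "e ^ k \<le> (455939 / 1000000) ^ k" for k using e by (intro power_mono)
  have e4: "e ^ 4 \<le> 432146 / 10000000" by (rule order_trans[OF pw]) (simp add: eval_nat_numeral)
  have e9: "e ^ 9 \<le> 85147 / 100000000" by (rule order_trans[OF pw]) (simp add: eval_nat_numeral)
  have e16: "e ^ 16 \<le> 35 / 10000000" by (rule order_trans[OF pw]) (simp add: eval_nat_numeral)
  have e20: "e ^ 20 \<le> 16 / 100000000" by (rule order_trans[OF pw]) (simp add: eval_nat_numeral)
  have "e ^ 21 \<le> 455939 / 1000000 * (16 / 100000000)"
    using mult_mono[OF e(2) e20] e by (simp flip: power_Suc)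
  then have e21: "e ^ 21 \<le> 73 / 1000000000" by simp
  have "gauss_sum 0 2 1 \<le> 2 * e ^ 16"
    using gauss_sum_0_le_double[of 1 2] pi_ge_two by (simp add: e_power mult.commute)
  then show "theta3 1 \<le> 1086444 / 1000000"
    unfolding theta3_def using gauss_sum_split[of 1 1 0] e4 e16 by (simp add: e_power)
  have "gauss_sum 0 (5/2) 1 \<le> 2 * exp (- (pi * (5/2)\<^sup>2 * 1))"
    using pi_ge_two by (intro gauss_sum_0_le_double) auto
  also have "\<dots> \<le> 2 * e ^ 21" by (simp add: e_power power2_eq_square)
  finally have "gauss_sum 0 (5/2) 1 \<le> 2 * e ^ 21" .
  moreover have "gauss_sum 0 (1/2) 1 = e + (e ^ 9 + gauss_sum 0 (5/2) 1)"
    using gauss_sum_split[of 1 "1/2" 0] gauss_sum_split[of 1 "3/2" 0] by (simp add: e_def[symmetric] e_power power2_eq_square)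
  ultimately show "theta2 1 \<le> 91359 / 100000"
    unfolding theta2_def using e e9 e21 by linarith
  \<comment> \<open>The first moment of the tail is passed to the second one, to which
    \<open>gauss_sum_2_le\<close> applies.\<close>
  have "1 * gauss_sum 1 (5/2) 1 \<le> pi * gauss_sum 1 (5/2) 1"
    using pi_ge_two gauss_sum_pos[of 1 "5/2" 1] by (intro mult_right_mono) auto
  also have "\<dots> \<le> gauss_sum 2 (5/2) 1" by (rule gauss_sum_2_ge) auto
  also have "\<dots> \<le> 128 * gauss_sum 0 (5/2) (7 / 8)" using gauss_sum_2_le[of 1 "5/2"] by simp
  also have "\<dots> \<le> 128 * (2 * exp (- (pi * (5/2)\<^sup>2 * (7 / 8))))"
    using pi_ge_two by (intro mult_left_mono gauss_sum_0_le_double) auto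
  also have "\<dots> \<le> 128 * (2 * e ^ 21)" by (simp add: e_power power2_eq_square)
  finally have "gauss_sum 1 (5/2) 1 \<le> 128 * (2 * e ^ 21)" by simp
  moreover have "gauss_sum 1 (1/2) 1 = pi / 4 * e + (9 * pi / 4 * e ^ 9 + gauss_sum 1 (5/2) 1)"
    using gauss_sum_split[of 1 "1/2" 1] gauss_sum_split[of 1 "3/2" 1] by (simp add: e_def[symmetric] e_power power2_eq_square)
  moreover have "pi / 4 * e \<le> 785399 / 1000000 * (455939 / 1000000)" using e pi_approx by (intro mult_mono) auto
  moreover have "9 * pi / 4 * e ^ 9 \<le> 70686 / 10000 * (85147 / 100000000)" using e e9 pi_approx by (intro mult_mono) auto
  ultimately show "2 * gauss_sum 1 (1/2) 1 \<le> 72827 / 100000"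
    using e21 by simp
qed

text \<open>In u = pi d, where z^2 = 2 pi u + u^2, all kept terms have polynomial lower bounds, and
  the difference is at least u c1 + u^2 (c2 + u c3).\<close>

lemma theta_combination_min_1:
  assumes y: "1 < y" "y \<le> sqrt 3"
  shows "theta3 1 * theta3 1 + 921 / 1000 * (theta2 1 * theta2 1) < theta3 y * theta3 (1 / y) + 921 / 1000 * (theta2 y * theta2 (1 / y))"
proof -
  define d where "d = (y - 1)\<^sup>2 / (2 * y)"
  define u z where "u = pi * d" and "z = pi * ((y - 1 / y) / 2)"
  have d0: "d > 0" using y by (simp add: d_def)
  have d1: "d \<le> 155 / 1000"
  proof -
    have "sqrt 3 \<le> 17321 / 10000" by (rule real_le_lsqrt) (auto simp: power2_eq_square)
    then have y3: "y \<le> 17321 / 10000" using y by linarith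
    \<comment> \<open>This is the chord of y^2 over the interval, which makes the bound for d linear
      in y.\<close>
    have "0 \<le> (y - 1) * (17321 / 10000 - y)" using y y3 by (intro mult_nonneg_nonneg) auto
    also have "\<dots> = 27321 / 10000 * y - y\<^sup>2 - 17321 / 10000" by (simp add: field_simps power2_eq_square)
    finally have "y\<^sup>2 \<le> 27321 / 10000 * y - 17321 / 10000" by simp
    moreover have "(y - 1)\<^sup>2 = y\<^sup>2 - 2 * y + 1" by (simp add: power2_eq_square algebra_simps)
    ultimately have "(y - 1)\<^sup>2 \<le> 155 / 1000 * (2 * y)" using y3 by linarith
    then show ?thesis using y by (simp add: d_def pos_divide_le_eq)
  qed
  have u: "0 \<le> u" "u \<le> 487 / 1000" "u > 0"
  proof -
    have "pi * d \<le> 31416 / 10000 * (155 / 1000)" using d0 d1 pi_approx by (intro mult_mono) auto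
    then show "u \<le> 487 / 1000" by (simp add: u_def)
  qed (use d0 in \<open>auto simp: u_def\<close>)
  have "((y - 1 / y) / 2)\<^sup>2 = d * (2 + d)"
    using y by (simp add: d_def power2_eq_square field_simps)
  then have "z\<^sup>2 = pi\<^sup>2 * (d * (2 + d))"
    by (simp only: z_def power_mult_distrib)
  also have "\<dots> = 2 * pi * u + u\<^sup>2" by (simp add: u_def power2_eq_square algebra_simps)
  finally have "z\<^sup>2 = 2 * pi * u + u\<^sup>2" .
  moreover have "157 / 50 * u \<le> pi * u" using pi_approx u by (intro mult_right_mono) auto
  ultimately have z: "z\<^sup>2 \<ge> 2 * (157 / 50) * u + u\<^sup>2" by simp
  then have z2: "(2 * z)\<^sup>2 \<ge> 8 * (157 / 50) * u + 4 * u\<^sup>2" by (simp add: power_mult_distrib)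
  define E where "E = exp (- (pi / 2))"
  have E4: "E = exp (- (pi / 4)) * exp (- (pi / 4))" by (simp add: E_def flip: exp_add)
  have E: "207878 / 1000000 \<le> E" "E \<le> 207881 / 1000000"
  proof -
    have "455937 / 1000000 * (455937 / 1000000) \<le> E" unfolding E4 using exp_minus_pi_quarter by (intro mult_mono) auto
    then show "207878 / 1000000 \<le> E" by simp
    have "E \<le> 455939 / 1000000 * (455939 / 1000000)" unfolding E4 using exp_minus_pi_quarter by (intro mult_mono) auto
    then show "E \<le> 207881 / 1000000" by simp
  qed
  have E_power: "exp (- pi) = E\<^sup>2" "exp (- (5 / 2 * pi)) = E ^ 5"
    unfolding E_def exp_of_nat_mult[symmetric] by simp_all
  have E2: "432132 / 10000000 \<le> E\<^sup>2" "E\<^sup>2 \<le> 432146 / 10000000"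
    using power_mono[OF E(1), of 2] power_mono[OF E(2), of 2] E by (simp_all add: power2_eq_square)
  have E5: "3881 / 10000000 \<le> E ^ 5" "E ^ 5 \<le> 3883 / 10000000"
    using power_mono[OF E(1), of 5] power_mono[OF E(2), of 5] E by (simp_all add: eval_nat_numeral)
  define b1 b2 b3 where "b1 = exp (- u) * cosh z - 1 + u" and "b2 = exp (- (u / 2)) - 1 + u / 2"
    and "b3 = exp (- (5 / 2 * u)) * cosh (2 * z) - 1 + 5 / 2 * u"
  have b1: "b1 \<ge> 157 / 50 * u - 498 / 1000 * u\<^sup>2 + 8 / 100 * u ^ 3"
    unfolding b1_def by (rule first_shell_increment[OF u(1,2) z])
  have b2: "b2 \<ge> u\<^sup>2 / 8 - u ^ 3 / 48"
    unfolding b2_def using exp_minus_ge_cubic[of "u / 2"] by (simp add: power_divide)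
  have b3: "b3 \<ge> 4 * (157 / 50) * u - 2 * u\<^sup>2"
    unfolding b3_def by (rule third_shell_increment[OF u(1,2) z2])
  have f: "theta3 y * theta3 (1 / y) - theta3 1 * theta3 1 \<ge> 4 * E\<^sup>2 * b1 - u * (18787 / 100000)"
  proof -
    have "(theta3 1)\<^sup>2 \<le> (1086444 / 1000000)\<^sup>2" using theta_1_bounds theta3_gt_1[of 1] by (intro power_mono) auto
    then have "(theta3 1)\<^sup>2 / (2 * pi) \<le> (1086444 / 1000000)\<^sup>2 / (2 * (314159 / 100000))"
      using pi_approx by (intro frac_le) auto
    also have "\<dots> \<le> 18787 / 100000" by (simp add: power2_eq_square)
    finally have "u * ((theta3 1)\<^sup>2 / (2 * pi)) \<le> u * (18787 / 100000)" using u by (intro mult_left_mono) auto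
    moreover have "u / (2 * pi) * (theta3 1)\<^sup>2 = u * ((theta3 1)\<^sup>2 / (2 * pi))" by simp
    ultimately show ?thesis
      using theta3_prod_increment[of y] y unfolding d_def[symmetric] u_def[symmetric] z_def[symmetric] b1_def[symmetric] E_power
      by linarith
  qed
  have g: "theta2 y * theta2 (1 / y) - theta2 1 * theta2 1 \<ge> 4 * E * b2 + 8 * E ^ 5 * b3 - u * (42358 / 100000)"
  proof -
    have "theta2 1 * (2 * gauss_sum 1 (1/2) 1) \<le> 91359 / 100000 * (72827 / 100000)"
      using theta_1_bounds theta2_pos[of 1] gauss_sum_pos[of 1 "1/2" 1] by (intro mult_mono) auto
    then have "2 * (theta2 1 * (2 * gauss_sum 1 (1/2) 1)) / pi \<le> 2 * (91359 / 100000 * (72827 / 100000)) / (314159 / 100000)"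
      using pi_approx by (intro frac_le) auto
    also have "\<dots> \<le> 42358 / 100000" by simp
    finally have "u * (2 * (theta2 1 * (2 * gauss_sum 1 (1/2) 1)) / pi) \<le> u * (42358 / 100000)" using u by (intro mult_left_mono) auto
    moreover have "2 * u / pi * (theta2 1 * (2 * gauss_sum 1 (1/2) 1)) = u * (2 * (theta2 1 * (2 * gauss_sum 1 (1/2) 1)) / pi)"
      by simp
    ultimately show ?thesis
      using theta2_prod_increment[of y] y
      unfolding d_def[symmetric] u_def[symmetric] z_def[symmetric] b2_def[symmetric] b3_def[symmetric] E_power E_def[symmetric]
      by linarith
  qed
  have "4 * E\<^sup>2 * b1 \<ge> 4 * E\<^sup>2 * (157 / 50 * u - 498 / 1000 * u\<^sup>2 + 8 / 100 * u ^ 3)" using b1 by (intro mult_left_mono) auto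
  moreover have "4 * E * b2 \<ge> 4 * E * (u\<^sup>2 / 8 - u ^ 3 / 48)" using b2 E by (intro mult_left_mono) auto
  moreover have "8 * E ^ 5 * b3 \<ge> 8 * E ^ 5 * (4 * (157 / 50) * u - 2 * u\<^sup>2)" using b3 E5 E by (intro mult_left_mono) auto
  ultimately have low: "(theta3 y * theta3 (1 / y) - theta3 1 * theta3 1) + 921 / 1000 * (theta2 y * theta2 (1 / y) - theta2 1 * theta2 1) \<ge>
      4 * E\<^sup>2 * (157 / 50 * u - 498 / 1000 * u\<^sup>2 + 8 / 100 * u ^ 3) - u * (18787 / 100000) +
      921 / 1000 * (4 * E * (u\<^sup>2 / 8 - u ^ 3 / 48) + 8 * E ^ 5 * (4 * (157 / 50) * u - 2 * u\<^sup>2) - u * (42358 / 100000))"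
    using f g by argo
  \<comment> \<open>\<open>c1\<close> is positive by less than 1/1000; the precision of E, of the
    values at 1 and of the weight 921/1000 is dictated by it.\<close>
  define c1 c2 c3 where "c1 = 4 * (157 / 50) * E\<^sup>2 - 18787 / 100000 + 921 / 1000 * (32 * (157 / 50) * E ^ 5 - 42358 / 100000)"
    and "c2 = 921 / 1000 * (E / 2 - 16 * E ^ 5) - 1992 / 1000 * E\<^sup>2" and "c3 = 32 / 100 * E\<^sup>2 - 921 / 12000 * E"
  have c: "c1 > 0" "c2 \<ge> 39 / 10000" "c3 \<ge> - (22 / 10000)"
    using E E2 E5 unfolding c1_def c2_def c3_def right_diff_distrib by linarith+
  have eq: "4 * E\<^sup>2 * (157 / 50 * u - 498 / 1000 * u\<^sup>2 + 8 / 100 * u ^ 3) - u * (18787 / 100000) +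
      921 / 1000 * (4 * E * (u\<^sup>2 / 8 - u ^ 3 / 48) + 8 * E ^ 5 * (4 * (157 / 50) * u - 2 * u\<^sup>2) - u * (42358 / 100000)) =
      u * c1 + u\<^sup>2 * (c2 + u * c3)"
    by (simp add: c1_def c2_def c3_def field_simps power2_eq_square power3_eq_cube)
  have "u * c1 > 0" using u c by simp
  moreover have "u * c3 \<ge> u * - (22 / 10000)" using u c by (intro mult_left_mono) auto
  then have "c2 + u * c3 \<ge> 0" using c u by linarith
  then have "u\<^sup>2 * (c2 + u * c3) \<ge> 0" by (intro mult_nonneg_nonneg) auto
  ultimately show ?thesis using low[unfolded eq, unfolded right_diff_distrib] by linarith
qed

text \<open>If the \<open>theta2\<close> product does not decrease, growth of the
  \<open>theta3\<close> product decides; if it decreases, replacing its weight by the largest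
  admissible one, 921/1000 times the other, is the worst case.\<close>

lemma lattice_theta_bco_1_less:
  assumes t: "t \<ge> 9 / 10" and y: "1 < y" "y \<le> sqrt 3"
  shows "lattice_theta (bco 1 t) 1 < lattice_theta (bco y t) 1"
proof -
  define f g A B where "f y = theta3 y * theta3 (1 / y)" and "g y = theta2 y * theta2 (1 / y)"
    and "A = theta3 (t\<^sup>2)" and "B = theta2 (t\<^sup>2)" for y
  have t0: "t > 0" using t by simp
  have A: "A > 0" using theta3_gt_1[of "t\<^sup>2"] t0 by (simp add: A_def)
  have B: "0 < B" "B \<le> 921 / 1000 * A"
    using theta2_pos[of "t\<^sup>2"] theta2_theta3_ratio[OF t] t0 by (simp_all add: A_def B_def)
  have f: "f 1 < f y" using theta3_prod_strict_mono[of 1 1 y] y by (simp add: f_def)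
  have fg: "f y - f 1 + 921 / 1000 * (g y - g 1) > 0"
    using theta_combination_min_1[OF y] unfolding f_def g_def right_diff_distrib by simp
  have "A * (f y - f 1) + B * (g y - g 1) > 0"
  proof (cases "g y \<ge> g 1")
    case True
    then show ?thesis using A B f by (intro add_pos_nonneg mult_pos_pos mult_nonneg_nonneg) auto
  next
    case False
    then have "921 / 1000 * A * (g y - g 1) \<le> B * (g y - g 1)"
      using B by (intro mult_right_mono_neg) auto
    moreover have "A * (f y - f 1 + 921 / 1000 * (g y - g 1)) > 0" using A fg by (intro mult_pos_pos)
    ultimately show ?thesis by (simp add: algebra_simps)
  qed
  then show ?thesis
    using t0 y by (simp add: lattice_theta_bco f_def g_def A_def B_def algebra_simps)
qed

lemma bco_minimizer_iff:
  assumes t: "t \<ge> 9 / 10"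
  shows "is_arg_min (\<lambda>y. lattice_theta (bco y t) 1) (\<lambda>y. 1 \<le> y) y \<longleftrightarrow> y = 1"
proof -
  have "y = 1" if "is_arg_min (\<lambda>y. lattice_theta (bco y t) 1) (\<lambda>y. 1 \<le> y) y" for y
  proof (rule ccontr)
    assume "y \<noteq> 1"
    moreover have "y \<in> {1..sqrt 3}" using t that by (intro bco_minimizer_le_sqrt3[of t 1]) auto
    ultimately have "lattice_theta (bco 1 t) 1 < lattice_theta (bco y t) 1"
      using t by (intro lattice_theta_bco_1_less) auto
    then show False using that by (auto simp: is_arg_min_def)
  qed
  \<comment> \<open>Excluding all other points shows only that nothing but 1 can be a minimizer;
    existence makes 1 one.\<close>
  moreover have "\<exists>y. is_arg_min (\<lambda>y. lattice_theta (bco y t) 1) (\<lambda>y. 1 \<le> y) y"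
    using t by (intro bco_minimizer_exists) auto
  ultimately show ?thesis by blast
qed

section \<open>The cubic lattices of density one, and the final assembly\<close>

lemma bcc_unit_not_local_minimizer:
  assumes "\<alpha> > 2385 / 1000"
  shows "\<not> local_minimizer unit_density_lattices (\<lambda>\<Lambda>. lattice_theta \<Lambda> \<alpha>) bcc_unit"
proof
  define \<beta> where "\<beta> = (root 3 2)\<^sup>2 * \<alpha>"
  \<comment> \<open>Rescaling to density one replaces \<alpha> by a larger parameter, so the
    threshold found for \<open>bco y 1\<close> is sufficient.\<close>
  have "1 \<le> root 3 (2::real)" by simp
  then have "1 * \<alpha> \<le> \<beta>" unfolding \<beta>_def using assms by (intro mult_right_mono one_le_power) auto
  then have "\<beta> > 2385 / 1000" using assms by simp
  then have less: "\<forall>\<^sub>F y in at_right 1. lattice_theta (bco y 1) \<beta> < lattice_theta (bco 1 1) \<beta>"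
    by (rule bco_1_not_local_minimizer)
  assume "local_minimizer unit_density_lattices (\<lambda>\<Lambda>. lattice_theta \<Lambda> \<alpha>) bcc_unit"
  then have le: "\<forall>\<^sub>F y in at_right 1. lattice_theta bcc_unit \<alpha> \<le> lattice_theta (dilate y ` bcc_unit) \<alpha>"
    by (rule local_minimizer_imp_eventually_dilate)
  have eq: "lattice_theta bcc_unit \<alpha> = lattice_theta (bco 1 1) \<beta>"
    by (simp add: bcc_unit_def bco_1_1 lattice_theta_scaleR \<beta>_def)
  from less le have "\<forall>\<^sub>F y in at_right (1::real). False"
    unfolding lattice_theta_dilate_bcc_unit eq \<beta>_def[symmetric] by eventually_elim simp
  then show False by simp
qed

lemma dilate_1: "dilate 1 p = p"
  by (simp add: dilate_def dilation_factors_def vec_eq_iff forall_3)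

lemma fcc_unit_not_local_minimizer:
  assumes \<alpha>: "0 < \<alpha>" "\<alpha> < 1 / (2385 / 1000)"
  shows "\<not> local_minimizer unit_density_lattices (\<lambda>\<Lambda>. lattice_theta \<Lambda> \<alpha>) fcc_unit"
proof
  define \<beta> where "\<beta> = 4 / ((root 3 4)\<^sup>2 * \<alpha>)"
  have "root 3 4 ^ 3 = (4::real)" by simp
  moreover have "1 \<le> root 3 (4::real)" by simp
  \<comment> \<open>The square of the scaling factor is at most its cube 4, so the dual parameter is
    at least 1/\<alpha>.\<close>
  then have "(root 3 4)\<^sup>2 \<le> root 3 (4::real) ^ 3" by (intro power_increasing) auto
  ultimately have "(root 3 4)\<^sup>2 \<le> (4::real)" by simp
  then have "(root 3 4)\<^sup>2 * \<alpha> \<le> 4 * \<alpha>" using \<alpha> by (intro mult_right_mono) auto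
  moreover have "(root 3 4)\<^sup>2 * \<alpha> > 0" using \<alpha> by simp
  ultimately have "4 / (4 * \<alpha>) \<le> \<beta>" unfolding \<beta>_def by (intro divide_left_mono) auto
  moreover have "4 / (4 * \<alpha>) > 2385 / 1000" using \<alpha> by (simp add: field_simps)
  ultimately have \<beta>: "\<beta> > 2385 / 1000" by linarith
  then have less: "\<forall>\<^sub>F y in at_right 1. lattice_theta (bco y 1) \<beta> < lattice_theta (bco 1 1) \<beta>"
    by (rule bco_1_not_local_minimizer)
  define c where "c = \<beta> * sqrt \<beta> / 2"
  have c: "c > 0" using \<beta> by (simp add: c_def)
  have dual: "lattice_theta (dilate y ` fcc_unit) \<alpha> = c * lattice_theta (bco y 1) \<beta>" if "y > 0" for y
    unfolding c_def \<beta>_def by (rule lattice_theta_dilate_fcc_unit[OF that \<alpha>(1)])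
  assume "local_minimizer unit_density_lattices (\<lambda>\<Lambda>. lattice_theta \<Lambda> \<alpha>) fcc_unit"
  then have le: "\<forall>\<^sub>F y in at_right 1. lattice_theta fcc_unit \<alpha> \<le> lattice_theta (dilate y ` fcc_unit) \<alpha>"
    by (rule local_minimizer_imp_eventually_dilate)
  have eq: "lattice_theta fcc_unit \<alpha> = c * lattice_theta (bco 1 1) \<beta>"
    using dual[of 1] by (simp add: dilate_1)
  have "\<forall>\<^sub>F y::real in at_right 1. y > 1" by (simp add: eventually_at_right_less)
  with less le have "\<forall>\<^sub>F y in at_right (1::real). False"
    unfolding eq by eventually_elim (use c in \<open>simp add: dual\<close>)
  then show False by simp
qed

theorem theorem1p7:
  shows
    "(\<forall>t>0. \<forall>\<alpha>>0.
        (\<exists>y. is_arg_min (\<lambda>y. lattice_theta (bco y t) \<alpha>) (\<lambda>y. 1 \<le> y) y) \<and>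
        (\<forall>y. is_arg_min (\<lambda>y. lattice_theta (bco y t) \<alpha>) (\<lambda>y. 1 \<le> y) y \<longrightarrow> y \<in> {1..sqrt 3}))
     \<and>
     (\<forall>\<alpha>>0. \<exists>t0>0. \<forall>t. 0 < t \<and> t < t0 \<longrightarrow>
        \<not> is_arg_min (\<lambda>y. lattice_theta (bco y t) \<alpha>) (\<lambda>y. 1 \<le> y) 1)
     \<and>
     (\<forall>t. 0 < t \<and> t < sqrt 2 \<longrightarrow> (\<exists>\<alpha>t>0. \<forall>\<alpha>>\<alpha>t.
        \<not> is_arg_min (\<lambda>y. lattice_theta (bco y t) \<alpha>) (\<lambda>y. 1 \<le> y) 1))
     \<and>
     (\<exists>\<alpha>1>0.
        (\<forall>\<alpha>>\<alpha>1. \<not> is_arg_min (\<lambda>y. lattice_theta (bco y 1) \<alpha>) (\<lambda>y. 1 \<le> y) 1) \<and>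
        (\<forall>\<alpha>>\<alpha>1. \<not> local_minimizer unit_density_lattices (\<lambda>\<Lambda>. lattice_theta \<Lambda> \<alpha>) bcc_unit) \<and>
        (\<forall>\<alpha>. 0 < \<alpha> \<and> \<alpha> < 1 / \<alpha>1 \<longrightarrow>
           \<not> local_minimizer unit_density_lattices (\<lambda>\<Lambda>. lattice_theta \<Lambda> \<alpha>) fcc_unit) \<and>
        \<bar>\<alpha>1 - 2.38\<bar> \<le> 0.005 \<and> \<bar>1 / \<alpha>1 - 0.42\<bar> \<le> 0.005)
     \<and>
     (\<forall>t\<ge>0.9. \<forall>y.
        is_arg_min (\<lambda>y. lattice_theta (bco y t) 1) (\<lambda>y. 1 \<le> y) y \<longleftrightarrow> y = 1)
     \<and>
     (\<forall>\<Lambda>. is_arg_min (\<lambda>\<Lambda>. lattice_theta \<Lambda> 1) (\<lambda>\<Lambda>. \<Lambda> \<in> (\<lambda>y. bco y 1) ` {1..}) \<Lambda> \<longleftrightarrow> \<Lambda> = bcc)"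
proof (intro conjI)
  show "\<forall>t>0. \<forall>\<alpha>>0.
        (\<exists>y. is_arg_min (\<lambda>y. lattice_theta (bco y t) \<alpha>) (\<lambda>y. 1 \<le> y) y) \<and>
        (\<forall>y. is_arg_min (\<lambda>y. lattice_theta (bco y t) \<alpha>) (\<lambda>y. 1 \<le> y) y \<longrightarrow> y \<in> {1..sqrt 3})"
    using bco_minimizer_exists bco_minimizer_le_sqrt3 by blast
  show "\<forall>\<alpha>>0. \<exists>t0>0. \<forall>t. 0 < t \<and> t < t0 \<longrightarrow>
        \<not> is_arg_min (\<lambda>y. lattice_theta (bco y t) \<alpha>) (\<lambda>y. 1 \<le> y) 1"
    using bco_1_not_minimizer_small_t by blast
  show "\<forall>t. 0 < t \<and> t < sqrt 2 \<longrightarrow> (\<exists>\<alpha>t>0. \<forall>\<alpha>>\<alpha>t.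
        \<not> is_arg_min (\<lambda>y. lattice_theta (bco y t) \<alpha>) (\<lambda>y. 1 \<le> y) 1)"
    using bco_1_not_minimizer_large_alpha by blast
  have "\<not> is_arg_min (\<lambda>y. lattice_theta (bco y 1) \<alpha>) (\<lambda>y. 1 \<le> y) 1" if "\<alpha> > 2385 / 1000" for \<alpha>
  proof -
    have "\<forall>\<^sub>F y in at_right 1. lattice_theta (bco y 1) \<alpha> < lattice_theta (bco 1 1) \<alpha> \<and> 1 < y"
      using bco_1_not_local_minimizer[OF that] by (auto intro: eventually_conj simp: eventually_at_right_less)
    then obtain y where "lattice_theta (bco y 1) \<alpha> < lattice_theta (bco 1 1) \<alpha>" "1 < y"
      using eventually_happens[of _ "at_right (1::real)"] by auto
    then show ?thesis by (intro bco_1_not_minimizer_if[of y]) auto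
  qed
  then show "\<exists>\<alpha>1>0.
        (\<forall>\<alpha>>\<alpha>1. \<not> is_arg_min (\<lambda>y. lattice_theta (bco y 1) \<alpha>) (\<lambda>y. 1 \<le> y) 1) \<and>
        (\<forall>\<alpha>>\<alpha>1. \<not> local_minimizer unit_density_lattices (\<lambda>\<Lambda>. lattice_theta \<Lambda> \<alpha>) bcc_unit) \<and>
        (\<forall>\<alpha>. 0 < \<alpha> \<and> \<alpha> < 1 / \<alpha>1 \<longrightarrow>
           \<not> local_minimizer unit_density_lattices (\<lambda>\<Lambda>. lattice_theta \<Lambda> \<alpha>) fcc_unit) \<and>
        \<bar>\<alpha>1 - 2.38\<bar> \<le> 0.005 \<and> \<bar>1 / \<alpha>1 - 0.42\<bar> \<le> 0.005"
    using bcc_unit_not_local_minimizer fcc_unit_not_local_minimizer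
    by (intro exI[of _ "2385 / 1000"] conjI allI impI) (auto simp: abs_if)
  show "\<forall>t\<ge>0.9. \<forall>y. is_arg_min (\<lambda>y. lattice_theta (bco y t) 1) (\<lambda>y. 1 \<le> y) y \<longleftrightarrow> y = 1"
    using bco_minimizer_iff by simp
  have iff: "is_arg_min (\<lambda>y. lattice_theta (bco y 1) 1) (\<lambda>y. 1 \<le> y) y \<longleftrightarrow> y = 1" for y
    by (rule bco_minimizer_iff) simp
  have "is_arg_min (\<lambda>\<Lambda>. lattice_theta \<Lambda> 1) (\<lambda>\<Lambda>. \<Lambda> \<in> (\<lambda>y. bco y 1) ` {1..}) \<Lambda> \<longleftrightarrow>
      (\<exists>y. \<Lambda> = bco y 1 \<and> is_arg_min (\<lambda>y. lattice_theta (bco y 1) 1) (\<lambda>y. 1 \<le> y) y)" for \<Lambda>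
    by (auto simp: is_arg_min_def)
  then show "\<forall>\<Lambda>. is_arg_min (\<lambda>\<Lambda>. lattice_theta \<Lambda> 1) (\<lambda>\<Lambda>. \<Lambda> \<in> (\<lambda>y. bco y 1) ` {1..}) \<Lambda> \<longleftrightarrow> \<Lambda> = bcc"
    by (simp add: iff bco_1_1)
qed

end
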